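(* Consider, for a parameter $\lambda\in\mathbb{R}$, the initial boundary value problem $$u_{xt}+uu_{xx}-\lambda u_x^2=I(t),\quad I(t)=-(\lambda+1)\int_0^1u_x^2\,dx,\quad t>0,\qquad u(x,0)=u_0(x),\ x\in[0,1],$$ with periodic boundary conditions $u(0,t)=u(1,t)$, $u_x(0,t)=u_x(1,t)$. There exist smooth, $1$-periodic initial data $u_0$ (so that $u_0'$ has mean zero on $[0,1]$) such that the following hold. (1) For $\lambda\in[0,1]$ the solution exists for all $t\ge0$. Moreover, for $\lambda\in(0,1)$, $u_x(\gamma(\alpha,t),t)\to0$ as $t\to+\infty$ for every $\alpha\in[0,1]$, while for $\lambda=1$, $u_x(\gamma(\alpha,t),t)$ converges as $t\to+\infty$ to a limit which is not identically zero (a non-trivial steady state). (2) For $\lambda\in(-\infty,-2]\cup(1,+\infty)$ there is a finite $t_*>0$ such that $M(t)\to+\infty$ and $m(t)\to-\infty$ as $t\uparrow t_*$, and moreover $\lim_{t\uparrow t_*}|u_x(\gamma(\alpha,t),t)|=+\infty$ for every $\alpha\notin\{\overline\alpha_i\}\cup\{\underline\alpha_j\}$ (two-sided, everywhere blow-up). (3) For $\lambda\in(-2,0)$ there is a finite $t_*>0$ such that $m(t)\to-\infty$ as $t\uparrow t_*$, while $u_x(\gamma(\alpha,t),t)$ remains bounded on $[0,t_* )$ for every $\alpha\notin\{\underline\alpha_j\}$ (one-sided, discrete blow-up: only the minimum diverges).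
   Context: For a solution $u$, $\gamma(\alpha,t)$ denotes the characteristic (Lagrangian flow map): $\dot\gamma(\alpha,t)=u(\gamma(\alpha,t),t)$, $\gamma(\alpha,0)=\alpha\in[0,1]$; $\gamma_\alpha$ is its derivative in $\alpha$ (the jacobian). $M(t)=\sup_{\alpha\in[0,1]}u_x(\gamma(\alpha,t),t)$ and $m(t)=\inf_{\alpha\in[0,1]}u_x(\gamma(\alpha,t),t)$. $M_0=\max u_0'>0$ and $m_0=\min u_0'<0$; $\overline\alpha_i$ ($1\le i\le m$) are the finitely many points of $[0,1]$ where $u_0'=M_0$, and $\underline\alpha_j$ ($1\le j\le n$) the finitely many points where $u_0'=m_0$. *)

theory Defs
  imports "HOL-Analysis.Analysis"
begin

definition ux :: "(real \<Rightarrow> real \<Rightarrow> real) \<Rightarrow> real \<Rightarrow> real \<Rightarrow> real" where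
  "ux u x t = deriv (\<lambda>y. u y t) x"

definition uxx :: "(real \<Rightarrow> real \<Rightarrow> real) \<Rightarrow> real \<Rightarrow> real \<Rightarrow> real" where
  "uxx u x t = deriv (\<lambda>y. ux u y t) x"

definition uxt :: "(real \<Rightarrow> real \<Rightarrow> real) \<Rightarrow> real \<Rightarrow> real \<Rightarrow> real" where
  "uxt u x t = deriv (\<lambda>s. ux u x s) t"

definition smooth_periodic :: "(real \<Rightarrow> real) \<Rightarrow> bool" where
  "smooth_periodic u0 \<longleftrightarrow>
     (\<forall>n x. ((deriv ^^ n) u0) differentiable (at x)) \<and> (\<forall>x. u0 (x + 1) = u0 x)"

text \<open>Classical solution on the time interval J (J = {0..<T} or {0..}) of
  u_xt + u u_xx - lam u_x^2 = -(lam+1) \<integral>_0^1 u_x^2 dx, u(x,0) = u0 x,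
  with periodic boundary conditions (u is 1-periodic in x, defined for all real x).\<close>
definition is_solution ::
  "real \<Rightarrow> (real \<Rightarrow> real) \<Rightarrow> real set \<Rightarrow> (real \<Rightarrow> real \<Rightarrow> real) \<Rightarrow> bool" where
  "is_solution lam u0 J u \<longleftrightarrow>
     (\<forall>x. u x 0 = u0 x) \<and>
     (\<forall>x. \<forall>t\<in>J. u (x + 1) t = u x t) \<and>
     (\<forall>x. \<forall>t\<in>J. ((\<lambda>y. u y t) has_real_derivative ux u x t) (at x)) \<and>
     (\<forall>x. \<forall>t\<in>J. ((\<lambda>y. ux u y t) has_real_derivative uxx u x t) (at x)) \<and>
     (\<forall>x. \<forall>t\<in>J. 0 < t \<longrightarrow> ((\<lambda>s. ux u x s) has_real_derivative uxt u x t) (at t)) \<and>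
     continuous_on (UNIV \<times> J) (\<lambda>(x, t). u x t) \<and>
     continuous_on (UNIV \<times> J) (\<lambda>(x, t). ux u x t) \<and>
     continuous_on (UNIV \<times> J) (\<lambda>(x, t). uxx u x t) \<and>
     continuous_on (UNIV \<times> {t\<in>J. 0 < t}) (\<lambda>(x, t). uxt u x t) \<and>
     (\<forall>x. \<forall>t\<in>J. 0 < t \<longrightarrow>
        uxt u x t + u x t * uxx u x t - lam * (ux u x t)\<^sup>2
          = - (lam + 1) * integral {0..1} (\<lambda>y. (ux u y t)\<^sup>2))"

definition is_flow ::
  "(real \<Rightarrow> real \<Rightarrow> real) \<Rightarrow> real set \<Rightarrow> (real \<Rightarrow> real \<Rightarrow> real) \<Rightarrow> bool" where
  "is_flow u J \<gamma> \<longleftrightarrow>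
     (\<forall>\<alpha>\<in>{0..1}. \<gamma> \<alpha> 0 = \<alpha> \<and>
        (\<forall>t\<in>J. ((\<lambda>s. \<gamma> \<alpha> s) has_real_derivative u (\<gamma> \<alpha> t) t) (at t within J)))"

definition Mfun :: "(real \<Rightarrow> real \<Rightarrow> real) \<Rightarrow> (real \<Rightarrow> real \<Rightarrow> real) \<Rightarrow> real \<Rightarrow> real" where
  "Mfun u \<gamma> t = (SUP \<alpha>\<in>{0..1}. ux u (\<gamma> \<alpha> t) t)"

definition mfun :: "(real \<Rightarrow> real \<Rightarrow> real) \<Rightarrow> (real \<Rightarrow> real \<Rightarrow> real) \<Rightarrow> real \<Rightarrow> real" where
  "mfun u \<gamma> t = (INF \<alpha>\<in>{0..1}. ux u (\<gamma> \<alpha> t) t)"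

definition M0 :: "(real \<Rightarrow> real) \<Rightarrow> real" where
  "M0 u0 = (SUP \<alpha>\<in>{0..1}. deriv u0 \<alpha>)"

definition m0 :: "(real \<Rightarrow> real) \<Rightarrow> real" where
  "m0 u0 = (INF \<alpha>\<in>{0..1}. deriv u0 \<alpha>)"

definition max_pts :: "(real \<Rightarrow> real) \<Rightarrow> real set" where
  "max_pts u0 = {\<alpha>\<in>{0..1}. deriv u0 \<alpha> = M0 u0}"

definition min_pts :: "(real \<Rightarrow> real) \<Rightarrow> real set" where
  "min_pts u0 = {\<alpha>\<in>{0..1}. deriv u0 \<alpha> = m0 u0}"

end

theory Submission
  imports Defs
begin

text \<open>
  Take \<open>u0 x = sin (2 \<pi> x) / (2 \<pi>)\<close>, so \<open>u0' = c\<close> with \<open>c a = cos (2 \<pi> a)\<close>. Along characteristics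
  \<open>v = u_x\<close> satisfies the Riccati equation \<open>v_t = \<lambda> v\<^sup>2 + I(t)\<close>. In a new time \<open>\<eta>\<close> it is solved by
  \<open>v = h (r - P)\<close> and the Jacobian is \<open>K / Kb\<close>, where \<open>K = (1 - \<lambda> \<eta> c) powr (-1/\<lambda>)\<close> (\<open>exp (\<eta> c)\<close>
  for \<open>\<lambda> = 0\<close>), \<open>r = c / (1 - \<lambda> \<eta> c)\<close>, \<open>Kb\<close> is the mean of \<open>K\<close>, \<open>P = Kb' / Kb\<close> and
  \<open>d\<eta>/dt = h = Kb powr (-2 \<lambda>)\<close>. Integrating the Jacobian gives the flow, and inverting the flow gives \<open>u\<close>.

  Everything is then decided by the behaviour of \<open>Kb\<close> and \<open>P\<close> as \<open>\<eta>\<close> tends to \<open>1 / \<bar>\<lambda>\<bar>\<close>, where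
  \<open>1 - \<lambda> \<eta> c\<close> first vanishes, quadratically in \<open>a\<close>, at the extremum of \<open>c\<close>: it is comparable to
  \<open>\<epsilon> + a\<^sup>2\<close> with \<open>\<epsilon> = 1 - \<bar>\<lambda>\<bar> \<eta>\<close>, \<open>a\<close> being measured from that extremum. For \<open>0 < \<lambda> \<le> 1\<close> this
  makes \<open>dt/d\<eta>\<close> at least of order \<open>1 / \<epsilon>\<close>, so the time \<open>t\<close> runs to infinity; for \<open>\<lambda> > 1\<close>
  and \<open>\<lambda> < 0\<close> the total time is finite, and \<open>P\<close> stays bounded exactly for \<open>-2 < \<lambda> < 0\<close>. At the extremum itself the competition
  between \<open>r\<close> and \<open>P\<close> is resolved by a contiguity relation for these (Legendre) integrals.
\<close>

subsection \<open>Primitives depending on a parameter\<close>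

text \<open>The ansatz comes from a linearisation. With \<open>w\<close> the Jacobian,
  \<open>w_t = v w\<close>; so for \<lambda> nonzero \<open>y = w powr (-\<lambda>)\<close>
  satisfies \<open>y_tt = -\<lambda> I(t) y\<close>, a linear equation whose coefficient is the same
  for every label. Reduction of order writes the solution with \<open>y = 1\<close>,
  \<open>y_t = -\<lambda> c\<close> at time 0 as \<open>\<phi> (1 - \<lambda> \<eta> c)\<close>,
  where \<open>\<phi>\<close> depends on t only and \<open>d\<eta>/dt = 1 / \<phi>^2\<close>.
  Periodicity forces \<open>w\<close> to have mean 1, hence
  \<open>\<phi> = Kb powr \<lambda>\<close>, and the unknown nonlocal I(t) disappears. The
  thresholds come from the mean of \<open>(\<epsilon> + a^2) powr (-k)\<close>: bounded for k < 1/2,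
  logarithmic at k = 1/2, of order \<open>\<epsilon> powr (1/2 - k)\<close> beyond.
  \<open>Kb\<close> has k = 1/\<lambda>, so for 0 < \<lambda> < 2 the speed
  \<open>dt/d\<eta>\<close> is of order \<open>\<epsilon> powr (\<lambda> - 2)\<close>, which fails
  to be integrable exactly when \<lambda> \<le> 1. The numerator of \<open>P\<close> has k = 1 +
  1/\<lambda>, and for negative \<lambda> this drops below 1/2 exactly when \<lambda> > -2. The
  claims concern every flow of the constructed u, so uniqueness of trajectories has to be proved as
  well.\<close>

text \<open>The primitive of \<open>f\<close> vanishing at 0, rescaled to the fixed interval [0,1]:
  both signs of \<open>a\<close> are covered at once, and dependence on a parameter is handled by
  theorems over a constant domain.\<close>

definition prim :: "(real \<Rightarrow> real) \<Rightarrow> real \<Rightarrow> real" where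
  "prim f a = a * integral {0..1} (\<lambda>s. f (a * s))"

lemma prim_0 [simp]: "prim f 0 = 0"
  by (simp add: prim_def)

lemma prim_1: "prim f 1 = integral {0..1} f"
  by (simp add: prim_def)

text \<open>By convexity \<open>s -> a * s\<close> maps [0,1] into \<open>D\<close>, so the
  fundamental theorem applies to \<open>F (a * s)\<close> for either sign of
  \<open>a\<close>.\<close>

lemma prim_eq_diff:
  fixes D :: "real set"
  assumes D: "convex D" "0 \<in> D" "a \<in> D"
    and F: "\<And>x. x \<in> D \<Longrightarrow> (F has_real_derivative f x) (at x within D)"
  shows "prim f a = F a - F 0"
proof -
  have *: "a * s \<in> D" if "s \<in> {0..1}" for s
    using convexD[OF D(1) D(2) D(3), of "1 - s" s] that by (simp add: mult.commute)
  have "((\<lambda>s. F (a * s)) has_vector_derivative a * f (a * s)) (at s within {0..1})"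
    if "s \<in> {0..1}" for s
  proof -
    have "(F has_real_derivative f (a * s)) (at (a * s) within (\<lambda>s. a * s) ` {0..1})"
      by (rule DERIV_subset[OF F[OF *[OF that]]]) (use * in auto)
    from DERIV_image_chain[OF this DERIV_cmult_Id]
    show ?thesis
      by (simp add: has_real_derivative_iff_has_vector_derivative o_def mult.commute)
  qed
  from fundamental_theorem_of_calculus[OF zero_le_one this]
  have "((\<lambda>s. a * f (a * s)) has_integral F a - F 0) {0..1}" by simp
  then show ?thesis by (simp add: prim_def has_integral_iff)
qed

lemma prim_has_real_derivative:
  fixes D :: "real set"
  assumes D: "open D" "convex D" "0 \<in> D" "a \<in> D" and f: "continuous_on D f"
  shows "(prim f has_real_derivative f a) (at a)"
proof -
  obtain e where e: "e > 0" "ball (min a 0) e \<subseteq> D"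
    using D by (metis min_def openE)
  obtain e' where e': "e' > 0" "ball (max a 0) e' \<subseteq> D"
    using D by (metis max_def openE)
  \<comment> \<open>A closed interval in \<open>D\<close> with both 0 and \<open>a\<close> in its
    interior; on it \<open>prim f\<close> differs by a constant from an ordinary indefinite
    integral.\<close>
  define l where "l = min a 0 - e / 2"
  define r where "r = max a 0 + e' / 2"
  have lr: "l \<in> D" "r \<in> D" "l < a" "a < r" "l < 0" "0 < r"
    using e e' by (auto simp: l_def r_def dist_real_def subset_iff)
  have sub: "{l..r} \<subseteq> D"
    using lr \<open>convex D\<close> closed_segment_eq_real_ivl1[of l r] closed_segment_subset[of l D r] by auto
  define F where "F x = integral {l..x} f" for x
  have F: "(F has_real_derivative f x) (at x within {l..r})" if "x \<in> {l..r}" for x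
    unfolding F_def
    using integral_has_real_derivative[OF continuous_on_subset[OF f sub] that] .
  have eq: "prim f x = F x - F 0" if "x \<in> {l<..<r}" for x
    by (rule prim_eq_diff[of "{l..r}"]) (use that lr F in auto)
  have "(F has_real_derivative f a) (at a)"
    using F[of a] lr at_within_interior[of a "{l..r}"] by auto
  then have "((\<lambda>x. F x - F 0) has_real_derivative f a) (at a)"
    by (auto intro!: derivative_eq_intros)
  then show ?thesis
    by (rule has_field_derivative_transform_within_open[of _ _ _ "{l<..<r}"])
      (use lr eq in auto)
qed

lemma prim_diff_has_integral:
  assumes "continuous_on UNIV f" "a \<le> b"
  shows "(f has_integral (prim f b - prim f a)) {a..b}"
  using assms prim_has_real_derivative[OF open_UNIV convex_UNIV]
  by (intro fundamental_theorem_of_calculus)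
    (auto simp: has_real_derivative_iff_has_vector_derivative[symmetric] intro: has_field_derivative_at_within)

lemma continuous_on_prim:
  assumes "continuous_on (UNIV \<times> S) (\<lambda>(a, t). f a t)"
  shows "continuous_on (UNIV \<times> S) (\<lambda>(a, t). prim (\<lambda>b. f b t) a)"
proof -
  have "continuous_on ((UNIV \<times> S) \<times> cbox 0 1) (\<lambda>(p, s). (\<lambda>(a, t). f a t) (fst p * s, snd p))"
    unfolding split_beta
    by (rule continuous_on_compose2[OF assms[unfolded split_beta]])
      (auto intro!: continuous_intros)
  then have "continuous_on ((UNIV \<times> S) \<times> cbox 0 1) (\<lambda>(p, s). f (fst p * s) (snd p))"
    by simp
  from integral_continuous_on_param[OF this]
  show ?thesis
    by (auto simp: prim_def split_beta intro!: continuous_intros)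
qed

lemma prim_param_has_real_derivative:
  assumes S: "open S" "convex S" "t \<in> S"
    and f: "continuous_on (UNIV \<times> S) (\<lambda>(a, t). f a t)"
    and f': "continuous_on (UNIV \<times> S) (\<lambda>(a, t). f' a t)"
    and der: "\<And>a t. t \<in> S \<Longrightarrow> ((\<lambda>t. f a t) has_real_derivative f' a t) (at t)"
  shows "((\<lambda>t. prim (\<lambda>b. f b t) a) has_real_derivative prim (\<lambda>b. f' b t) a) (at t)"
proof -
  have c: "continuous_on (S \<times> cbox 0 1) (\<lambda>(t, s). g (a * s) t)"
    if "continuous_on (UNIV \<times> S) (\<lambda>(a, t). g a t)" for g :: "real \<Rightarrow> real \<Rightarrow> real"
  proof -
    have "continuous_on (S \<times> cbox 0 1) (\<lambda>p. (\<lambda>(a, t). g a t) (a * snd p, fst p))"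
      by (rule continuous_on_compose2[OF that]) (auto intro!: continuous_intros)
    then show ?thesis by (simp add: split_beta)
  qed
  have int: "(\<lambda>s. f (a * s) x) integrable_on cbox 0 1" if "x \<in> S" for x
  proof (rule integrable_continuous)
    have "continuous_on (cbox 0 1) (\<lambda>s. (\<lambda>(a, t). f a t) (a * s, x))"
      by (rule continuous_on_compose2[OF f]) (use that in \<open>auto intro!: continuous_intros\<close>)
    then show "continuous_on (cbox 0 1) (\<lambda>s. f (a * s) x)" by simp
  qed
  have "((\<lambda>t. integral (cbox 0 1) (\<lambda>s. f (a * s) t)) has_field_derivative
      integral (cbox 0 1) (\<lambda>s. f' (a * s) t)) (at t within S)"
    by (rule leibniz_rule_field_derivative[where U = S])
      (use c[OF f'] int S in \<open>auto intro: has_field_derivative_at_within der\<close>)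
  then have "((\<lambda>t. integral {0..1} (\<lambda>s. f (a * s) t)) has_real_derivative
      integral {0..1} (\<lambda>s. f' (a * s) t)) (at t)"
    using S by (simp add: at_within_open[of t S])
  from DERIV_cmult[OF this, of a] show ?thesis by (simp add: prim_def)
qed

subsection \<open>From Lagrangian to Eulerian variables\<close>

text \<open>One jointly continuous partial derivative suffices for total differentiability; the time
  partial enters only at the point itself.\<close>

lemma has_derivative_of_partials:
  fixes f :: "real \<Rightarrow> real \<Rightarrow> real"
  assumes S: "open S" "t \<in> S"
    and ft: "((\<lambda>t. f a t) has_real_derivative ft) (at t)"
    and fa: "\<And>a t. t \<in> S \<Longrightarrow> ((\<lambda>a. f a t) has_real_derivative fa a t) (at a)"
    and cont: "continuous_on (UNIV \<times> S) (\<lambda>(a, t). fa a t)"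
  shows "((\<lambda>(t, a). f a t) has_derivative (\<lambda>(dt, da). ft * dt + fa a t * da)) (at (t, a))"
proof -
  have "((\<lambda>(t, a). f a t) has_derivative
      (\<lambda>(dt, da). ft * dt + blinfun_apply (blinfun_mult_right (fa a t)) da)) (at (t, a) within S \<times> UNIV)"
  proof (rule has_derivative_partialsI)
    show "((\<lambda>t. f a t) has_derivative (*) ft) (at t within S)"
      using has_field_derivative_at_within[OF ft] by (simp add: has_field_derivative_def)
    show "((\<lambda>y. f y x) has_derivative blinfun_apply (blinfun_mult_right (fa y x))) (at y within UNIV)"
      if "x \<in> S" for x y
      using fa[OF that, of y] by (simp add: has_field_derivative_def)
    have "continuous_on (S \<times> UNIV) (\<lambda>p. (\<lambda>(a, t). fa a t) (snd p, fst p))"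
      by (rule continuous_on_compose2[OF cont]) (auto intro!: continuous_intros)
    then have "continuous_on (S \<times> UNIV) (\<lambda>(t, a). blinfun_mult_right (fa a t))"
      by (auto simp: split_beta intro!: continuous_intros)
    then show "continuous (at (t, a) within S \<times> UNIV) (\<lambda>(t, a). blinfun_mult_right (fa a t))"
      using S by (simp add: continuous_on_eq_continuous_within)
  qed auto
  moreover have "at (t, a) within S \<times> UNIV = at (t, a)"
    using S by (intro at_within_open) (auto intro: open_Times)
  ultimately show ?thesis by simp
qed

text \<open>\<open>F (a + 1) - F a\<close> has derivative zero. Applied to the primitives of
  \<open>w\<close> (increment 1) and of \<open>v * w\<close> (increment 0).\<close>

lemma quasi_periodic:
  fixes F f :: "real \<Rightarrow> real"
  assumes "\<And>a. (F has_real_derivative f a) (at a)" "\<And>a. f (a + 1) = f a" "F 0 = 0"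
  shows "F (a + 1) = F a + F 1"
proof -
  have "((\<lambda>a. F (a + 1) - F a) has_real_derivative 0) (at x)" for x
  proof -
    have "((\<lambda>a. F (a + 1)) has_real_derivative f (x + 1) * 1) (at x)"
      by (rule DERIV_chain2[OF assms(1)]) (auto intro!: derivative_eq_intros)
    from DERIV_diff[OF this assms(1)] show ?thesis by (simp add: assms(2))
  qed
  then have "F (a + 1) - F a = F (0 + 1) - F 0"
    using DERIV_isconst_all[of "\<lambda>a. F (a + 1) - F a" a 0] by blast
  then show ?thesis using assms(3) by simp
qed

text \<open>\<open>w\<close> is the Jacobian, \<open>v\<close> is \<open>u_x\<close> and
  \<open>va\<close> its label derivative, all along characteristics. \<open>v_deriv_t\<close> is the
  equation in Lagrangian form; \<open>w_integral\<close> makes the flow commute with the unit shift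
  and \<open>vw_integral\<close> makes u periodic. \<open>S\<close> is open around 0, so one-sided
  derivatives do not arise in the construction.\<close>

locale lagrangian_solution =
  fixes lam :: real and u0 :: "real \<Rightarrow> real" and S :: "real set"
    and w v va :: "real \<Rightarrow> real \<Rightarrow> real"
  assumes open_S: "open S" and convex_S: "convex S" and zero_S: "0 \<in> S"
    and w_pos: "t \<in> S \<Longrightarrow> w a t > 0"
    and w_cont: "continuous_on (UNIV \<times> S) (\<lambda>(a, t). w a t)"
    and w_periodic: "t \<in> S \<Longrightarrow> w (a + 1) t = w a t"
    and w_integral: "t \<in> S \<Longrightarrow> integral {0..1} (\<lambda>a. w a t) = 1"
    and w_0: "w a 0 = 1"
    and w_deriv: "t \<in> S \<Longrightarrow> ((\<lambda>t. w a t) has_real_derivative v a t * w a t) (at t)"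
    and v_cont: "continuous_on (UNIV \<times> S) (\<lambda>(a, t). v a t)"
    and va_cont: "continuous_on (UNIV \<times> S) (\<lambda>(a, t). va a t)"
    and v_periodic: "t \<in> S \<Longrightarrow> v (a + 1) t = v a t"
    and v_deriv_a: "t \<in> S \<Longrightarrow> ((\<lambda>a. v a t) has_real_derivative va a t) (at a)"
    and vw_integral: "t \<in> S \<Longrightarrow> integral {0..1} (\<lambda>a. v a t * w a t) = 0"
    and v_deriv_t: "t \<in> S \<Longrightarrow> ((\<lambda>t. v a t) has_real_derivative
      lam * (v a t)\<^sup>2 - (lam + 1) * integral {0..1} (\<lambda>b. (v b t)\<^sup>2 * w b t)) (at t)"
    and u0_deriv: "(u0 has_real_derivative v a 0) (at a)"
    and u0_0: "u0 0 = 0"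
begin

text \<open>The flow map. Keeping the label 0 at position 0 fixes the Galilean freedom of the
  periodic problem: passing from u to \<open>u(x - b(t), t) + b'(t)\<close> preserves the
  equation.\<close>

definition Gam :: "real \<Rightarrow> real \<Rightarrow> real" where
  "Gam a t = prim (\<lambda>b. w b t) a"

definition V :: "real \<Rightarrow> real \<Rightarrow> real" where
  "V a t = prim (\<lambda>b. v b t * w b t) a"

text \<open>The back-to-labels map; \<open>inv\<close> is a genuine inverse only for
  \<open>t \<in> S\<close>, where each slice of \<open>Gam\<close> is a bijection of the
  line.\<close>

definition B :: "real \<Rightarrow> real \<Rightarrow> real" where
  "B x t = inv (\<lambda>a. Gam a t) x"

definition sol :: "real \<Rightarrow> real \<Rightarrow> real" where
  "sol x t = V (B x t) t"

lemma slice_cont: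
  assumes "continuous_on (UNIV \<times> S) (\<lambda>(a, t). f a t)" "t \<in> S"
  shows "continuous_on X (\<lambda>a. f a t)"
proof -
  have "continuous_on X (\<lambda>a. (\<lambda>(a, t). f a t) (a, t))"
    by (rule continuous_on_compose2[OF assms(1)]) (use assms(2) in \<open>auto intro!: continuous_intros\<close>)
  then show ?thesis by simp
qed

lemma vw_cont: "continuous_on (UNIV \<times> S) (\<lambda>(a, t). v a t * w a t)"
  using continuous_on_mult[OF v_cont w_cont] by (simp add: split_beta)

lemma Gam_deriv_a: "t \<in> S \<Longrightarrow> ((\<lambda>a. Gam a t) has_real_derivative w a t) (at a)"
  unfolding Gam_def by (rule prim_has_real_derivative[of UNIV]) (auto intro: slice_cont w_cont)

lemma V_deriv_a: "t \<in> S \<Longrightarrow> ((\<lambda>a. V a t) has_real_derivative v a t * w a t) (at a)"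
  unfolding V_def by (rule prim_has_real_derivative[of UNIV]) (auto intro: slice_cont vw_cont)

lemma Gam_deriv_t: "t \<in> S \<Longrightarrow> ((\<lambda>t. Gam a t) has_real_derivative V a t) (at t)"
  unfolding Gam_def V_def
  by (rule prim_param_has_real_derivative[OF open_S convex_S _ w_cont vw_cont w_deriv])

lemma V_cont: "continuous_on (UNIV \<times> S) (\<lambda>(a, t). V a t)"
  unfolding V_def by (rule continuous_on_prim[OF vw_cont])

lemma Gam_periodic: "t \<in> S \<Longrightarrow> Gam (a + 1) t = Gam a t + 1"
  using quasi_periodic[of "\<lambda>a. Gam a t" "\<lambda>a. w a t" a] Gam_deriv_a w_periodic w_integral
  by (simp add: Gam_def prim_1)

lemma V_periodic: "t \<in> S \<Longrightarrow> V (a + 1) t = V a t"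
  using quasi_periodic[of "\<lambda>a. V a t" "\<lambda>a. v a t * w a t" a] V_deriv_a w_periodic v_periodic vw_integral
  by (simp add: V_def prim_1)

lemma Gam_0 [simp]: "Gam 0 t = 0"
  by (simp add: Gam_def)

lemma Gam_1: "t \<in> S \<Longrightarrow> Gam 1 t = 1"
  by (simp add: Gam_def prim_1 w_integral)

lemma Gam_of_int: "t \<in> S \<Longrightarrow> Gam (of_int n) t = of_int n"
proof (induction n rule: int_induct[where k = 0])
  case (step1 i) then show ?case using Gam_periodic[of t "of_int i"] by simp
next
  case (step2 i) then show ?case using Gam_periodic[of t "of_int i - 1"] by simp
qed simp

lemma Gam_strict_mono: "t \<in> S \<Longrightarrow> a < b \<Longrightarrow> Gam a t < Gam b t"
  by (rule DERIV_pos_imp_increasing[of a b]) (use Gam_deriv_a w_pos in blast)+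

lemma Gam_inj: "t \<in> S \<Longrightarrow> inj (\<lambda>a. Gam a t)"
  by (rule injI) (metis Gam_strict_mono less_irrefl linorder_neqE_linordered_idom)

lemma Gam_surj:
  assumes "t \<in> S" shows "surj (\<lambda>a. Gam a t)"
proof -
  have "\<exists>a. Gam a t = x" for x
  proof -
    \<comment> \<open>Integers are fixed points of the flow map, so \<open>x\<close> is bracketed by
      the images of its two neighbouring integers.\<close>
    have "\<exists>a\<ge>of_int \<lfloor>x\<rfloor>. a \<le> of_int (\<lfloor>x\<rfloor> + 1) \<and> Gam a t = x"
    proof (rule IVT')
      show "Gam (of_int \<lfloor>x\<rfloor>) t \<le> x" "x \<le> Gam (of_int (\<lfloor>x\<rfloor> + 1)) t"
        using Gam_of_int[OF assms, of "\<lfloor>x\<rfloor>"] Gam_of_int[OF assms, of "\<lfloor>x\<rfloor> + 1"] by linarith+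
      show "continuous_on {of_int \<lfloor>x\<rfloor>..of_int (\<lfloor>x\<rfloor> + 1)} (\<lambda>a. Gam a t)"
        using Gam_deriv_a[OF assms] by (meson DERIV_continuous_on has_field_derivative_at_within)
    qed simp
    then show ?thesis by blast
  qed
  then show ?thesis unfolding surj_def by metis
qed

lemma B_Gam [simp]: "t \<in> S \<Longrightarrow> B (Gam a t) t = a"
  unfolding B_def by (rule inv_f_f[OF Gam_inj])

lemma Gam_B [simp]: "t \<in> S \<Longrightarrow> Gam (B x t) t = x"
  unfolding B_def using surj_f_inv_f[OF Gam_surj] by fastforce

lemma B_periodic: "t \<in> S \<Longrightarrow> B (x + 1) t = B x t + 1"
  using B_Gam[of t "B x t + 1"] Gam_periodic[of t "B x t"] by simp

lemma Gam_time_0: "Gam a 0 = a"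
  by (simp add: Gam_def prim_def w_0)

lemma B_time_0: "B x 0 = x"
  using B_Gam[OF zero_S, of x] by (simp add: Gam_time_0)

text \<open>Inverse function theorem for the map \<open>\<Phi>\<close>, which sends (t, a) to
  \<open>(t, Gam a t)\<close>: its derivative is triangular with diagonal entries 1 and
  \<open>w > 0\<close>.\<close>

lemma B_has_derivative:
  assumes t: "t \<in> S"
  shows "((\<lambda>(t, x). B x t) has_derivative
    (\<lambda>(dt, dx). (dx - V (B x t) t * dt) / w (B x t) t)) (at (t, x))"
proof -
  define \<Phi> where "\<Phi> = (\<lambda>(t, a). (t, Gam a t))"
  define \<Psi> where "\<Psi> = (\<lambda>(t, x). (t, B x t))"
  define \<Phi>' where "\<Phi>' = (\<lambda>(t, a). \<lambda>(dt :: real, da). (dt, V a t * dt + w a t * da))"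
  define \<Psi>' where "\<Psi>' = (\<lambda>(t, a). \<lambda>(dt :: real, dx). (dt, (dx - V a t * dt) / w a t))"
  define a where "a = B x t"
  have "(\<Psi> has_derivative \<Psi>' (t, a)) (at (\<Phi> (t, a)))"
  proof (rule has_derivative_inverse_on[where S = "S \<times> UNIV" and f' = \<Phi>' and g' = \<Psi>' and f = \<Phi> and x = "(t, a)"])
    show "open (S \<times> (UNIV :: real set))" by (intro open_Times open_S open_UNIV)
    show "(t, a) \<in> S \<times> UNIV" using t by simp
    show "\<Psi> (\<Phi> p) = p" if "p \<in> S \<times> UNIV" for p
      using that by (auto simp: \<Phi>_def \<Psi>_def)
    show "\<Phi>' (t, a) \<circ> \<Psi>' (t, a) = id"
      using w_pos[OF t, of a] by (auto simp: \<Phi>'_def \<Psi>'_def fun_eq_iff)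
    fix p assume "p \<in> S \<times> (UNIV :: real set)"
    then obtain s b where p: "p = (s, b)" "s \<in> S" by auto
    have "((\<lambda>(t, a). Gam a t) has_derivative (\<lambda>(dt, da). V b s * dt + w b s * da)) (at (s, b))"
      by (rule has_derivative_of_partials[OF open_S p(2) Gam_deriv_t[OF p(2)] Gam_deriv_a w_cont])
    then have "((\<lambda>p. (fst p, (\<lambda>(t, a). Gam a t) p)) has_derivative
        (\<lambda>q. (fst q, (\<lambda>(dt, da). V b s * dt + w b s * da) q))) (at (s, b))"
      by (intro has_derivative_Pair has_derivative_fst has_derivative_ident)
    then show "(\<Phi> has_derivative \<Phi>' p) (at p)"
      by (simp add: p \<Phi>_def \<Phi>'_def case_prod_unfold)
  qed
  then have "((\<lambda>p. snd (\<Psi> p)) has_derivative (\<lambda>q. snd (\<Psi>' (t, a) q))) (at (\<Phi> (t, a)))"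
    by (rule has_derivative_snd)
  moreover have "\<Phi> (t, a) = (t, x)" using t by (simp add: \<Phi>_def a_def)
  ultimately show ?thesis
    by (simp add: \<Psi>_def \<Psi>'_def case_prod_unfold a_def)
qed

lemma B_cont: "continuous_on (UNIV \<times> S) (\<lambda>(x, t). B x t)"
proof -
  have "continuous_on (S \<times> UNIV) (\<lambda>(t, x). B x t)"
    by (auto intro!: continuous_at_imp_continuous_on has_derivative_continuous[OF B_has_derivative])
  then have "continuous_on (UNIV \<times> S) (\<lambda>p. (\<lambda>(t, x). B x t) (snd p, fst p))"
    by (rule continuous_on_compose2) (auto intro!: continuous_intros)
  then show ?thesis by (simp add: split_beta)
qed

lemma B_deriv_x:
  assumes "t \<in> S"
  shows "((\<lambda>x. B x t) has_real_derivative 1 / w (B x t) t) (at x)"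
proof -
  have "((\<lambda>x. (t, x)) has_derivative (\<lambda>d. (0, d))) (at x)"
    by (intro has_derivative_Pair has_derivative_const has_derivative_ident)
  from has_derivative_compose[OF this B_has_derivative[OF assms]]
  show ?thesis by (simp add: has_derivative_imp_has_field_derivative)
qed

text \<open>Stated for a moving point to serve twice: a constant \<open>x\<close> gives the time
  derivative \<open>- V / w\<close> of the label, a trajectory gives zero.\<close>

lemma B_curve_deriv:
  assumes t: "t \<in> S" and x: "(x has_real_derivative x') (at t within J)"
  shows "((\<lambda>t. B (x t) t) has_real_derivative (x' - V (B (x t) t) t) / w (B (x t) t) t) (at t within J)"
proof -
  have "((\<lambda>t. (t, x t)) has_derivative (\<lambda>d. (d, x' * d))) (at t within J)"
    using x by (intro has_derivative_Pair has_derivative_ident) (simp add: has_field_derivative_def)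
  from has_derivative_compose[OF this B_has_derivative[OF t, of "x t"]]
  have "((\<lambda>t. B (x t) t) has_derivative (\<lambda>d. (x' * d - V (B (x t) t) t * d) / w (B (x t) t) t)) (at t within J)"
    by simp
  then show ?thesis by (rule has_derivative_imp_has_field_derivative) (simp add: algebra_simps)
qed

lemma sol_deriv_x:
  assumes "t \<in> S" shows "((\<lambda>x. sol x t) has_real_derivative v (B x t) t) (at x)"
  using DERIV_chain2[OF V_deriv_a[OF assms] B_deriv_x[OF assms], of x] w_pos[OF assms, of "B x t"]
  by (simp add: sol_def)

lemma ux_sol: "t \<in> S \<Longrightarrow> ux sol x t = v (B x t) t"
  unfolding ux_def by (rule DERIV_imp_deriv[OF sol_deriv_x])

lemma ux_sol_deriv_x:
  assumes "t \<in> S"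
  shows "((\<lambda>x. ux sol x t) has_real_derivative va (B x t) t / w (B x t) t) (at x)"
  using DERIV_chain2[OF v_deriv_a[OF assms] B_deriv_x[OF assms], of x] assms
  by (simp add: ux_sol)

lemma uxx_sol: "t \<in> S \<Longrightarrow> uxx sol x t = va (B x t) t / w (B x t) t"
  unfolding uxx_def by (rule DERIV_imp_deriv[OF ux_sol_deriv_x])

text \<open>Chain rule for \<open>v (B x t) t\<close>. The label moves with velocity
  \<open>- V / w\<close>, which turns \<open>va\<close> into the transport term
  \<open>- sol * uxx\<close>.\<close>

lemma ux_sol_deriv_t:
  assumes t: "t \<in> S"
  shows "((\<lambda>t. ux sol x t) has_real_derivative
    lam * (ux sol x t)\<^sup>2 - (lam + 1) * integral {0..1} (\<lambda>b. (v b t)\<^sup>2 * w b t) - sol x t * uxx sol x t) (at t)"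
proof -
  have "((\<lambda>t. B x t) has_real_derivative (0 - V (B x t) t) / w (B x t) t) (at t)"
    by (rule B_curve_deriv[OF t DERIV_const])
  then have "((\<lambda>t. (t, B x t)) has_derivative (\<lambda>d. (d, (0 - V (B x t) t) / w (B x t) t * d))) (at t)"
    by (intro has_derivative_Pair has_derivative_ident has_field_derivative_imp_has_derivative)
  from has_derivative_compose[OF this has_derivative_of_partials[OF open_S t v_deriv_t[OF t] v_deriv_a va_cont]]
  have "((\<lambda>t. v (B x t) t) has_derivative (\<lambda>d.
     (lam * (v (B x t) t)\<^sup>2 - (lam + 1) * integral {0..1} (\<lambda>b. (v b t)\<^sup>2 * w b t)) * d
       + va (B x t) t * ((0 - V (B x t) t) / w (B x t) t * d))) (at t)"
    by simp
  then have "((\<lambda>t. v (B x t) t) has_real_derivative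
     lam * (v (B x t) t)\<^sup>2 - (lam + 1) * integral {0..1} (\<lambda>b. (v b t)\<^sup>2 * w b t)
       - V (B x t) t * (va (B x t) t / w (B x t) t)) (at t)"
    by (rule has_derivative_imp_has_field_derivative) (simp add: algebra_simps)
  then have "((\<lambda>t. ux sol x t) has_real_derivative
     lam * (v (B x t) t)\<^sup>2 - (lam + 1) * integral {0..1} (\<lambda>b. (v b t)\<^sup>2 * w b t)
       - V (B x t) t * (va (B x t) t / w (B x t) t)) (at t)"
    by (rule has_field_derivative_transform_within_open[OF _ open_S t]) (simp add: ux_sol)
  then show ?thesis by (simp add: ux_sol uxx_sol t sol_def)
qed

lemma uxt_sol: "t \<in> S \<Longrightarrow> uxt sol x t =
    lam * (ux sol x t)\<^sup>2 - (lam + 1) * integral {0..1} (\<lambda>b. (v b t)\<^sup>2 * w b t) - sol x t * uxx sol x t"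
  unfolding uxt_def by (rule DERIV_imp_deriv[OF ux_sol_deriv_t])

lemma compose_B_cont:
  assumes "continuous_on (UNIV \<times> S) (\<lambda>(a, t). f a t)"
  shows "continuous_on (UNIV \<times> S) (\<lambda>(x, t). f (B x t) t)"
proof -
  have "continuous_on (UNIV \<times> S) (\<lambda>p. (\<lambda>(a, t). f a t) ((\<lambda>(x, t). B x t) p, snd p))"
    by (rule continuous_on_compose2[OF assms]) (auto intro!: continuous_intros B_cont)
  then show ?thesis by (simp add: split_beta)
qed

lemma sol_cont: "continuous_on (UNIV \<times> S) (\<lambda>(x, t). sol x t)"
  unfolding sol_def by (rule compose_B_cont[OF V_cont])

lemma ux_sol_cont: "continuous_on (UNIV \<times> S) (\<lambda>(x, t). ux sol x t)"
  using compose_B_cont[OF v_cont] by (rule continuous_on_eq) (auto simp: ux_sol)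

lemma uxx_sol_cont: "continuous_on (UNIV \<times> S) (\<lambda>(x, t). uxx sol x t)"
proof -
  have "\<forall>p\<in>UNIV \<times> S. (\<lambda>(x, t). w (B x t) t) p \<noteq> 0"
    using w_pos by (auto simp: less_imp_neq[THEN not_sym])
  from continuous_on_divide[OF compose_B_cont[OF va_cont] compose_B_cont[OF w_cont] this]
  have "continuous_on (UNIV \<times> S) (\<lambda>(x, t). va (B x t) t / w (B x t) t)"
    by (simp add: split_beta)
  then show ?thesis by (rule continuous_on_eq) (auto simp: uxx_sol)
qed

lemma energy_cont: "continuous_on S (\<lambda>t. integral {0..1} (\<lambda>b. (v b t)\<^sup>2 * w b t))"
proof -
  have "continuous_on (UNIV \<times> S) (\<lambda>(b, t). (v b t)\<^sup>2 * w b t)"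
    using continuous_on_mult[OF continuous_on_power[OF v_cont, of 2] w_cont] by (simp add: split_beta)
  then have "continuous_on (S \<times> cbox 0 1) (\<lambda>p. (\<lambda>(b, t). (v b t)\<^sup>2 * w b t) (snd p, fst p))"
    by (rule continuous_on_compose2) (auto intro!: continuous_intros)
  then have "continuous_on (S \<times> cbox 0 1) (\<lambda>(t, b). (v b t)\<^sup>2 * w b t)"
    by (simp add: split_beta)
  from integral_continuous_on_param[OF this] show ?thesis by simp
qed

lemma uxt_sol_cont: "continuous_on (UNIV \<times> S) (\<lambda>(x, t). uxt sol x t)"
proof -
  have "continuous_on (UNIV \<times> S) (\<lambda>p. integral {0..1} (\<lambda>b. (v b (snd p))\<^sup>2 * w b (snd p)))"
    by (rule continuous_on_compose2[OF energy_cont]) (auto intro!: continuous_intros)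
  then have "continuous_on (UNIV \<times> S) (\<lambda>p.
    lam * (ux sol (fst p) (snd p))\<^sup>2 - (lam + 1) * integral {0..1} (\<lambda>b. (v b (snd p))\<^sup>2 * w b (snd p))
      - sol (fst p) (snd p) * uxx sol (fst p) (snd p))"
    using ux_sol_cont sol_cont uxx_sol_cont by (auto simp: split_beta intro!: continuous_intros)
  then show ?thesis by (rule continuous_on_eq) (auto simp: uxt_sol)
qed

text \<open>Substitute \<open>y = Gam a t\<close>, a change of variables from [0,1] onto itself;
  this identifies the Eulerian nonlocal term with the Lagrangian one.\<close>

lemma energy_sol:
  assumes t: "t \<in> S"
  shows "integral {0..1} (\<lambda>y. (ux sol y t)\<^sup>2) = integral {0..1} (\<lambda>b. (v b t)\<^sup>2 * w b t)"
proof -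
  have "((\<lambda>a. w a t *\<^sub>R (ux sol (Gam a t) t)\<^sup>2) has_integral
      integral {Gam 0 t..Gam 1 t} (\<lambda>y. (ux sol y t)\<^sup>2)) {0..1}"
  proof (rule has_integral_substitution[where c = 0 and d = 1])
    show "(\<lambda>a. Gam a t) ` {0..1} \<subseteq> {0..1}"
    proof safe
      fix a :: real assume "a \<in> {0..1}"
      then show "Gam a t \<in> {0..1}"
        using Gam_strict_mono[OF t, of 0 a] Gam_strict_mono[OF t, of a 1] Gam_1[OF t]
        by (cases "a = 0"; cases "a = 1") auto
    qed
    show "continuous_on {0..1} (\<lambda>y. (ux sol y t)\<^sup>2)"
      by (intro continuous_intros slice_cont[OF ux_sol_cont t])
    show "((\<lambda>a. Gam a t) has_real_derivative w a t) (at a within {0..1})" for a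
      by (rule has_field_derivative_at_within[OF Gam_deriv_a[OF t]])
  qed (simp_all add: Gam_1 t)
  then show ?thesis using t by (simp add: ux_sol Gam_1 has_integral_iff mult.commute)
qed

lemma sol_time_0: "sol x 0 = u0 x"
proof -
  have "prim (\<lambda>b. v b 0) x = u0 x - u0 0"
    by (rule prim_eq_diff[of UNIV]) (auto intro: u0_deriv)
  then show ?thesis by (simp add: sol_def B_time_0 V_def w_0 u0_0)
qed

lemma sol_is_solution:
  assumes "J \<subseteq> S"
  shows "is_solution lam u0 J sol"
proof -
  have c: "continuous_on (UNIV \<times> J') (\<lambda>(x, t). f x t)"
    if "continuous_on (UNIV \<times> S) (\<lambda>(x, t). f x t)" "J' \<subseteq> J" for f :: "real \<Rightarrow> real \<Rightarrow> real" and J'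
    using that(1) by (rule continuous_on_subset) (use assms that(2) in auto)
  have t: "t \<in> S" if "t \<in> J" for t using that assms by blast
  show ?thesis
    unfolding is_solution_def
  proof (intro conjI allI ballI impI)
    show "sol x 0 = u0 x" for x by (rule sol_time_0)
    show "sol (x + 1) s = sol x s" if "s \<in> J" for x s
      using t[OF that] by (simp add: sol_def B_periodic V_periodic)
    show "((\<lambda>y. sol y s) has_real_derivative ux sol x s) (at x)" if "s \<in> J" for x s
      using sol_deriv_x[OF t[OF that]] t[OF that] by (simp add: ux_sol)
    show "((\<lambda>y. ux sol y s) has_real_derivative uxx sol x s) (at x)" if "s \<in> J" for x s
      using ux_sol_deriv_x[OF t[OF that]] t[OF that] by (simp add: uxx_sol)
    show "((\<lambda>s. ux sol x s) has_real_derivative uxt sol x s) (at s)" if "s \<in> J" for x s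
      using ux_sol_deriv_t[OF t[OF that]] t[OF that] by (simp add: uxt_sol)
    show "uxt sol x s + sol x s * uxx sol x s - lam * (ux sol x s)\<^sup>2
        = - (lam + 1) * integral {0..1} (\<lambda>y. (ux sol y s)\<^sup>2)" if "s \<in> J" for x s
      using t[OF that] by (simp add: uxt_sol energy_sol algebra_simps)
  qed (auto intro!: c sol_cont ux_sol_cont uxx_sol_cont uxt_sol_cont)
qed

lemma Gam_is_flow: "J \<subseteq> S \<Longrightarrow> is_flow sol J Gam"
  unfolding is_flow_def sol_def
  using has_field_derivative_at_within[OF Gam_deriv_t] by (auto simp: Gam_time_0 subset_iff)

text \<open>The label \<open>B (\<gamma> t) t\<close> of a particle is constant along any trajectory \<open>\<gamma>\<close>, so the flow is unique.\<close>
lemma ux_along_flow: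
  assumes J: "J \<subseteq> S" "convex J" "0 \<in> J" and fl: "is_flow sol J \<gamma>" and a: "a \<in> {0..1}" and t: "t \<in> J"
  shows "ux sol (\<gamma> a t) t = v a t"
proof -
  have *: "((\<lambda>t. B (\<gamma> a t) t) has_real_derivative 0) (at s within J)" if s: "s \<in> J" for s
  proof -
    have "(\<gamma> a has_real_derivative sol (\<gamma> a s) s) (at s within J)"
      using fl a s by (auto simp: is_flow_def)
    from B_curve_deriv[OF _ this] show ?thesis
      using s J by (auto simp: sol_def)
  qed
  have "B (\<gamma> a t) t = B (\<gamma> a 0) 0"
  proof -
    obtain c where "\<And>s. s \<in> J \<Longrightarrow> B (\<gamma> a s) s = c"
      using has_field_derivative_zero_constant[OF J(2) *] by blast
    then show ?thesis using J(3) t by simp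
  qed
  also have "\<dots> = a" using fl a by (simp add: is_flow_def B_time_0)
  finally show ?thesis using ux_sol t J by auto
qed

end

subsection \<open>The explicit Lagrangian solution\<close>

text \<open>Solves \<open>\<eta>' = 1 / H \<eta>\<close>, \<open>\<eta> 0 = 0\<close>, by inverting
  the primitive of \<open>H\<close>, without an existence theorem for differential equations. The
  image of \<open>D\<close> is the full time interval of the solution and is open by invariance of
  domain.\<close>

lemma time_change:
  fixes D :: "real set"
  assumes D: "open D" "convex D" "0 \<in> D" and H: "continuous_on D H" "\<And>e. e \<in> D \<Longrightarrow> H e > 0"
  obtains \<eta> where "open (prim H ` D)" "convex (prim H ` D)" "0 \<in> prim H ` D" "\<eta> 0 = 0"
    "\<And>t. t \<in> prim H ` D \<Longrightarrow> \<eta> t \<in> D \<and> prim H (\<eta> t) = t"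
    "\<And>t. t \<in> prim H ` D \<Longrightarrow> (\<eta> has_real_derivative 1 / H (\<eta> t)) (at t)"
    "\<And>e e'. e \<in> D \<Longrightarrow> e' \<in> D \<Longrightarrow> e < e' \<Longrightarrow> prim H e < prim H e'"
proof -
  have der: "(prim H has_real_derivative H e) (at e)" if "e \<in> D" for e
    by (rule prim_has_real_derivative) (use D H that in auto)
  have mono: "prim H e < prim H e'" if "e \<in> D" "e' \<in> D" "e < e'" for e e'
  proof (rule DERIV_pos_imp_increasing[OF that(3)])
    fix x assume "e \<le> x" "x \<le> e'"
    then have "x \<in> D"
      using that D(2) closed_segment_eq_real_ivl1[of e e'] closed_segment_subset[of e D e'] by auto
    then show "\<exists>y. (prim H has_real_derivative y) (at x) \<and> y > 0"
      using der H(2) by blast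
  qed
  have inj: "inj_on (prim H) D"
    by (rule inj_onI) (metis mono less_irrefl linorder_neqE_linordered_idom)
  have cont: "continuous_on D (prim H)"
    using der by (meson DERIV_continuous_on has_field_derivative_at_within)
  define \<eta> where "\<eta> = inv_into D (prim H)"
  have \<eta>: "\<eta> (prim H e) = e" if "e \<in> D" for e
    using that inj by (simp add: \<eta>_def)
  show thesis
  proof (rule that[of \<eta>])
    show "open (prim H ` D)" by (rule invariance_of_domain[OF cont D(1) inj])
    show "convex (prim H ` D)"
      using connected_continuous_image[OF cont convex_connected[OF D(2)]]
      by (simp add: is_interval_connected_1[symmetric] is_interval_convex_1)
    show "0 \<in> prim H ` D" using D(3) by (force intro: image_eqI[of _ _ 0])
    show "\<eta> 0 = 0" using \<eta>[OF D(3)] by simp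
    show "\<eta> t \<in> D \<and> prim H (\<eta> t) = t" if "t \<in> prim H ` D" for t
      using that \<eta> by auto
    show "(\<eta> has_real_derivative 1 / H (\<eta> t)) (at t)" if "t \<in> prim H ` D" for t
    proof -
      from that obtain e where e: "e \<in> D" "t = prim H e" by blast
      have "(\<eta> has_derivative (*) (1 / H e)) (at (prim H e))"
      proof (rule has_derivative_inverse_on[OF D(1), where f' = "\<lambda>e. (*) (H e)" and g' = "\<lambda>e. (*) (1 / H e)"])
        show "(prim H has_derivative (*) (H x)) (at x)" if "x \<in> D" for x
          using der[OF that] by (simp add: has_field_derivative_def)
        show "(*) (H e) \<circ> (*) (1 / H e) = id"
          using H(2)[OF e(1)] by (auto simp: fun_eq_iff)
      qed (use \<eta> e in auto)
      then show ?thesis by (simp add: has_field_derivative_def e \<eta>)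
    qed
  qed (use mono in auto)
qed

section \<open>The explicit family in the variable \<eta>, written \<open>e\<close>\<close>

definition cs :: "real \<Rightarrow> real" where
  "cs a = cos (2 * pi * a)"

definition Jac :: "real \<Rightarrow> real \<Rightarrow> real \<Rightarrow> real" where
  "Jac lam e a = 1 - lam * e * cs a"

definition rr :: "real \<Rightarrow> real \<Rightarrow> real \<Rightarrow> real" where
  "rr lam e a = cs a / Jac lam e a"

text \<open>The exponential at \<open>lam = 0\<close> is the limit of the power as
  \<open>lam\<close> tends to 0, so one parametrisation covers all parameters.\<close>

definition KK :: "real \<Rightarrow> real \<Rightarrow> real \<Rightarrow> real" where
  "KK lam e a = (if lam = 0 then exp (e * cs a) else Jac lam e a powr (- 1 / lam))"

text \<open>The values of \<eta> for which \<open>Jac\<close> is positive at every label. Negative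
  values are included to make 0 an interior point; for \<open>lam = 0\<close> it is the whole
  line.\<close>

definition Dom :: "real \<Rightarrow> real set" where
  "Dom lam = {e. \<bar>lam * e\<bar> < 1}"

definition Kb :: "real \<Rightarrow> real \<Rightarrow> real" where
  "Kb lam e = integral {0..1} (KK lam e)"

definition Nb :: "real \<Rightarrow> real \<Rightarrow> real" where
  "Nb lam e = integral {0..1} (\<lambda>a. rr lam e a * KK lam e a)"

definition Qb :: "real \<Rightarrow> real \<Rightarrow> real" where
  "Qb lam e = integral {0..1} (\<lambda>a. (rr lam e a)\<^sup>2 * KK lam e a)"

definition PP :: "real \<Rightarrow> real \<Rightarrow> real" where
  "PP lam e = Nb lam e / Kb lam e"

definition hh :: "real \<Rightarrow> real \<Rightarrow> real" where
  "hh lam e = Kb lam e powr (- 2 * lam)"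

definition vv :: "real \<Rightarrow> real \<Rightarrow> real \<Rightarrow> real" where
  "vv lam a e = hh lam e * (rr lam e a - PP lam e)"

lemma cs_bound: "\<bar>cs a\<bar> \<le> 1"
  by (simp add: cs_def abs_le_iff cos_ge_minus_one minus_le_iff)

lemma cs_periodic: "cs (a + 1) = cs a"
  by (simp add: cs_def distrib_left)

lemma cs_deriv: "(cs has_real_derivative - (2 * pi * sin (2 * pi * a))) (at a)"
  unfolding cs_def by (auto intro!: derivative_eq_intros)

lemma continuous_on_cs [continuous_intros]:
  fixes f :: "'a::t2_space \<Rightarrow> real"
  shows
  "continuous_on A f \<Longrightarrow> continuous_on A (\<lambda>x. cs (f x))"
  unfolding cs_def by (auto intro!: continuous_intros)

lemma open_Dom: "open (Dom lam)"
  unfolding Dom_def by (intro open_Collect_less continuous_intros)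

lemma convex_Dom: "convex (Dom lam)"
proof -
  have "Dom lam = (\<lambda>e. lam * e) -` {-1<..<1}" by (auto simp: Dom_def)
  then show ?thesis
    by (simp add: convex_linear_vimage linear_times)
qed

lemma zero_Dom: "0 \<in> Dom lam"
  by (simp add: Dom_def)

lemma Jac_pos:
  assumes "e \<in> Dom lam" shows "Jac lam e a > 0"
proof -
  have "\<bar>lam * e * cs a\<bar> \<le> \<bar>lam * e\<bar> * 1"
    unfolding abs_mult[of _ "cs a"] by (rule mult_left_mono[OF cs_bound]) simp
  then show ?thesis using assms by (simp add: Dom_def Jac_def abs_if split: if_splits)
qed

lemma KK_pos: "e \<in> Dom lam \<Longrightarrow> KK lam e a > 0"
  using Jac_pos[of e lam a] by (simp add: KK_def)

lemma KK_deriv: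
  assumes "e \<in> Dom lam"
  shows "((\<lambda>e. KK lam e a) has_real_derivative rr lam e a * KK lam e a) (at e)"
proof (cases "lam = 0")
  case True
  then show ?thesis
    by (auto simp: KK_def rr_def Jac_def intro!: derivative_eq_intros)
next
  case False
  have J: "Jac lam e a > 0" by (rule Jac_pos[OF assms])
  have "((\<lambda>e. Jac lam e a) has_real_derivative - (lam * cs a)) (at e)"
    unfolding Jac_def by (auto intro!: derivative_eq_intros)
  from has_real_derivative_powr'[OF this DERIV_const[of "- 1 / lam"] J] False J show ?thesis
    by (simp add: KK_def rr_def mult.commute)
qed

lemma rr_deriv_e:
  assumes "e \<in> Dom lam"
  shows "((\<lambda>e. rr lam e a) has_real_derivative lam * (rr lam e a)\<^sup>2) (at e)"
proof -
  have J: "Jac lam e a \<noteq> 0" using Jac_pos[OF assms, of a] by simp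
  have "((\<lambda>e. Jac lam e a) has_real_derivative - (lam * cs a)) (at e)"
    unfolding Jac_def by (auto intro!: derivative_eq_intros)
  from DERIV_divide[OF DERIV_const[of "cs a"] this J] show ?thesis
    by (simp add: rr_def power2_eq_square mult.left_commute)
qed

definition rra :: "real \<Rightarrow> real \<Rightarrow> real \<Rightarrow> real" where
  "rra lam e a = - (2 * pi * sin (2 * pi * a)) / (Jac lam e a)\<^sup>2"

lemma rr_deriv_a:
  assumes "e \<in> Dom lam"
  shows "((\<lambda>a. rr lam e a) has_real_derivative rra lam e a) (at a)"
proof -
  have J: "1 - lam * e * cs a \<noteq> 0" using Jac_pos[OF assms, of a] by (simp add: Jac_def)
  show ?thesis
    unfolding rr_def rra_def Jac_def
    by (rule derivative_eq_intros cs_deriv J refl)+ (use J in \<open>simp add: field_simps power2_eq_square\<close>)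
qed

lemma Jac_cont [continuous_intros]:
  fixes f :: "'a::t2_space \<Rightarrow> real"
  shows
  "continuous_on A f \<Longrightarrow> continuous_on A g \<Longrightarrow> continuous_on A (\<lambda>x. Jac lam (f x) (g x))"
  unfolding Jac_def by (auto intro!: continuous_intros)

lemma rr_cont [continuous_intros]:
  fixes f :: "'a::t2_space \<Rightarrow> real"
  assumes "continuous_on A f" "continuous_on A g" "\<And>x. x \<in> A \<Longrightarrow> f x \<in> Dom lam"
  shows "continuous_on A (\<lambda>x. rr lam (f x) (g x))"
  unfolding rr_def using assms Jac_pos by (intro continuous_intros) (auto simp: less_imp_neq[THEN not_sym])

lemma KK_cont [continuous_intros]:
  fixes f :: "'a::t2_space \<Rightarrow> real"
  assumes "continuous_on A f" "continuous_on A g" "\<And>x. x \<in> A \<Longrightarrow> f x \<in> Dom lam"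
  shows "continuous_on A (\<lambda>x. KK lam (f x) (g x))"
proof (cases "lam = 0")
  case False
  then show ?thesis
    unfolding KK_def using assms Jac_pos
    by (auto intro!: continuous_intros simp: less_imp_neq[THEN not_sym])
qed (auto simp: KK_def intro!: continuous_intros assms)

lemma rra_cont [continuous_intros]:
  fixes f :: "'a::t2_space \<Rightarrow> real"
  assumes "continuous_on A f" "continuous_on A g" "\<And>x. x \<in> A \<Longrightarrow> f x \<in> Dom lam"
  shows "continuous_on A (\<lambda>x. rra lam (f x) (g x))"
  unfolding rra_def using assms Jac_pos
  by (auto simp: less_imp_neq[THEN not_sym] intro!: continuous_intros)

lemma Kb_deriv:
  assumes "e \<in> Dom lam"
  shows "(Kb lam has_real_derivative Nb lam e) (at e)"
proof -
  have "((\<lambda>e. prim (\<lambda>a. KK lam e a) 1) has_real_derivative prim (\<lambda>a. rr lam e a * KK lam e a) 1) (at e)"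
    by (rule prim_param_has_real_derivative[OF open_Dom convex_Dom assms])
      (auto simp: split_beta intro!: continuous_intros KK_deriv)
  then show ?thesis by (simp add: prim_1 Kb_def[abs_def] Nb_def)
qed

text \<open>Since \<open>rr\<close> has e-derivative \<open>lam * rr\<^sup>2\<close> and
  \<open>KK\<close> has \<open>rr * KK\<close>, the product has
  \<open>(lam + 1) * rr\<^sup>2 * KK\<close>. This is the origin of the factor
  \<open>lam + 1\<close> in front of the nonlocal term.\<close>

lemma Nb_deriv:
  assumes "e \<in> Dom lam"
  shows "(Nb lam has_real_derivative (lam + 1) * Qb lam e) (at e)"
proof -
  have "((\<lambda>e. prim (\<lambda>a. rr lam e a * KK lam e a) 1) has_real_derivative
      prim (\<lambda>a. (lam + 1) * ((rr lam e a)\<^sup>2 * KK lam e a)) 1) (at e)"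
  proof (rule prim_param_has_real_derivative[OF open_Dom convex_Dom assms])
    show "((\<lambda>e. rr lam e a * KK lam e a) has_real_derivative (lam + 1) * ((rr lam e a)\<^sup>2 * KK lam e a)) (at e)"
      if "e \<in> Dom lam" for a e
      using DERIV_mult[OF rr_deriv_e[OF that, of a] KK_deriv[OF that, of a]]
      by (simp add: algebra_simps power2_eq_square)
  qed (auto simp: split_beta intro!: continuous_intros)
  then show ?thesis by (simp add: prim_1 Nb_def[abs_def] Qb_def)
qed

lemma Kb_pos:
  assumes "e \<in> Dom lam" shows "Kb lam e > 0"
proof -
  have c: "continuous_on {0..1} (KK lam e)"
    using assms by (auto intro!: continuous_intros)
  have "Kb lam e \<noteq> 0"
  proof
    assume "Kb lam e = 0"
    then have "\<forall>x\<in>{0..1}. KK lam e x = 0"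
      using integral_eq_0_iff[OF c] KK_pos[OF assms] by (simp add: Kb_def less_imp_le)
    then have "KK lam e 0 = 0" by simp
    then show False using KK_pos[OF assms, of 0] by simp
  qed
  moreover have "Kb lam e \<ge> 0"
    unfolding Kb_def using KK_pos[OF assms]
    by (intro integral_nonneg integrable_continuous_real c) (auto simp: less_imp_le)
  ultimately show ?thesis by simp
qed

lemma PP_deriv:
  assumes "e \<in> Dom lam"
  shows "(PP lam has_real_derivative (lam + 1) * Qb lam e / Kb lam e - (PP lam e)\<^sup>2) (at e)"
  unfolding PP_def[abs_def]
  by (rule DERIV_cong[OF DERIV_divide[OF Nb_deriv[OF assms] Kb_deriv[OF assms]]])
    (use Kb_pos[OF assms] in \<open>auto simp: field_simps power2_eq_square\<close>)

lemma hh_deriv: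
  assumes "e \<in> Dom lam"
  shows "(hh lam has_real_derivative - 2 * lam * PP lam e * hh lam e) (at e)"
proof -
  have "((\<lambda>e. Kb lam e powr (- 2 * lam)) has_real_derivative
      - 2 * lam * Kb lam e powr (- 2 * lam - 1) * Nb lam e) (at e)"
    using DERIV_fun_powr[OF Kb_deriv[OF assms] Kb_pos[OF assms], of "- 2 * lam"] by simp
  then show ?thesis
    unfolding hh_def[abs_def]
    by (rule DERIV_cong) (use Kb_pos[OF assms] in \<open>simp add: PP_def powr_diff\<close>)
qed

lemma hh_pos: "e \<in> Dom lam \<Longrightarrow> hh lam e > 0"
  using Kb_pos by (simp add: hh_def less_imp_neq[THEN not_sym])

lemma KK_0 [simp]: "KK lam 0 a = 1"
  by (simp add: KK_def Jac_def)

lemma Kb_0 [simp]: "Kb lam 0 = 1"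
proof -
  have "KK lam 0 = (\<lambda>a. 1)" by auto
  then show ?thesis by (simp add: Kb_def)
qed

lemma integral_cs: "integral {0..1} cs = 0"
proof -
  have "(cs has_integral (sin (2 * pi * 1) / (2 * pi) - sin (2 * pi * 0) / (2 * pi))) {0..1}"
    by (rule fundamental_theorem_of_calculus)
      (auto simp: cs_def has_real_derivative_iff_has_vector_derivative[symmetric] intro!: derivative_eq_intros)
  then show ?thesis by (simp add: has_integral_iff)
qed

lemma vv_0: "vv lam a 0 = cs a"
  using integral_cs by (simp add: vv_def hh_def rr_def Jac_def PP_def Nb_def)

text \<open>The term \<open>- 2 * lam * PP * hh\<close> coming from \<open>hh\<close> completes the
  square in \<open>rr - PP\<close>; this is what the exponent \<open>- 2 * lam\<close> in
  \<open>hh\<close> achieves. One factor \<open>hh\<close> is missing and is supplied by the change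
  to the time t.\<close>

lemma vv_deriv_e:
  assumes "e \<in> Dom lam"
  shows "((\<lambda>e. vv lam a e) has_real_derivative
    hh lam e * (lam * (rr lam e a - PP lam e)\<^sup>2 - (lam + 1) * (Qb lam e / Kb lam e - (PP lam e)\<^sup>2))) (at e)"
proof -
  have "((\<lambda>e. hh lam e * (rr lam e a - PP lam e)) has_real_derivative
      - 2 * lam * PP lam e * hh lam e * (rr lam e a - PP lam e) +
      (lam * (rr lam e a)\<^sup>2 - ((lam + 1) * Qb lam e / Kb lam e - (PP lam e)\<^sup>2)) * hh lam e) (at e)"
    by (rule DERIV_mult[OF hh_deriv[OF assms] DERIV_diff[OF rr_deriv_e[OF assms] PP_deriv[OF assms]]])
  then show ?thesis
    unfolding vv_def by (rule DERIV_cong) (simp add: algebra_simps power2_eq_square)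
qed

section \<open>Mean and variance of \<open>rr\<close> under the weight
  \<open>KK / Kb\<close>\<close>

lemma integrable_moments:
  assumes "e \<in> Dom lam"
  shows "KK lam e integrable_on {0..1}" "(\<lambda>a. rr lam e a * KK lam e a) integrable_on {0..1}"
    "(\<lambda>a. (rr lam e a)\<^sup>2 * KK lam e a) integrable_on {0..1}"
  using assms by (auto intro!: integrable_continuous_real continuous_intros)

lemma centred_first_moment:
  assumes "e \<in> Dom lam"
  shows "integral {0..1} (\<lambda>a. vv lam a e * (KK lam e a / Kb lam e)) = 0"
proof -
  have "((\<lambda>a. hh lam e / Kb lam e * (rr lam e a * KK lam e a - PP lam e * KK lam e a))
      has_integral hh lam e / Kb lam e * (Nb lam e - PP lam e * Kb lam e)) {0..1}"
    unfolding Nb_def Kb_def using integrable_moments[OF assms]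
    by (intro has_integral_mult_right has_integral_diff) (auto simp: has_integral_iff)
  then show ?thesis
    using Kb_pos[OF assms] by (simp add: has_integral_iff vv_def PP_def field_simps)
qed

text \<open>Second moment minus squared mean: the energy is a variance, which matches the last term
  of \<open>vv_deriv_e\<close>.\<close>

lemma centred_second_moment:
  assumes "e \<in> Dom lam"
  shows "integral {0..1} (\<lambda>a. (vv lam a e)\<^sup>2 * (KK lam e a / Kb lam e))
    = (hh lam e)\<^sup>2 * (Qb lam e / Kb lam e - (PP lam e)\<^sup>2)"
proof -
  have "((\<lambda>a. (hh lam e)\<^sup>2 / Kb lam e * ((rr lam e a)\<^sup>2 * KK lam e a
        - 2 * PP lam e * (rr lam e a * KK lam e a) + (PP lam e)\<^sup>2 * KK lam e a))
      has_integral (hh lam e)\<^sup>2 / Kb lam e * (Qb lam e - 2 * PP lam e * Nb lam e + (PP lam e)\<^sup>2 * Kb lam e)) {0..1}"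
    unfolding Nb_def Kb_def Qb_def using integrable_moments[OF assms]
    by (intro has_integral_mult_right has_integral_diff has_integral_add) (auto simp: has_integral_iff)
  moreover have "(hh lam e)\<^sup>2 / Kb lam e * ((rr lam e a)\<^sup>2 * KK lam e a
        - 2 * PP lam e * (rr lam e a * KK lam e a) + (PP lam e)\<^sup>2 * KK lam e a)
      = (vv lam a e)\<^sup>2 * (KK lam e a / Kb lam e)" for a
    by (simp add: vv_def field_simps power2_eq_square)
  moreover have "(hh lam e)\<^sup>2 / Kb lam e * (Qb lam e - 2 * PP lam e * Nb lam e + (PP lam e)\<^sup>2 * Kb lam e)
      = (hh lam e)\<^sup>2 * (Qb lam e / Kb lam e - (PP lam e)\<^sup>2)"
    using Kb_pos[OF assms] by (simp add: PP_def field_simps power2_eq_square)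
  ultimately show ?thesis by (metis (no_types, lifting) ext integral_unique)
qed

definition sine_data :: "real \<Rightarrow> real" where
  "sine_data x = sin (2 * pi * x) / (2 * pi)"

lemma sine_data_deriv: "(sine_data has_real_derivative cs x) (at x)"
  unfolding sine_data_def cs_def by (auto intro!: derivative_eq_intros)

text \<open>Physical time as a function of \<eta>; its speed is \<open>1 / hh\<close>.\<close>

definition clock :: "real \<Rightarrow> real \<Rightarrow> real" where
  "clock lam = prim (\<lambda>e. Kb lam e powr (2 * lam))"

lemma clock_cont: "continuous_on (Dom lam) (\<lambda>e. Kb lam e powr (2 * lam))"
proof -
  have "continuous_on (Dom lam) (Kb lam)"
    using Kb_deriv by (meson DERIV_continuous_on has_field_derivative_at_within)
  then show ?thesis
    using Kb_pos by (intro continuous_intros) (auto simp: less_imp_neq[THEN not_sym])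
qed

lemma clock_deriv: "e \<in> Dom lam \<Longrightarrow> (clock lam has_real_derivative Kb lam e powr (2 * lam)) (at e)"
  unfolding clock_def
  by (rule prim_has_real_derivative[OF open_Dom convex_Dom zero_Dom _ clock_cont])

lemma lagrangian_solution_sine:
  obtains \<eta> where
    "lagrangian_solution lam sine_data (clock lam ` Dom lam)
       (\<lambda>a t. KK lam (\<eta> t) a / Kb lam (\<eta> t)) (\<lambda>a t. vv lam a (\<eta> t)) (\<lambda>a t. hh lam (\<eta> t) * rra lam (\<eta> t) a)"
    "\<And>t. t \<in> clock lam ` Dom lam \<Longrightarrow> \<eta> t \<in> Dom lam \<and> clock lam (\<eta> t) = t"
    "\<And>e e'. e \<in> Dom lam \<Longrightarrow> e' \<in> Dom lam \<Longrightarrow> e < e' \<Longrightarrow> clock lam e < clock lam e'"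
proof -
  obtain \<eta> where \<eta>: "open (clock lam ` Dom lam)" "convex (clock lam ` Dom lam)"
    "0 \<in> clock lam ` Dom lam" "\<eta> 0 = 0"
    "\<And>t. t \<in> clock lam ` Dom lam \<Longrightarrow> \<eta> t \<in> Dom lam \<and> clock lam (\<eta> t) = t"
    "\<And>t. t \<in> clock lam ` Dom lam \<Longrightarrow> (\<eta> has_real_derivative 1 / Kb lam (\<eta> t) powr (2 * lam)) (at t)"
    "\<And>e e'. e \<in> Dom lam \<Longrightarrow> e' \<in> Dom lam \<Longrightarrow> e < e' \<Longrightarrow> clock lam e < clock lam e'"
    using time_change[OF open_Dom convex_Dom zero_Dom clock_cont, of lam] Kb_pos
    unfolding clock_def[symmetric] by (metis less_irrefl powr_gt_zero)
  let ?S = "clock lam ` Dom lam"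
  have mem: "\<eta> t \<in> Dom lam" if "t \<in> ?S" for t using \<eta>(5)[OF that] by simp
  have der: "(\<eta> has_real_derivative hh lam (\<eta> t)) (at t)" if "t \<in> ?S" for t
    using \<eta>(6)[OF that] by (simp add: hh_def powr_minus field_simps)
  have cont: "continuous_on ?S \<eta>"
    using der by (meson DERIV_continuous_on has_field_derivative_at_within)
  have cont2: "continuous_on (UNIV \<times> ?S) (\<lambda>p. \<eta> (snd p))"
    by (rule continuous_on_compose2[OF cont]) (auto intro!: continuous_intros)
  have cont3: "continuous_on (UNIV \<times> ?S) (\<lambda>p. f (\<eta> (snd p)))"
    if "\<And>e. e \<in> Dom lam \<Longrightarrow> (f has_real_derivative f' e) (at e)" for f f'
  proof -
    have "continuous_on (Dom lam) f"
      using that by (meson DERIV_continuous_on has_field_derivative_at_within)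
    then show ?thesis
      by (rule continuous_on_compose2[OF _ cont2]) (use mem in auto)
  qed
  note [continuous_intros] = cont2 cont3[OF Kb_deriv] cont3[OF PP_deriv] cont3[OF hh_deriv]
  have "lagrangian_solution lam sine_data ?S
       (\<lambda>a t. KK lam (\<eta> t) a / Kb lam (\<eta> t)) (\<lambda>a t. vv lam a (\<eta> t)) (\<lambda>a t. hh lam (\<eta> t) * rra lam (\<eta> t) a)"
  proof
    show "continuous_on (UNIV \<times> ?S) (\<lambda>(a, t). KK lam (\<eta> t) a / Kb lam (\<eta> t))"
      using mem Kb_pos by (auto simp: split_beta less_imp_neq[THEN not_sym] intro!: continuous_intros)
    show "continuous_on (UNIV \<times> ?S) (\<lambda>(a, t). vv lam a (\<eta> t))"
      using mem by (auto simp: split_beta vv_def intro!: continuous_intros)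
    show "continuous_on (UNIV \<times> ?S) (\<lambda>(a, t). hh lam (\<eta> t) * rra lam (\<eta> t) a)"
      using mem by (auto simp: split_beta intro!: continuous_intros)
    show "integral {0..1} (\<lambda>a. KK lam (\<eta> t) a / Kb lam (\<eta> t)) = 1" if "t \<in> ?S" for t
      using Kb_pos[OF mem[OF that]] by (simp add: Kb_def)
    show "((\<lambda>t. KK lam (\<eta> t) a / Kb lam (\<eta> t)) has_real_derivative
        vv lam a (\<eta> t) * (KK lam (\<eta> t) a / Kb lam (\<eta> t))) (at t)" if "t \<in> ?S" for a t
    proof -
      note e = mem[OF that]
      have "((\<lambda>e. KK lam e a / Kb lam e) has_real_derivative
          (rr lam (\<eta> t) a - PP lam (\<eta> t)) * (KK lam (\<eta> t) a / Kb lam (\<eta> t))) (at (\<eta> t))"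
        using DERIV_divide[OF KK_deriv[OF e] Kb_deriv[OF e]] Kb_pos[OF e]
        by (simp add: PP_def field_simps)
      from DERIV_chain2[OF this der[OF that]] show ?thesis by (simp add: vv_def mult.commute mult.left_commute)
    qed
    show "((\<lambda>a. vv lam a (\<eta> t)) has_real_derivative hh lam (\<eta> t) * rra lam (\<eta> t) a) (at a)"
      if "t \<in> ?S" for a t
      unfolding vv_def using rr_deriv_a[OF mem[OF that], of a] by (auto intro!: derivative_eq_intros)
    show "((\<lambda>t. vv lam a (\<eta> t)) has_real_derivative lam * (vv lam a (\<eta> t))\<^sup>2 -
        (lam + 1) * integral {0..1} (\<lambda>b. (vv lam b (\<eta> t))\<^sup>2 * (KK lam (\<eta> t) b / Kb lam (\<eta> t)))) (at t)"
      if "t \<in> ?S" for a t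
      using DERIV_chain2[OF vv_deriv_e[OF mem[OF that]] der[OF that], of a]
      by (rule DERIV_cong)
        (unfold centred_second_moment[OF mem[OF that]], simp add: vv_def power2_eq_square algebra_simps)
    show "(sine_data has_real_derivative vv lam a (\<eta> 0)) (at a)" for a
      using sine_data_deriv[of a] by (simp add: \<eta> vv_0)
    show "KK lam (\<eta> t) (a + 1) / Kb lam (\<eta> t) = KK lam (\<eta> t) a / Kb lam (\<eta> t)"
      "vv lam (a + 1) (\<eta> t) = vv lam a (\<eta> t)" for a t
      by (simp_all add: KK_def vv_def rr_def Jac_def cs_periodic)
    show "integral {0..1} (\<lambda>a. vv lam a (\<eta> t) * (KK lam (\<eta> t) a / Kb lam (\<eta> t))) = 0" if "t \<in> ?S" for t
      by (rule centred_first_moment[OF mem[OF that]])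
    show "KK lam (\<eta> t) a / Kb lam (\<eta> t) > 0" if "t \<in> ?S" for a t
      using mem[OF that] by (simp add: Kb_pos KK_pos)
  qed (use \<eta>(1-4) in \<open>simp_all add: sine_data_def\<close>)
  with \<eta>(5,7) show thesis by (intro that)
qed

subsection \<open>Integrals of powers of \<open>1 - m cos (2 \<pi> a)\<close>\<close>

text \<open>From \<open>y * cos y \<le> sin y\<close> at \<open>y = x / 2\<close> and the double
  angle formulas, using \<open>cos x \<ge> 0\<close>.\<close>

lemma sin_ge_half:
  assumes "0 \<le> x" "x \<le> pi / 2"
  shows "x / 2 \<le> sin (x :: real)"
proof -
  have "sin 0 - 0 * cos 0 \<le> sin (x / 2) - x / 2 * cos (x / 2)"
  proof (rule DERIV_nonneg_imp_nondecreasing[where f = "\<lambda>y. sin y - y * cos y"])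
    fix y assume y: "0 \<le> y" "y \<le> x / 2"
    have "((\<lambda>y. sin y - y * cos y) has_real_derivative y * sin y) (at y)"
      by (auto intro!: derivative_eq_intros)
    moreover have "y * sin y \<ge> 0" using y assms by (intro mult_nonneg_nonneg sin_ge_zero) auto
    ultimately show "\<exists>z. ((\<lambda>y. sin y - y * cos y) has_real_derivative z) (at y) \<and> z \<ge> 0" by blast
  qed (use assms in auto)
  then have 1: "x / 2 * cos (x / 2) \<le> sin (x / 2)" by simp
  have c: "cos (x / 2) \<ge> 0" using assms by (intro cos_ge_zero) auto
  have "x / 2 \<le> x / 2 * (1 + cos x)"
    using assms by (simp add: mult_le_cancel_left1 cos_ge_zero)
  also have "\<dots> = 2 * (x / 2 * cos (x / 2)) * cos (x / 2)"
    using cos_double_cos[of "x / 2"] by (simp add: power2_eq_square)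
  also have "\<dots> \<le> 2 * sin (x / 2) * cos (x / 2)"
    using 1 c by (intro mult_right_mono) auto
  also have "\<dots> = sin x" using sin_double[of "x / 2"] by simp
  finally show ?thesis .
qed

lemma one_minus_cs: "1 - cs a = 2 * (sin (pi * a))\<^sup>2"
  using cos_double_sin[of "pi * a"] by (simp add: cs_def mult.assoc)

lemma cs_reflect: "cs (1 - a) = cs a"
  by (simp add: cs_def right_diff_distrib cos_diff)

lemma cs_half_shift: "cs (a + 1 / 2) = - cs a"
  by (simp add: cs_def distrib_left)

text \<open>Half-angle formula with \<open>pi > 3\<close>. The companion upper bound uses
  \<open>pi < 4\<close>, whence its constant 32 = 2 * 4^2.\<close>

lemma one_minus_cs_ge:
  assumes "0 \<le> a" "a \<le> 1 / 2" shows "4 * a\<^sup>2 \<le> 1 - cs a"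
proof -
  have "3 * a / 2 \<le> pi * a / 2"
    using assms pi_gt3 by (simp add: mult_right_mono)
  also have "\<dots> \<le> sin (pi * a)"
    using assms by (intro sin_ge_half) auto
  finally have "(3 * a / 2)\<^sup>2 \<le> (sin (pi * a))\<^sup>2"
    using assms by (intro power_mono) auto
  moreover have "4 * a\<^sup>2 \<le> 2 * (3 * a / 2)\<^sup>2" by (simp add: power2_eq_square)
  ultimately show ?thesis unfolding one_minus_cs by linarith
qed

lemma one_minus_cs_le: "1 - cs a \<le> 32 * a\<^sup>2"
proof -
  have "\<bar>sin (pi * a)\<bar> \<le> \<bar>pi * a\<bar>" by (rule abs_sin_x_le_abs_x)
  also have "\<dots> \<le> 4 * \<bar>a\<bar>" using pi_less_4 by (auto simp: abs_mult intro!: mult_right_mono)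
  finally have "\<bar>sin (pi * a)\<bar>\<^sup>2 \<le> (4 * \<bar>a\<bar>)\<^sup>2" by (intro power_mono) auto
  then show ?thesis unfolding one_minus_cs by (simp add: power_mult_distrib)
qed

lemma cs_ge_half: "0 \<le> a \<Longrightarrow> a \<le> 1 / 6 \<Longrightarrow> cs a \<ge> 1 / 2"
  using cos_monotone_0_pi_le[of "2 * pi * a" "pi / 3"] cos_60 by (simp add: cs_def)

lemma cs_nonneg: "0 \<le> a \<Longrightarrow> a \<le> 1 / 4 \<Longrightarrow> cs a \<ge> 0"
  unfolding cs_def by (intro cos_ge_zero) (auto intro: order_trans[of _ 0])

definition J1 :: "real \<Rightarrow> real \<Rightarrow> real" where
  "J1 m a = 1 - m * cs a"

text \<open>By Laplace's integral this is \<open>(1 - m\<^sup>2) powr (- k / 2)\<close> times the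
  Legendre function of degree \<open>k - 1\<close> at \<open>1 / sqrt (1 - m\<^sup>2)\<close>. Here
  \<open>m\<close> stands for \<open>\<bar>lam * e\<bar>\<close>, and \<open>1 - m\<close> is the
  \<epsilon> of the overview.\<close>

definition LI :: "real \<Rightarrow> real \<Rightarrow> real" where
  "LI k m = integral {0..1} (\<lambda>a. J1 m a powr (- k))"

definition LC :: "real \<Rightarrow> real \<Rightarrow> real" where
  "LC k m = integral {0..1} (\<lambda>a. cs a * J1 m a powr (- k))"

lemma J1_ge:
  assumes "0 \<le> m" "m < 1" shows "J1 m a \<ge> 1 - m"
  using assms cs_bound[of a] by (simp add: J1_def abs_le_iff mult_left_le)

lemma J1_pos: "0 \<le> m \<Longrightarrow> m < 1 \<Longrightarrow> J1 m a > 0"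
  using J1_ge[of m a] by linarith

lemma J1_le: 
  assumes "0 \<le> m" "m < 1" shows "J1 m a \<le> 1 - m + 32 * a\<^sup>2"
proof -
  have "m * (1 - cs a) \<le> 1 * (32 * a\<^sup>2)"
    using assms one_minus_cs_le[of a] cs_bound[of a] by (intro mult_mono) (auto simp: abs_le_iff)
  then show ?thesis by (simp add: J1_def algebra_simps)
qed

text \<open>Combines \<open>J1 m a \<ge> 1 - m\<close> and
  \<open>J1 m a \<ge> 4 * a\<^sup>2\<close>. A perfect square is chosen so that powers of the bound
  have an elementary primitive.\<close>

lemma J1_ge_square:
  assumes m: "0 \<le> m" "m < 1" and a: "0 \<le> a" "a \<le> 1 / 2"
  shows "J1 m a \<ge> (sqrt (1 - m) + a)\<^sup>2 / 4"
proof -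
  have a2: "4 * a\<^sup>2 \<le> 1" using a power_mono[of a "1/2" 2] by (simp add: power2_eq_square)
  have "J1 m a = (1 - m) + m * (1 - cs a)" by (simp add: J1_def algebra_simps)
  also have "\<dots> \<ge> (1 - m) + m * (4 * a\<^sup>2)"
    using m one_minus_cs_ge[OF a] by (intro add_left_mono mult_left_mono) auto
  finally have "J1 m a \<ge> (1 - m) * 1 + m * (4 * a\<^sup>2)" by simp
  moreover have "(1 - m) * 1 \<ge> (1 - m) * (4 * a\<^sup>2)"
    using m a2 by (intro mult_left_mono) auto
  ultimately have 1: "J1 m a \<ge> 4 * a\<^sup>2" by (simp add: algebra_simps)
  have 2: "J1 m a \<ge> (sqrt (1 - m))\<^sup>2" using J1_ge[OF m] m by simp
  have "(sqrt (1 - m) + a)\<^sup>2 \<le> 2 * (sqrt (1 - m))\<^sup>2 + 2 * a\<^sup>2"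
    using sum_squares_bound[of "sqrt (1 - m)" a] by (simp add: power2_sum)
  then have "(sqrt (1 - m) + a)\<^sup>2 \<le> 4 * J1 m a" using 1 2 zero_le_power2[of a] by linarith
  then show ?thesis by simp
qed

lemma J1_cont [continuous_intros]:
  fixes g :: "'a::t2_space \<Rightarrow> real"
  shows "continuous_on A g \<Longrightarrow> continuous_on A (\<lambda>x. J1 m (g x))"
  unfolding J1_def by (auto intro!: continuous_intros)

lemma J1_powr_integrable:
  assumes "0 \<le> m" "m < 1"
  shows "(\<lambda>a. J1 m a powr k) integrable_on {c..d}" "(\<lambda>a. cs a * J1 m a powr k) integrable_on {c..d}"
  using J1_pos[OF assms]
  by (auto intro!: integrable_continuous_real continuous_intros simp: less_imp_neq[THEN not_sym])

text \<open>Because \<open>b < 1\<close>, the bound does not degenerate as \<delta> tends to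
  0.\<close>

lemma integral_powr_shift_le:
  fixes b \<delta> :: real
  assumes "0 \<le> b" "b < 1" "0 < \<delta>" "\<delta> \<le> 1"
  shows "integral {0..1} (\<lambda>a. (\<delta> + a) powr (- b)) \<le> 2 / (1 - b)"
proof -
  have "((\<lambda>a. (\<delta> + a) powr (- b)) has_integral
      (\<delta> + 1) powr (1 - b) / (1 - b) - (\<delta> + 0) powr (1 - b) / (1 - b)) {0..1}"
  proof (rule fundamental_theorem_of_calculus)
    fix x :: real assume "x \<in> {0..1}"
    then have "\<delta> + x > 0" using assms by simp
    have "((\<lambda>a. \<delta> + a) has_real_derivative 1) (at x)" by (auto intro!: derivative_eq_intros)
    from DERIV_cdivide[OF DERIV_fun_powr[OF this \<open>\<delta> + x > 0\<close>, of "1 - b"], of "1 - b"]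
    have "((\<lambda>a. (\<delta> + a) powr (1 - b) / (1 - b)) has_real_derivative (\<delta> + x) powr (- b)) (at x)"
      using assms by simp
    then show "((\<lambda>a. (\<delta> + a) powr (1 - b) / (1 - b)) has_vector_derivative (\<delta> + x) powr (- b)) (at x within {0..1})"
      by (metis has_field_derivative_at_within has_real_derivative_iff_has_vector_derivative)
  qed simp
  then have "integral {0..1} (\<lambda>a. (\<delta> + a) powr (- b)) \<le> (\<delta> + 1) powr (1 - b) / (1 - b)"
    using assms by (simp add: has_integral_iff)
  also have "(\<delta> + 1) powr (1 - b) \<le> (\<delta> + 1) powr 1" using assms by (intro powr_mono) auto
  then have "(\<delta> + 1) powr (1 - b) / (1 - b) \<le> 2 / (1 - b)"
    using assms by (intro divide_right_mono) auto
  finally show ?thesis .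
qed

text \<open>Splits the exponent as \<open>2 * k = b + (2 * k - b)\<close>: the part
  \<open>b < 1\<close> is integrated uniformly in \<open>m\<close>, the rest is estimated at
  \<open>a = 0\<close>, where it is largest. The reflection of \<open>a\<close> to
  \<open>1 - a\<close> handles the second half of the period.\<close>

lemma LI_le:
  assumes m: "0 \<le> m" "m < 1" and b: "0 \<le> b" "b < 1" "b \<le> 2 * k"
  shows "LI k m \<le> 4 powr k * sqrt (1 - m) powr (b - 2 * k) * (4 / (1 - b))"
proof -
  define \<delta> where "\<delta> = sqrt (1 - m)"
  have \<delta>: "0 < \<delta>" "\<delta> \<le> 1" using m by (auto simp: \<delta>_def)
  define C where "C = 4 powr k * \<delta> powr (b - 2 * k)"
  have C: "C > 0" using \<delta> by (simp add: C_def)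
  define g where "g a = (\<delta> + a) powr (- b)" for a
  have pt: "J1 m a powr (- k) \<le> C * g a" if a: "0 \<le> a" "a \<le> 1 / 2" for a
  proof -
    have "J1 m a powr (- k) \<le> ((\<delta> + a)\<^sup>2 / 4) powr (- k)"
      using J1_ge_square[OF m a] \<delta> a b by (intro powr_mono2') (auto simp: \<delta>_def[symmetric] add_pos_nonneg)
    also have "\<dots> = 4 powr k * (\<delta> + a) powr (- (2 * k))"
      using \<delta> a by (simp add: powr_divide powr_minus powr_powr field_simps flip: powr_numeral)
    also have "(\<delta> + a) powr (- (2 * k)) = (\<delta> + a) powr (b - 2 * k) * g a"
      unfolding g_def using \<delta> a by (simp flip: powr_add)
    also have "(\<delta> + a) powr (b - 2 * k) \<le> \<delta> powr (b - 2 * k)"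
      using \<delta> a b by (intro powr_mono2') auto
    finally show ?thesis unfolding C_def by (simp add: mult_right_mono g_def mult.assoc)
  qed
  have g0: "g a \<ge> 0" for a by (simp add: g_def)
  have cont: "continuous_on {0..1} g" "continuous_on {0..1} (\<lambda>a. g (1 - a))"
    unfolding g_def using \<delta> by (auto intro!: continuous_intros)
  have I1: "integral {0..1} g \<le> 2 / (1 - b)"
    unfolding g_def by (rule integral_powr_shift_le[OF b(1,2) \<delta>])
  have "LI k m \<le> integral {0..1} (\<lambda>a. C * (g a + g (1 - a)))"
    unfolding LI_def
  proof (rule integral_le)
    fix a :: real assume a: "a \<in> {0..1}"
    show "J1 m a powr (- k) \<le> C * (g a + g (1 - a))"
    proof (cases "a \<le> 1 / 2")
      case True
      then show ?thesis using pt[of a] a C g0[of "1 - a"] by (simp add: distrib_left add_increasing2)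
    next
      case False
      then show ?thesis using pt[of "1 - a"] a C g0[of a] by (simp add: distrib_left add_increasing J1_def cs_reflect)
    qed
  qed (use J1_powr_integrable[OF m] cont in \<open>auto intro!: integrable_continuous_real continuous_intros\<close>)
  also have "\<dots> = C * (integral {0..1} g + integral {0..1} (\<lambda>a. g (1 - a)))"
    using cont by (simp add: integral_add integrable_continuous_real)
  also have "integral {0..1} (\<lambda>a. g (1 - a)) = integral {0..1} g"
  proof -
    have "integral {0..1} g = integral {-1..0} (g \<circ> (\<lambda>a. a + 1))"
      using integral_shift[of "-1" 1 0 g] cont by simp
    also have "\<dots> = integral {0..1} (\<lambda>a. g (1 - a))"
      using Henstock_Kurzweil_Integration.integral_reflect_real[of 0 "-1" "g \<circ> (\<lambda>a. a + 1)"] by (simp add: o_def)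
    finally show ?thesis ..
  qed
  also have "C * (integral {0..1} g + integral {0..1} g) \<le> C * (4 / (1 - b))"
    using I1 C by (intro mult_left_mono) auto
  finally show ?thesis by (simp add: C_def \<delta>_def)
qed

lemma LI_le_neg:
  assumes m: "0 \<le> m" "m < 1" and k: "k \<le> 0"
  shows "LI k m \<le> 2 powr (- k)"
proof -
  have "LI k m \<le> integral {0..1::real} (\<lambda>a. 2 powr (- k))"
    unfolding LI_def
  proof (rule integral_le)
    fix a :: real
    have "\<bar>m * cs a\<bar> \<le> 1 * 1" unfolding abs_mult using m cs_bound[of a] by (intro mult_mono) auto
    then show "J1 m a powr (- k) \<le> 2 powr (- k)"
      using J1_pos[OF m, of a] k by (intro powr_mono2) (auto simp: J1_def)
  qed (use J1_powr_integrable[OF m] in auto)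
  then show ?thesis by simp
qed

lemma integral_subset_ge:
  fixes f :: "real \<Rightarrow> real"
  assumes "f integrable_on {0..1}" "\<And>a. a \<in> {0..1} \<Longrightarrow> f a \<ge> 0" "0 \<le> d" "d \<le> 1"
    and "g integrable_on {0..d}" "\<And>a. a \<in> {0..d} \<Longrightarrow> g a \<le> f a"
  shows "integral {0..d} g \<le> integral {0..1} f"
proof -
  have f: "f integrable_on {0..d}"
    by (rule integrable_subinterval_real[OF assms(1)]) (use assms in auto)
  have "integral {0..d} g \<le> integral {0..d} f"
    by (rule integral_le) (use assms f in auto)
  also have "\<dots> \<le> integral {0..1} f"
    by (rule integral_subset_le) (use assms f in auto)
  finally show ?thesis .
qed

text \<open>Keeps only the labels up to \<open>sqrt (1 - m)\<close>, where \<open>J1\<close> is at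
  most (1 + 32) * (1 - m).\<close>

lemma LI_ge:
  assumes m: "0 \<le> m" "m < 1" and k: "k \<ge> 0"
  shows "LI k m \<ge> sqrt (1 - m) * (33 * (1 - m)) powr (- k)"
proof -
  define \<delta> where "\<delta> = sqrt (1 - m)"
  have \<delta>: "0 < \<delta>" "\<delta> \<le> 1" "\<delta>\<^sup>2 = 1 - m" using m by (auto simp: \<delta>_def)
  have "integral {0..\<delta>} (\<lambda>a. (33 * (1 - m)) powr (- k)) \<le> LI k m"
    unfolding LI_def
  proof (rule integral_subset_ge)
    fix a assume a: "a \<in> {0..\<delta>}"
    then have "a\<^sup>2 \<le> \<delta>\<^sup>2" by (intro power_mono) auto
    then have "J1 m a \<le> 33 * (1 - m)" using J1_le[OF m, of a] \<delta> by simp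
    then show "(33 * (1 - m)) powr (- k) \<le> J1 m a powr (- k)"
      using J1_pos[OF m] k by (intro powr_mono2') auto
  qed (use \<delta> J1_powr_integrable[OF m] in auto)
  then show ?thesis using \<delta> by (simp add: \<delta>_def)
qed

lemma J1_powr_ge_1:
  assumes m: "0 \<le> m" "m < 1" and k: "k \<ge> 0" and "cs a \<ge> 0"
  shows "J1 m a powr (- k) \<ge> 1"
proof -
  have "J1 m a \<le> 1" using m assms by (simp add: J1_def)
  then have "1 powr (- k) \<le> J1 m a powr (- k)" using J1_pos[OF m] k by (intro powr_mono2') auto
  then show ?thesis by simp
qed

text \<open>Subtracting the vanishing integral of \<open>cs\<close> makes the integrand nonnegative.\<close>
lemma LC_eq: 
  assumes m: "0 \<le> m" "m < 1"
  shows "LC k m = integral {0..1} (\<lambda>a. cs a * (J1 m a powr (- k) - 1))"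
proof -
  have "cs integrable_on {0..1}" by (auto intro!: integrable_continuous_real continuous_intros)
  then have "integral {0..1} (\<lambda>a. cs a * J1 m a powr (- k) - cs a) = LC k m - integral {0..1} cs"
    unfolding LC_def by (intro integral_diff J1_powr_integrable[OF m])
  then show ?thesis by (simp add: integral_cs right_diff_distrib)
qed

text \<open>After subtracting 1 both factors have the same sign, because \<open>cs a \<ge> 0\<close>
  forces \<open>J1 \<le> 1\<close> and conversely. The integral may then be restricted to
  \<open>{0..d}\<close>, where \<open>d \<le> 1 / 6\<close> keeps \<open>cs\<close> above
  1/2.\<close>

lemma LC_ge_subset:
  assumes m: "0 \<le> m" "m < 1" and k: "k \<ge> 0" and d: "0 \<le> d" "d \<le> 1 / 6"
    and g: "g integrable_on {0..d}" "\<And>a. a \<in> {0..d} \<Longrightarrow> g a \<le> J1 m a powr (- k)"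
  shows "LC k m \<ge> (integral {0..d} g - d) / 2"
proof -
  have "integral {0..d} (\<lambda>a. (g a - 1) / 2) \<le> integral {0..1} (\<lambda>a. cs a * (J1 m a powr (- k) - 1))"
  proof (rule integral_subset_ge)
    show "(\<lambda>a. cs a * (J1 m a powr (- k) - 1)) integrable_on {0..1}"
      using J1_pos[OF m]
      by (auto intro!: integrable_continuous_real continuous_intros simp: less_imp_neq[THEN not_sym])
    show "cs a * (J1 m a powr (- k) - 1) \<ge> 0" for a
    proof (cases "cs a \<ge> 0")
      case True
      then show ?thesis using J1_powr_ge_1[OF m k] by simp
    next
      case False
      then have "J1 m a \<ge> 1" using m by (simp add: J1_def mult_nonneg_nonpos)
      then have "J1 m a powr (- k) \<le> 1 powr (- k)" using k by (intro powr_mono2') auto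
      then show ?thesis using False by (simp add: mult_nonpos_nonpos)
    qed
    show "(g a - 1) / 2 \<le> cs a * (J1 m a powr (- k) - 1)" if a: "a \<in> {0..d}" for a
    proof -
      have c: "cs a \<ge> 1 / 2" using a d by (intro cs_ge_half) auto
      have "(g a - 1) / 2 \<le> 1 / 2 * (J1 m a powr (- k) - 1)" using g(2)[OF a] by simp
      also have "\<dots> \<le> cs a * (J1 m a powr (- k) - 1)"
        using c J1_powr_ge_1[OF m k, of a] by (intro mult_right_mono) auto
      finally show ?thesis .
    qed
    show "(\<lambda>a. (g a - 1) / 2) integrable_on {0..d}"
      using integrable_diff[OF g(1) integrable_const_ivl[of 1 0 d]] by (rule integrable_on_divide)
  qed (use d in auto)
  also have "\<dots> = LC k m" by (rule LC_eq[OF m, symmetric])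
  finally have "integral {0..d} (\<lambda>a. g a - 1) / 2 \<le> LC k m" by simp
  moreover have "integral {0..d} (\<lambda>a. g a - 1) = integral {0..d} g - d"
    using d integral_diff[OF g(1) integrable_const_ivl[of 1 0 d]] by simp
  ultimately show ?thesis by simp
qed

lemma LC_ge_power:
  assumes m: "0 \<le> m" "m < 1" and k: "k \<ge> 0" and "sqrt (1 - m) \<le> 1 / 6"
  shows "LC k m \<ge> sqrt (1 - m) * ((33 * (1 - m)) powr (- k) - 1) / 2"
proof -
  define \<delta> where "\<delta> = sqrt (1 - m)"
  have \<delta>: "0 < \<delta>" "\<delta> \<le> 1 / 6" "\<delta>\<^sup>2 = 1 - m" using assms by (auto simp: \<delta>_def)
  have "LC k m \<ge> (integral {0..\<delta>} (\<lambda>a. (33 * (1 - m)) powr (- k)) - \<delta>) / 2"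
  proof (rule LC_ge_subset[OF m k])
    fix a assume a: "a \<in> {0..\<delta>}"
    then have "a\<^sup>2 \<le> \<delta>\<^sup>2" by (intro power_mono) auto
    then have "J1 m a \<le> 33 * (1 - m)" using J1_le[OF m, of a] \<delta> by simp
    then show "(33 * (1 - m)) powr (- k) \<le> J1 m a powr (- k)"
      using J1_pos[OF m] k by (intro powr_mono2') auto
  qed (use \<delta> in auto)
  then show ?thesis using \<delta> by (simp add: \<delta>_def right_diff_distrib)
qed

text \<open>At the critical exponent 1/2 the integrand behaves like
  \<open>1 / (\<delta> + a)\<close>, hence the logarithm; a larger \<open>k\<close> only increases
  the integrand where \<open>J1 \<le> 1\<close>.\<close>

lemma LC_ge_log:
  assumes m: "0 \<le> m" "m < 1" and k: "k \<ge> 1 / 2"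
  shows "LC k m \<ge> (- ln (sqrt (1 - m)) - 1) / 12"
proof -
  define \<delta> where "\<delta> = sqrt (1 - m)"
  have \<delta>: "0 < \<delta>" "\<delta>\<^sup>2 = 1 - m" using assms by (auto simp: \<delta>_def)
  have I: "((\<lambda>a. 1 / (\<delta> + 6 * a)) has_integral ln (\<delta> + 6 * (1 / 6)) / 6 - ln (\<delta> + 6 * 0) / 6) {0..1/6}"
  proof (rule fundamental_theorem_of_calculus)
    fix x :: real assume "x \<in> {0..1/6}"
    then have "\<delta> + 6 * x > 0" using \<delta> by (simp add: add_pos_nonneg)
    then have "((\<lambda>a. ln (\<delta> + 6 * a) / 6) has_real_derivative 1 / (\<delta> + 6 * x)) (at x)"
      by (auto intro!: derivative_eq_intros simp: field_simps)
    then show "((\<lambda>a. ln (\<delta> + 6 * a) / 6) has_vector_derivative 1 / (\<delta> + 6 * x)) (at x within {0..1/6})"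
      by (metis has_field_derivative_at_within has_real_derivative_iff_has_vector_derivative)
  qed simp
  have "LC k m \<ge> (integral {0..1/6} (\<lambda>a. 1 / (\<delta> + 6 * a)) - 1 / 6) / 2"
  proof (rule LC_ge_subset[OF m])
    fix a :: real assume a: "a \<in> {0..1/6}"
    have c: "cs a \<ge> 0" using a cs_ge_half[of a] by simp
    then have J: "J1 m a \<le> 1" using m by (simp add: J1_def)
    have "\<delta> * a \<ge> 0" using \<delta> a by simp
    \<comment> \<open>The slope 6 works because 6^2 = 36 exceeds the constant 32 of
      \<open>J1_le\<close>.\<close>
    then have "J1 m a \<le> (\<delta> + 6 * a)\<^sup>2"
    proof -
      have "(\<delta> + 6 * a)\<^sup>2 = \<delta>\<^sup>2 + 36 * a\<^sup>2 + 12 * (\<delta> * a)"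
        by (simp add: power2_sum power_mult_distrib)
      then show ?thesis using \<open>\<delta> * a \<ge> 0\<close> J1_le[OF m, of a] \<delta>(2) zero_le_power2[of a] by linarith
    qed
    then have "((\<delta> + 6 * a)\<^sup>2) powr (- 1 / 2) \<le> J1 m a powr (- 1 / 2)"
      using J1_pos[OF m] by (intro powr_mono2') auto
    moreover have "((\<delta> + 6 * a)\<^sup>2) powr (- 1 / 2) = 1 / (\<delta> + 6 * a)"
      using \<delta> a by (simp add: powr_minus_divide powr_half_sqrt)
    moreover have "J1 m a powr (- 1 / 2) \<le> J1 m a powr (- k)"
      using J J1_pos[OF m, of a] k by (intro powr_mono') auto
    ultimately show "1 / (\<delta> + 6 * a) \<le> J1 m a powr (- k)" by linarith
  qed (use k I in \<open>auto simp: has_integral_iff\<close>)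
  moreover have "ln (\<delta> + 1) \<ge> 0" using \<delta> by simp
  ultimately show ?thesis using I by (simp add: has_integral_iff \<delta>_def field_simps)
qed

text \<open>A shift by half a period changes the sign of the cosine, and integrals over a full
  period do not depend on the starting point. It reduces negative \<open>lam\<close> to integrals
  with singularity at label 0.\<close>

lemma integral_cs_flip:
  assumes "continuous_on {-1..1} f"
  shows "integral {0..1} (\<lambda>a. f (- cs a)) = integral {0..1} (\<lambda>a. f (cs a) :: real)"
proof -
  have c: "continuous_on A (\<lambda>a. f (cs a))" for A
    by (rule continuous_on_compose2[OF assms])
      (use cs_bound in \<open>auto intro!: continuous_intros simp: abs_le_iff minus_le_iff\<close>)
  define F where "F = prim (\<lambda>a. f (cs a))"
  have F: "(F has_real_derivative f (cs a)) (at a)" for a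
    unfolding F_def by (rule prim_has_real_derivative[of UNIV]) (auto intro: c)
  have "integral {0..1} (\<lambda>a. f (- cs a)) = integral {0..1} ((\<lambda>a. f (cs a)) \<circ> (\<lambda>a. a + 1 / 2))"
    by (simp add: o_def cs_half_shift)
  also have "\<dots> = integral {0 + 1 / 2..1 + 1 / 2} (\<lambda>a. f (cs a))"
    by (rule integral_shift[OF c])
  also have "\<dots> = F (1 / 2 + 1) - F (1 / 2)"
    using prim_diff_has_integral[OF c, of "1 / 2" "3 / 2"] by (simp add: has_integral_iff F_def)
  also have "\<dots> = F 1"
    using quasi_periodic[OF F, of "1 / 2"] by (simp add: cs_periodic F_def)
  finally show ?thesis by (simp add: F_def prim_1)
qed

subsection \<open>The moments \<open>Kb\<close> and \<open>Nb\<close>\<close>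

lemma Dom_iff: "lam \<noteq> 0 \<Longrightarrow> 0 \<le> e \<Longrightarrow> e \<in> Dom lam \<longleftrightarrow> e < 1 / \<bar>lam\<bar>"
  by (simp add: Dom_def abs_mult field_simps)

lemma Kb_Nb_pos:
  assumes "lam > 0"
  shows "Kb lam e = LI (1 / lam) (lam * e)"
    and "e \<in> Dom lam \<Longrightarrow> Nb lam e = LC (1 / lam + 1) (lam * e)"
proof -
  have K: "KK lam e a = J1 (lam * e) a powr (- (1 / lam))" for a
    using assms by (simp add: KK_def J1_def Jac_def)
  then show "Kb lam e = LI (1 / lam) (lam * e)"
    unfolding Kb_def LI_def by (intro integral_cong) simp
  assume e: "e \<in> Dom lam"
  have "rr lam e a * KK lam e a = cs a * J1 (lam * e) a powr (- (1 / lam + 1))" for a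
    using Jac_pos[OF e, of a] unfolding K
    by (simp add: rr_def J1_def Jac_def powr_diff[of _ _ 1, simplified])
  then show "Nb lam e = LC (1 / lam + 1) (lam * e)"
    by (simp add: Nb_def LC_def)
qed

text \<open>The flip replaces \<open>cs\<close> by \<open>- cs\<close>, so that
  \<open>m = - lam * e\<close> is nonnegative. The exponent \<open>1 / lam\<close> of
  \<open>Kb\<close> is now negative, and only \<open>Nb\<close> can become singular.\<close>

lemma Kb_Nb_neg:
  assumes "lam < 0" "e \<ge> 0" "e \<in> Dom lam"
  shows "Kb lam e = LI (1 / lam) (- lam * e)"
    and "Nb lam e = - LC (1 / lam + 1) (- lam * e)"
proof -
  define m where "m = - lam * e"
  have m: "0 \<le> m" "m < 1"
    using assms by (auto simp: m_def Dom_def abs_mult mult_nonpos_nonneg)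
  have pos: "1 - m * c > 0" "1 + m * c > 0" if "c \<in> {-1..1}" for c
  proof -
    have "\<bar>m * c\<bar> \<le> m * 1" unfolding abs_mult using m that by (intro mult_mono) auto
    then show "1 - m * c > 0" "1 + m * c > 0" using m by (auto simp: abs_le_iff)
  qed
  have K: "KK lam e a = (1 + m * cs a) powr (- (1 / lam))" for a
    using assms by (simp add: KK_def Jac_def m_def)
  have rK: "rr lam e a * KK lam e a = - (- cs a * (1 + m * cs a) powr (- (1 / lam + 1)))" for a
    using Jac_pos[OF assms(3), of a] unfolding K
    by (simp add: rr_def m_def Jac_def powr_diff[of _ _ 1, simplified])
  have "integral {0..1} (\<lambda>a. (1 - m * (- cs a)) powr (- (1 / lam)))
      = integral {0..1} (\<lambda>a. (1 - m * cs a) powr (- (1 / lam)))"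
    by (rule integral_cs_flip) (use pos in \<open>force intro!: continuous_intros\<close>)
  then show "Kb lam e = LI (1 / lam) (- lam * e)"
    unfolding m_def[symmetric] Kb_def LI_def ext[OF K] J1_def by simp
  have "integral {0..1} (\<lambda>a. - cs a * (1 - m * (- cs a)) powr (- (1 / lam + 1)))
      = integral {0..1} (\<lambda>a. cs a * (1 - m * cs a) powr (- (1 / lam + 1)))"
    by (rule integral_cs_flip) (use pos in \<open>force intro!: continuous_intros\<close>)
  then show "Nb lam e = - LC (1 / lam + 1) (- lam * e)"
    unfolding m_def[symmetric] by (simp add: Nb_def LC_def rK J1_def)
qed

text \<open>For \<open>e \<ge> 0\<close> the weight increases with \<open>cs a\<close> whatever the
  sign of \<open>lam\<close>, and it equals 1 where \<open>cs a = 0\<close>.\<close>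

lemma KK_ge_1:
  assumes "e \<ge> 0" "e \<in> Dom lam" "cs a \<ge> 0"
  shows "KK lam e a \<ge> 1"
proof (cases lam "0 :: real" rule: linorder_cases)
  case less
  then have "Jac lam e a \<ge> 1" using assms by (simp add: Jac_def mult_nonpos_nonneg)
  then have "1 powr (- 1 / lam) \<le> Jac lam e a powr (- 1 / lam)"
    using less by (intro powr_mono2) (auto simp: divide_le_0_iff)
  then show ?thesis using less by (simp add: KK_def)
next
  case greater
  then have "Jac lam e a \<le> 1" using assms by (simp add: Jac_def)
  then have "1 powr (- 1 / lam) \<le> Jac lam e a powr (- 1 / lam)"
    using greater Jac_pos[OF assms(2)] by (intro powr_mono2') auto
  then show ?thesis using greater by (simp add: KK_def)
qed (use assms in \<open>simp add: KK_def\<close>)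

lemma KK_le_1:
  assumes "e \<ge> 0" "e \<in> Dom lam" "cs a \<le> 0"
  shows "KK lam e a \<le> 1"
proof (cases lam "0 :: real" rule: linorder_cases)
  case less
  then have "Jac lam e a \<le> 1" using assms by (simp add: Jac_def mult_nonpos_nonneg mult_nonpos_nonpos)
  then have "Jac lam e a powr (- 1 / lam) \<le> 1 powr (- 1 / lam)"
    using less Jac_pos[OF assms(2), of a] by (intro powr_mono2) (auto simp: divide_le_0_iff)
  then show ?thesis using less by (simp add: KK_def)
next
  case greater
  then have "Jac lam e a \<ge> 1" using assms by (simp add: Jac_def mult_nonneg_nonpos)
  then have "Jac lam e a powr (- 1 / lam) \<le> 1 powr (- 1 / lam)"
    using greater by (intro powr_mono2') auto
  then show ?thesis using greater by (simp add: KK_def)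
qed (use assms in \<open>simp add: KK_def mult_nonneg_nonpos\<close>)

text \<open>The quarter period \<open>{0..1/4}\<close>, where \<open>cs \<ge> 0\<close>, alone
  contributes 1/4.\<close>

lemma Kb_ge:
  assumes "e \<ge> 0" "e \<in> Dom lam"
  shows "Kb lam e \<ge> 1 / 4"
proof -
  have "integral {0..1/4::real} (\<lambda>a. 1) \<le> Kb lam e"
    unfolding Kb_def
    by (rule integral_subset_ge)
      (use assms integrable_moments(1)[OF assms(2)] KK_ge_1[OF assms] KK_pos[OF assms(2)] cs_nonneg
        in \<open>auto simp: less_imp_le\<close>)
  then show ?thesis by simp
qed

lemma cs_KK_integrable: "e \<in> Dom lam \<Longrightarrow> (\<lambda>a. cs a * KK lam e a) integrable_on {0..1}"
  by (auto intro!: integrable_continuous_real continuous_intros)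

text \<open>\<open>KK - 1\<close> has the sign of \<open>cs\<close>, so
  \<open>cs \<le> cs * KK\<close> pointwise, and \<open>cs\<close> has mean zero. This controls the
  last term of \<open>Nb_contiguity\<close>.\<close>

lemma cs_KK_integral_nonneg:
  assumes "e \<ge> 0" "e \<in> Dom lam"
  shows "integral {0..1} (\<lambda>a. cs a * KK lam e a) \<ge> 0"
proof -
  have "integral {0..1} cs \<le> integral {0..1} (\<lambda>a. cs a * KK lam e a)"
  proof (rule integral_le)
    show "cs a \<le> cs a * KK lam e a" for a
      using mult_left_mono[OF KK_ge_1[OF assms, of a], of "cs a"]
        mult_left_mono_neg[OF KK_le_1[OF assms, of a], of "cs a"]
      by (cases "cs a \<ge> 0") auto
  qed (use cs_KK_integrable[OF assms(2)] in \<open>auto intro!: integrable_continuous_real continuous_intros\<close>)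
  then show ?thesis by (simp add: integral_cs)
qed

text \<open>Integrate the derivative of \<open>sin (2 \<pi> a) KK\<close> over a period; this is a contiguity relation of
  Legendre functions.\<close>
lemma Nb_contiguity:
  assumes "lam \<noteq> 0" "e \<in> Dom lam"
  shows "(1 - (lam * e)\<^sup>2) * Nb lam e
    = lam * e * Kb lam e - (lam - 1) * integral {0..1} (\<lambda>a. cs a * KK lam e a)"
proof -
  define \<mu> where "\<mu> = lam * e"
  define f where "f a = 2 * pi / lam * ((lam - 1) * (cs a * KK lam e a) - \<mu> * KK lam e a
      + (1 - \<mu>\<^sup>2) * (rr lam e a * KK lam e a))" for a
  have "((\<lambda>a. sin (2 * pi * a) * KK lam e a) has_real_derivative f a) (at a)" for a
  proof -
    have J: "Jac lam e a > 0" by (rule Jac_pos[OF assms(2)])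
    have "((\<lambda>a. Jac lam e a) has_real_derivative \<mu> * (2 * pi * sin (2 * pi * a))) (at a)"
      unfolding Jac_def \<mu>_def using cs_deriv[of a] by (auto intro!: derivative_eq_intros)
    from DERIV_fun_powr[OF this J, of "- 1 / lam"]
    have "((\<lambda>a. KK lam e a) has_real_derivative
        - 1 / lam * (KK lam e a / Jac lam e a) * (\<mu> * (2 * pi * sin (2 * pi * a)))) (at a)"
      using assms(1) J by (simp add: KK_def powr_diff)
    then have "((\<lambda>a. sin (2 * pi * a) * KK lam e a) has_real_derivative
        sin (2 * pi * a) * (- 1 / lam * (KK lam e a / Jac lam e a) * (\<mu> * (2 * pi * sin (2 * pi * a))))
         + 2 * pi * cs a * KK lam e a) (at a)"
      by (auto intro!: derivative_eq_intros simp: cs_def)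
    then show ?thesis
    proof (rule DERIV_cong)
      have s2: "sin (2 * pi * a) * sin (2 * pi * a) = 1 - cs a * cs a"
        using sin_cos_squared_add[of "2 * pi * a"] by (simp add: cs_def power2_eq_square)
      have "lam * (sin (2 * pi * a) * (- 1 / lam * (KK lam e a / Jac lam e a) * (\<mu> * (2 * pi * sin (2 * pi * a))))
         + 2 * pi * cs a * KK lam e a) =
        2 * pi * KK lam e a * (lam * cs a - \<mu> * (1 - cs a * cs a) / Jac lam e a)"
        using assms(1) unfolding s2[symmetric] by (simp add: field_simps)
      also have "\<mu> * (1 - cs a * cs a) / Jac lam e a = cs a + \<mu> - (1 - \<mu>\<^sup>2) * rr lam e a"
      proof -
        \<comment> \<open>Polynomial division of \<open>\<mu> * (1 - cs\<^sup>2)\<close> by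
          \<open>1 - \<mu> * cs\<close>, which trades the squared sine for the three moments
          \<open>cs * KK\<close>, \<open>KK\<close> and \<open>rr * KK\<close>.\<close>
        have "\<mu> * (1 - cs a * cs a) = (cs a + \<mu>) * Jac lam e a - (1 - \<mu>\<^sup>2) * cs a"
          unfolding Jac_def \<mu>_def[symmetric] by (simp add: algebra_simps power2_eq_square)
        then show ?thesis using J by (simp add: rr_def diff_divide_distrib)
      qed
      also have "2 * pi * KK lam e a * (lam * cs a - (cs a + \<mu> - (1 - \<mu>\<^sup>2) * rr lam e a)) = lam * f a"
        using assms(1) by (simp add: f_def algebra_simps)
      finally show "sin (2 * pi * a) * (- 1 / lam * (KK lam e a / Jac lam e a) * (\<mu> * (2 * pi * sin (2 * pi * a))))
         + 2 * pi * cs a * KK lam e a = f a"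
        using assms(1) by simp
    qed
  qed
  then have "(f has_integral (sin (2 * pi * 1) * KK lam e 1 - sin (2 * pi * 0) * KK lam e 0)) {0..1}"
    by (intro fundamental_theorem_of_calculus)
      (auto simp: has_real_derivative_iff_has_vector_derivative[symmetric] intro: has_field_derivative_at_within)
  then have 0: "(f has_integral 0) {0..1}" by simp
  have "(f has_integral (2 * pi / lam * ((lam - 1) * integral {0..1} (\<lambda>a. cs a * KK lam e a)
      - \<mu> * Kb lam e + (1 - \<mu>\<^sup>2) * Nb lam e))) {0..1}"
    unfolding f_def Nb_def Kb_def
    using integrable_moments[OF assms(2)] cs_KK_integrable[OF assms(2)]
    by (intro has_integral_mult_right has_integral_diff has_integral_add) (auto simp: has_integral_iff)
  from has_integral_unique[OF this 0] assms(1)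
  have "(lam - 1) * integral {0..1} (\<lambda>a. cs a * KK lam e a) - \<mu> * Kb lam e + (1 - \<mu>\<^sup>2) * Nb lam e = 0"
    by simp
  then show ?thesis by (simp add: \<mu>_def)
qed

lemma abs_rr_le:
  assumes "e \<in> Dom lam" shows "\<bar>rr lam e a\<bar> \<le> 1 / (1 - \<bar>lam * e\<bar>)"
proof -
  have "\<bar>lam * e * cs a\<bar> \<le> \<bar>lam * e\<bar> * 1"
    unfolding abs_mult[of _ "cs a"] by (rule mult_left_mono[OF cs_bound]) simp
  then have "Jac lam e a \<ge> 1 - \<bar>lam * e\<bar>" by (simp add: Jac_def)
  then show ?thesis
    unfolding rr_def abs_divide using assms cs_bound[of a]
    by (intro frac_le) (auto simp: Dom_def)
qed

text \<open>\<open>PP\<close> is the average of \<open>rr\<close> with positive weight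
  \<open>KK\<close>, so it inherits the bound for \<open>rr\<close>.\<close>

lemma abs_PP_le:
  assumes "e \<in> Dom lam" shows "\<bar>PP lam e\<bar> \<le> 1 / (1 - \<bar>lam * e\<bar>)"
proof -
  have "norm (Nb lam e) \<le> integral {0..1} (\<lambda>a. 1 / (1 - \<bar>lam * e\<bar>) * KK lam e a)"
    unfolding Nb_def
  proof (rule integral_norm_bound_integral)
    show "norm (rr lam e a * KK lam e a) \<le> 1 / (1 - \<bar>lam * e\<bar>) * KK lam e a" for a
      using mult_right_mono[OF abs_rr_le[OF assms, of a], of "KK lam e a"] KK_pos[OF assms, of a]
      by (simp add: abs_mult)
  qed (rule integrable_moments[OF assms] integrable_on_mult_right)+
  then have "\<bar>Nb lam e\<bar> \<le> 1 / (1 - \<bar>lam * e\<bar>) * Kb lam e" by (simp add: Kb_def)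
  then show ?thesis using Kb_pos[OF assms] by (simp add: PP_def abs_divide pos_divide_le_eq)
qed

lemma powr_neg_at_top:
  assumes "p < 0" shows "filterlim (\<lambda>x::real. x powr p) at_top (at_right 0)"
proof -
  have "filterlim (\<lambda>x. - p * - ln x) at_top (at_right (0::real))"
    by (rule filterlim_tendsto_pos_mult_at_top[OF tendsto_const])
      (use assms ln_at_0 in \<open>auto simp: filterlim_uminus_at_top\<close>)
  from filterlim_compose[OF exp_at_top this]
  have "filterlim (\<lambda>x. exp (p * ln x)) at_top (at_right (0::real))" by simp
  then show ?thesis
    by (rule filterlim_mono_eventually)
      (auto simp: powr_def eventually_at_filter)
qed

lemma eps_at_right_0:
  fixes lam :: real
  assumes "lam \<noteq> 0"
  shows "filterlim (\<lambda>e. 1 - \<bar>lam\<bar> * e) (at_right 0) (at_left (1 / \<bar>lam\<bar>))"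
  unfolding filterlim_at
proof
  show "\<forall>\<^sub>F e in at_left (1 / \<bar>lam\<bar>). 1 - \<bar>lam\<bar> * e \<in> {0<..} \<and> 1 - \<bar>lam\<bar> * e \<noteq> 0"
    unfolding eventually_at_filter
  proof (rule always_eventually, intro allI impI)
    fix x assume "x \<in> {..<1 / \<bar>lam\<bar>}"
    then have "\<bar>lam\<bar> * x < \<bar>lam\<bar> * (1 / \<bar>lam\<bar>)" using assms by (intro mult_strict_left_mono) auto
    then show "1 - \<bar>lam\<bar> * x \<in> {0<..} \<and> 1 - \<bar>lam\<bar> * x \<noteq> 0" using assms by simp
  qed
  have "((\<lambda>e. 1 - \<bar>lam\<bar> * e) \<longlongrightarrow> 1 - \<bar>lam\<bar> * (1 / \<bar>lam\<bar>)) (at_left (1 / \<bar>lam\<bar>))"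
    by (intro tendsto_intros)
  then show "((\<lambda>e. 1 - \<bar>lam\<bar> * e) \<longlongrightarrow> 0) (at_left (1 / \<bar>lam\<bar>))" using assms by simp
qed

lemma eventually_Dom:
  assumes "lam \<noteq> 0"
  shows "\<forall>\<^sub>F e in at_left (1 / \<bar>lam\<bar>). 0 \<le> e \<and> e \<in> Dom lam"
proof -
  have "\<forall>\<^sub>F e in at_left (1 / \<bar>lam\<bar>). e \<in> {0<..<1 / \<bar>lam\<bar>}"
    using assms by (intro eventually_at_left_real) simp
  then show ?thesis by eventually_elim (use Dom_iff[OF assms] in auto)
qed

lemma Dom_Icc:
  assumes "e \<in> Dom lam" "0 \<le> x" "x \<le> e"
  shows "x \<in> Dom lam"
proof -
  have "\<bar>lam * x\<bar> \<le> \<bar>lam * e\<bar>" unfolding abs_mult using assms by (intro mult_left_mono) auto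
  then show ?thesis using assms by (simp add: Dom_def)
qed

lemma Dom_pos:
  assumes "lam > 0" "0 \<le> e" "e \<in> Dom lam"
  shows "0 \<le> lam * e" "lam * e < 1"
  using assms by (auto simp: Dom_def)

lemma Kb_powr_hh: "e \<in> Dom lam \<Longrightarrow> Kb lam e powr (2 * lam) = 1 / hh lam e"
  by (simp add: hh_def powr_minus field_simps)

subsection \<open>Decay for \<open>0 < \<lambda> \<le> 1\<close>\<close>

text \<open>Raise the lower bound \<open>LI_ge\<close> to the power \<open>- 2 * lam\<close>: the
  width contributes \<open>- lam\<close>, the height contributes 2, and 1089 = 33^2.\<close>

lemma hh_le:
  assumes lam: "0 < lam" and e: "0 \<le> e" "e \<in> Dom lam"
  shows "hh lam e \<le> 1089 * (1 - lam * e) powr (2 - lam)"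
proof -
  define \<epsilon> where "\<epsilon> = 1 - lam * e"
  note m = Dom_pos[OF lam e]
  have \<epsilon>: "\<epsilon> > 0" using m by (simp add: \<epsilon>_def)
  define b where "b = \<epsilon> powr (1 / 2) * (33 * \<epsilon>) powr (- (1 / lam))"
  have b: "b > 0" using \<epsilon> by (simp add: b_def)
  have "Kb lam e \<ge> b"
    using LI_ge[OF m, of "1 / lam"] Kb_Nb_pos(1)[OF lam, of e] lam \<epsilon>
    by (simp add: b_def \<epsilon>_def powr_half_sqrt)
  then have "hh lam e \<le> b powr (- 2 * lam)"
    unfolding hh_def using b lam by (intro powr_mono2') auto
  also have "\<dots> = \<epsilon> powr (- lam) * (33 * \<epsilon>) powr 2"
    using \<epsilon> lam by (simp add: b_def powr_mult powr_powr)
  also have "(33 * \<epsilon>) powr 2 = 1089 * \<epsilon> powr 2"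
    using \<epsilon> by (simp add: powr_mult)
  also have "\<epsilon> powr (- lam) * (1089 * \<epsilon> powr 2) = 1089 * \<epsilon> powr (2 - lam)"
    using powr_add[of \<epsilon> "- lam" 2] by simp
  finally show ?thesis by (simp add: \<epsilon>_def)
qed

text \<open>\<open>hh\<close> loses to the two bounds \<open>1 / \<epsilon>\<close> for
  \<open>rr\<close> and \<open>PP\<close> by one power, leaving \<open>1 - lam\<close>; this is
  positive, hence gives decay, exactly for \<open>lam < 1\<close>.\<close>

lemma abs_vv_le:
  assumes lam: "0 < lam" and e: "0 \<le> e" "e \<in> Dom lam"
  shows "\<bar>vv lam a e\<bar> \<le> 2178 * (1 - lam * e) powr (1 - lam)"
proof -
  note m = Dom_pos[OF lam e]
  define \<epsilon> where "\<epsilon> = 1 - lam * e"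
  have \<epsilon>: "\<epsilon> > 0" using m by (simp add: \<epsilon>_def)
  have "\<bar>rr lam e a - PP lam e\<bar> \<le> 1 / \<epsilon> + 1 / \<epsilon>"
    using abs_rr_le[OF e(2), of a] abs_PP_le[OF e(2)] m by (simp add: \<epsilon>_def)
  then have "\<bar>vv lam a e\<bar> \<le> 1089 * \<epsilon> powr (2 - lam) * (1 / \<epsilon> + 1 / \<epsilon>)"
    unfolding vv_def abs_mult using hh_le[OF lam e] hh_pos[OF e(2)] by (intro mult_mono) (auto simp: \<epsilon>_def)
  also have "\<dots> = 2178 * (\<epsilon> powr (2 - lam) / \<epsilon> powr 1)" using \<epsilon> by simp
  also have "\<dots> = 2178 * \<epsilon> powr (1 - lam)" unfolding powr_diff[symmetric] by simp
  finally show ?thesis by (simp add: \<epsilon>_def)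
qed

lemma vv_tendsto_0:
  assumes "0 < lam" "lam < 1"
  shows "((\<lambda>e. vv lam a e) \<longlongrightarrow> 0) (at_left (1 / \<bar>lam\<bar>))"
proof (rule Lim_null_comparison)
  show "\<forall>\<^sub>F e in at_left (1 / \<bar>lam\<bar>). norm (vv lam a e) \<le> 2178 * (1 - \<bar>lam\<bar> * e) powr (1 - lam)"
    using eventually_Dom[of lam] assms by (auto elim!: eventually_mono simp: abs_vv_le)
  have "((\<lambda>x. 2178 * x powr (1 - lam)) \<longlongrightarrow> 0) (at_right 0)"
    using assms by (auto intro!: tendsto_mult_right_zero tendsto_zero_powrI[where b = "1 - lam"] tendsto_ident_at
       eventually_at_rightI[of 0 1])
  from filterlim_compose[OF this eps_at_right_0[of lam]] assms
  show "((\<lambda>e. 2178 * (1 - \<bar>lam\<bar> * e) powr (1 - lam)) \<longlongrightarrow> 0) (at_left (1 / \<bar>lam\<bar>))" by simp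
qed

text \<open>The right-hand side is the primitive of \<open>1 / (1089 * \<epsilon>)\<close>, a lower
  bound for the clock speed because \<open>2 - lam \<ge> 1\<close> and
  \<open>\<epsilon> \<le> 1\<close>.\<close>

lemma clock_ge:
  assumes lam: "0 < lam" "lam \<le> 1" and e: "0 \<le> e" "e \<in> Dom lam"
  shows "clock lam e \<ge> - ln (1 - lam * e) / (1089 * lam)"
proof -
  have "clock lam 0 + ln (1 - lam * 0) / (1089 * lam) \<le> clock lam e + ln (1 - lam * e) / (1089 * lam)"
  proof (rule DERIV_nonneg_imp_nondecreasing[OF e(1)])
    fix x assume x: "0 \<le> x" "x \<le> e"
    have xD: "x \<in> Dom lam" by (rule Dom_Icc[OF e(2) x])
    note m = Dom_pos[OF lam(1) x(1) xD]
    define \<epsilon> where "\<epsilon> = 1 - lam * x"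
    have \<epsilon>: "0 < \<epsilon>" "\<epsilon> \<le> 1" using m by (auto simp: \<epsilon>_def)
    have "((\<lambda>e. clock lam e + ln (1 - lam * e) / (1089 * lam)) has_real_derivative
        1 / hh lam x + (1 / \<epsilon>) * (- lam) / (1089 * lam)) (at x)"
    proof -
      have "((\<lambda>e. ln (1 - lam * e)) has_real_derivative (1 / \<epsilon>) * (- lam)) (at x)"
        using \<epsilon> by (auto intro!: derivative_eq_intros simp: \<epsilon>_def)
      from DERIV_add[OF clock_deriv[OF xD] DERIV_cdivide[OF this, of "1089 * lam"]]
      show ?thesis by (simp add: Kb_powr_hh[OF xD])
    qed
    moreover have "1 / hh lam x + (1 / \<epsilon>) * (- lam) / (1089 * lam) \<ge> 0"
    proof -
      have "hh lam x \<le> 1089 * \<epsilon> powr (2 - lam)"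
        using hh_le[OF lam(1) x(1) xD] by (simp add: \<epsilon>_def)
      also have "\<epsilon> powr (2 - lam) \<le> \<epsilon> powr 1" using \<epsilon> lam by (intro powr_mono') auto
      finally have "hh lam x \<le> 1089 * \<epsilon>" using \<epsilon> by simp
      then have "1 / (1089 * \<epsilon>) \<le> 1 / hh lam x" using hh_pos[OF xD] by (intro divide_left_mono) auto
      then show ?thesis using lam \<epsilon> by simp
    qed
    ultimately show "\<exists>y. ((\<lambda>e. clock lam e + ln (1 - lam * e) / (1089 * lam)) has_real_derivative y) (at x) \<and> 0 \<le> y"
      by blast
  qed
  then show ?thesis by (simp add: clock_def)
qed

lemma clock_unbounded:
  assumes "0 < lam" "lam \<le> 1"
  shows "\<exists>e. 0 \<le> e \<and> e \<in> Dom lam \<and> clock lam e \<ge> C"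
proof -
  have "filterlim (\<lambda>x. - ln x / (1089 * lam)) at_top (at_right (0::real))"
    using assms filterlim_at_top_mult_tendsto_pos[OF tendsto_const, of "1 / (1089 * lam)" "\<lambda>x. - ln x" "at_right 0"]
      ln_at_0 by (simp add: filterlim_uminus_at_top)
  from filterlim_compose[OF this eps_at_right_0[of lam]] assms
  have "\<forall>\<^sub>F e in at_left (1 / \<bar>lam\<bar>). - ln (1 - lam * e) / (1089 * lam) \<ge> C"
    by (simp add: filterlim_at_top)
  then have "\<forall>\<^sub>F e in at_left (1 / \<bar>lam\<bar>). 0 \<le> e \<and> e \<in> Dom lam \<and> clock lam e \<ge> C"
    using eventually_Dom[OF less_imp_neq[OF assms(1), THEN not_sym]]
    by eventually_elim (use clock_ge[OF assms] in \<open>auto intro: order_trans\<close>)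
  from eventually_happens'[OF trivial_limit_at_left_real this] show ?thesis .
qed

text \<open>At \<open>lam = 1\<close> the last term of the contiguity relation drops out, leaving
  the closed equation \<open>(1 - e\<^sup>2) * Nb = e * Kb\<close> with \<open>Nb\<close> the
  derivative of \<open>Kb\<close>.\<close>

lemma Kb_sq_1:
  assumes e: "0 \<le> e" "e \<in> Dom 1"
  shows "(Kb 1 e)\<^sup>2 * (1 - e\<^sup>2) = 1"
proof -
  have "(Kb 1 e)\<^sup>2 * (1 - e\<^sup>2) = (Kb 1 0)\<^sup>2 * (1 - 0\<^sup>2)"
  proof (cases "e = 0")
    case False
    have d: "((\<lambda>e. (Kb 1 e)\<^sup>2 * (1 - e\<^sup>2)) has_real_derivative 0) (at x)" if "0 \<le> x" "x \<le> e" for x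
    proof -
      have xD: "x \<in> Dom 1" by (rule Dom_Icc[OF e(2) that])
      have "((\<lambda>e. (Kb 1 e)\<^sup>2 * (1 - e\<^sup>2)) has_real_derivative
          2 * Kb 1 x * Nb 1 x * (1 - x\<^sup>2) + (Kb 1 x)\<^sup>2 * (- 2 * x)) (at x)"
        using Kb_deriv[OF xD] by (auto intro!: derivative_eq_intros)
      moreover have "2 * Kb 1 x * Nb 1 x * (1 - x\<^sup>2) + (Kb 1 x)\<^sup>2 * (- 2 * x)
          = 2 * Kb 1 x * ((1 - x\<^sup>2) * Nb 1 x - x * Kb 1 x)"
        by (simp add: algebra_simps power2_eq_square)
      moreover have "(1 - x\<^sup>2) * Nb 1 x = x * Kb 1 x" using Nb_contiguity[OF _ xD] by simp
      ultimately show ?thesis by (simp only: diff_self mult_zero_right)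
    qed
    then show ?thesis
      using e False by (intro DERIV_isconst_end[of 0 e]) (auto intro!: continuous_at_imp_continuous_on DERIV_isCont)
  qed simp
  then show ?thesis by simp
qed

lemma vv_1_eq:
  assumes e: "0 \<le> e" "e \<in> Dom 1"
  shows "vv 1 a e = (1 - e\<^sup>2) * (cs a / (1 - e * cs a)) - e"
proof -
  have e1: "e < 1" using Dom_pos[OF _ e] by simp
  then have p: "1 - e\<^sup>2 > 0" using e by (simp add: power_less_one_iff)
  note K = Kb_pos[OF e(2)]
  have "hh 1 e = 1 / (Kb 1 e)\<^sup>2" using K by (simp add: hh_def powr_minus powr_numeral divide_inverse)
  also have "\<dots> = 1 - e\<^sup>2" using Kb_sq_1[OF e] K by (simp add: field_simps)
  finally have h: "hh 1 e = 1 - e\<^sup>2" .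
  have "(1 - e\<^sup>2) * PP 1 e = e" using Nb_contiguity[OF _ e(2)] K by (simp add: PP_def)
  then show ?thesis by (simp add: vv_def h rr_def Jac_def right_diff_distrib)
qed

text \<open>At a label with \<open>cs a = 1\<close> the closed form equals 1 for all
  \<open>e < 1\<close>; at every other label the factor \<open>1 - e\<^sup>2\<close> kills the first
  term and \<open>- e\<close> remains.\<close>

lemma vv_1_tendsto:
  shows "((\<lambda>e. vv 1 a e) \<longlongrightarrow> (if cs a = 1 then 1 else -1)) (at_left 1)"
proof -
  have eq: "\<forall>\<^sub>F e in at_left 1. (if cs a = 1 then 1 else (1 - e\<^sup>2) * (cs a / (1 - e * cs a)) - e) = vv 1 a e"
    using eventually_Dom[of 1, simplified]
  proof eventually_elim
    case (elim e)
    then have "e < 1" using Dom_pos[of 1 e] by simp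
    then have "(1 - e\<^sup>2) * (1 / (1 - e)) - e = 1"
      by (simp add: power2_eq_square field_simps)
    then show ?case using vv_1_eq[of e a] elim by simp
  qed
  have "((\<lambda>e. if cs a = 1 then 1 else (1 - e\<^sup>2) * (cs a / (1 - e * cs a)) - e)
    \<longlongrightarrow> (if cs a = 1 then 1 else (1 - 1\<^sup>2) * (cs a / (1 - 1 * cs a)) - 1)) (at_left 1)"
    by (auto intro!: tendsto_eq_intros)
  then show ?thesis
    by (rule Lim_transform_eventually[OF _ eq, THEN tendsto_eq_rhs]) auto
qed

subsection \<open>Blow-up for \<open>\<lambda> > 1\<close>\<close>

lemma Kb_le:
  assumes lam: "lam > 1"
  obtains C where "C > 0" "\<And>e. 0 \<le> e \<Longrightarrow> e \<in> Dom lam \<Longrightarrow>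
    Kb lam e \<le> C * (1 - lam * e) powr (- (1 / (lam * (lam + 1))))"
proof
  \<comment> \<open>\<open>LI_le\<close> needs \<open>b < 1\<close> and
    \<open>b \<le> 2 / lam\<close>, and a finite total time needs \<open>b > 1 / lam\<close>. This
    value satisfies all three for every \<open>lam > 1\<close>, without a case split at
    \<open>lam = 2\<close>, where \<open>Kb\<close> is logarithmic.\<close>
  define b where "b = 2 / (lam + 1)"
  have b: "0 \<le> b" "b < 1" "b \<le> 2 * (1 / lam)" using lam by (auto simp: b_def field_simps)
  define C where "C = 4 powr (1 / lam) * (4 / (1 - b))"
  show "C > 0" using b by (simp add: C_def)
  fix e assume e: "0 \<le> e" "e \<in> Dom lam"
  have m: "0 \<le> lam * e" "lam * e < 1" using Dom_pos[OF _ e] lam by auto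
  have "b - 2 * (1 / lam) = 2 * (- (1 / (lam * (lam + 1))))"
    using lam by (simp add: b_def divide_simps)
  then have "sqrt (1 - lam * e) powr (b - 2 * (1 / lam)) = (1 - lam * e) powr (- (1 / (lam * (lam + 1))))"
    using m by (simp add: powr_half_sqrt[symmetric] powr_powr)
  then show "Kb lam e \<le> C * (1 - lam * e) powr (- (1 / (lam * (lam + 1))))"
    using LI_le[OF m b] Kb_Nb_pos(1)[of lam e] lam by (simp add: C_def mult_ac)
qed

lemma hh_ge:
  assumes lam: "lam > 1"
  obtains c where "c > 0" "\<And>e. 0 \<le> e \<Longrightarrow> e \<in> Dom lam \<Longrightarrow> hh lam e \<ge> c * (1 - lam * e) powr (2 / (lam + 1))"
proof -
  obtain C where C: "C > 0" "\<And>e. 0 \<le> e \<Longrightarrow> e \<in> Dom lam \<Longrightarrow>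
      Kb lam e \<le> C * (1 - lam * e) powr (- (1 / (lam * (lam + 1))))"
    using Kb_le[OF lam] by blast
  show thesis
  proof (rule that[of "C powr (- 2 * lam)"])
    fix e assume e: "0 \<le> e" "e \<in> Dom lam"
    have m: "0 \<le> lam * e" "lam * e < 1" using Dom_pos[OF _ e] lam by auto
    have "(C * (1 - lam * e) powr (- (1 / (lam * (lam + 1))))) powr (- 2 * lam) \<le> hh lam e"
      unfolding hh_def using C(2)[OF e] Kb_pos[OF e(2)] lam by (intro powr_mono2') auto
    then show "C powr (- 2 * lam) * (1 - lam * e) powr (2 / (lam + 1)) \<le> hh lam e"
      using C(1) m lam by (simp add: powr_mult powr_powr)
  qed (use C in auto)
qed

text \<open>The speed is at most a multiple of \<open>\<epsilon> powr (- 2 / (lam + 1))\<close>, an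
  integrable singularity; adding its explicit primitive
  \<open>\<epsilon> powr q / (c * lam * q)\<close> yields a decreasing function.\<close>

lemma clock_bounded_gt_1:
  assumes lam: "lam > 1"
  shows "\<exists>C. \<forall>e. 0 \<le> e \<and> e \<in> Dom lam \<longrightarrow> clock lam e \<le> C"
proof -
  obtain c where c: "c > 0" "\<And>e. 0 \<le> e \<Longrightarrow> e \<in> Dom lam \<Longrightarrow> hh lam e \<ge> c * (1 - lam * e) powr (2 / (lam + 1))"
    using hh_ge[OF lam] by blast
  define q where "q = 1 - 2 / (lam + 1)"
  have q: "q > 0" using lam by (simp add: q_def)
  define F where "F e = clock lam e + (1 - lam * e) powr q / (c * lam * q)" for e
  have "clock lam e \<le> 1 / (c * lam * q)" if e: "0 \<le> e" "e \<in> Dom lam" for e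
  proof -
    have "F 0 \<ge> F e"
    proof (rule DERIV_nonpos_imp_nonincreasing[OF e(1)])
      fix x assume x: "0 \<le> x" "x \<le> e"
      have xD: "x \<in> Dom lam" by (rule Dom_Icc[OF e(2) x])
      have m: "0 \<le> lam * x" "lam * x < 1" using Dom_pos[OF _ x(1) xD] lam by auto
      have J: "1 - lam * x > 0" using m by simp
      have "((\<lambda>e. 1 - lam * e) has_real_derivative - lam) (at x)" by (auto intro!: derivative_eq_intros)
      from DERIV_add[OF clock_deriv[OF xD] DERIV_cdivide[OF DERIV_fun_powr[OF this J, of q], of "c * lam * q"]]
      have "(F has_real_derivative 1 / hh lam x - (1 - lam * x) powr (q - 1) / c) (at x)"
        using lam q c(1) Kb_powr_hh[OF xD] by (simp add: F_def[abs_def])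
      moreover have "1 / hh lam x \<le> 1 / (c * (1 - lam * x) powr (2 / (lam + 1)))"
        using c(1) c(2)[OF x(1) xD] J by (intro divide_left_mono) (auto simp: hh_pos[OF xD])
      moreover have "1 / (c * (1 - lam * x) powr (2 / (lam + 1))) = (1 - lam * x) powr (q - 1) / c"
        by (simp add: q_def powr_minus field_simps)
      ultimately show "\<exists>y. (F has_real_derivative y) (at x) \<and> y \<le> 0" by force
    qed
    moreover have "F 0 = 1 / (c * lam * q)" by (simp add: F_def clock_def)
    moreover have "(1 - lam * e) powr q / (c * lam * q) \<ge> 0" using c lam q by simp
    ultimately show ?thesis by (simp add: F_def)
  qed
  then show ?thesis by blast
qed

text \<open>At the maximum \<open>rr = 1 / (1 - \<mu>)\<close> and \<open>PP\<close> may be of the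
  same order. For \<open>lam > 1\<close> the contiguity relation caps \<open>PP\<close> by
  \<open>\<mu> / (1 - \<mu>\<^sup>2)\<close>, and the gap \<open>1 / (1 - \<mu>\<^sup>2)\<close>
  survives.\<close>

lemma vv_0_ge:
  assumes lam: "lam > 1" and e: "0 \<le> e" "e \<in> Dom lam"
  shows "vv lam 0 e \<ge> hh lam e / (2 * (1 - lam * e))"
proof -
  define \<mu> where "\<mu> = lam * e"
  have m: "0 \<le> \<mu>" "\<mu> < 1" using Dom_pos[OF _ e] lam by (auto simp: \<mu>_def)
  have p: "1 - \<mu>\<^sup>2 > 0" "1 - \<mu>\<^sup>2 \<le> 2 * (1 - \<mu>)"
    using m by (auto simp: power_less_one_iff) (sos)
  have "(1 - \<mu>\<^sup>2) * Nb lam e \<le> \<mu> * Kb lam e"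
    using Nb_contiguity[OF _ e(2)] cs_KK_integral_nonneg[OF e] lam by (simp add: \<mu>_def)
  then have "(1 - \<mu>\<^sup>2) * PP lam e \<le> \<mu>"
    using Kb_pos[OF e(2)] by (simp add: PP_def field_simps)
  then have "PP lam e \<le> \<mu> / (1 - \<mu>\<^sup>2)" using p by (simp add: field_simps)
  moreover have "rr lam e 0 = 1 / (1 - \<mu>)" by (simp add: rr_def Jac_def cs_def \<mu>_def)
  moreover have "1 / (1 - \<mu>) - \<mu> / (1 - \<mu>\<^sup>2) = 1 / (1 - \<mu>\<^sup>2)"
  proof -
    have "1 / (1 - \<mu>) = (1 + \<mu>) / (1 - \<mu>\<^sup>2)" using m p by (simp add: divide_simps power2_eq_square) (simp add: algebra_simps)
    then show ?thesis by (simp add: add_divide_distrib)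
  qed
  moreover have "1 / (2 * (1 - \<mu>)) \<le> 1 / (1 - \<mu>\<^sup>2)" using p by (intro divide_left_mono) auto
  ultimately have "1 / (2 * (1 - \<mu>)) \<le> rr lam e 0 - PP lam e" by linarith
  then have "hh lam e * (1 / (2 * (1 - \<mu>))) \<le> vv lam 0 e"
    unfolding vv_def using hh_pos[OF e(2)] by (intro mult_left_mono) auto
  then show ?thesis by (simp add: \<mu>_def)
qed

lemma vv_0_at_top:
  assumes lam: "lam > 1"
  shows "filterlim (\<lambda>e. vv lam 0 e) at_top (at_left (1 / \<bar>lam\<bar>))"
proof -
  obtain c where c: "c > 0" "\<And>e. 0 \<le> e \<Longrightarrow> e \<in> Dom lam \<Longrightarrow> hh lam e \<ge> c * (1 - lam * e) powr (2 / (lam + 1))"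
    using hh_ge[OF lam] by blast
  have neg: "2 / (lam + 1) - 1 < 0" using lam by (simp add: field_simps)
  have "filterlim (\<lambda>x. c / 2 * x powr (2 / (lam + 1) - 1)) at_top (at_right 0)"
    by (rule filterlim_tendsto_pos_mult_at_top[OF tendsto_const _ powr_neg_at_top[OF neg]]) (use c in auto)
  from filterlim_compose[OF this eps_at_right_0[of lam]] lam
  have "filterlim (\<lambda>e. c / 2 * (1 - lam * e) powr (2 / (lam + 1) - 1)) at_top (at_left (1 / \<bar>lam\<bar>))" by simp
  moreover have "\<forall>\<^sub>F e in at_left (1 / \<bar>lam\<bar>). c / 2 * (1 - lam * e) powr (2 / (lam + 1) - 1) \<le> vv lam 0 e"
    using eventually_Dom[OF less_imp_neq[OF less_trans[OF zero_less_one lam], THEN not_sym]]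
  proof eventually_elim
    case (elim e)
    then have e: "0 \<le> e" "e \<in> Dom lam" using lam by auto
    have m: "lam * e < 1" using Dom_pos[OF _ e] lam by auto
    have "c / 2 * (1 - lam * e) powr (2 / (lam + 1) - 1) = c * (1 - lam * e) powr (2 / (lam + 1)) / (2 * (1 - lam * e))"
      using m by (simp add: powr_diff)
    also have "\<dots> \<le> hh lam e / (2 * (1 - lam * e))"
      using c(2)[OF e] m by (intro divide_right_mono) auto
    also have "\<dots> \<le> vv lam 0 e" by (rule vv_0_ge[OF lam e])
    finally show ?case .
  qed
  ultimately show ?thesis by (rule filterlim_at_top_mono)
qed

text \<open>Three power bounds are multiplied: \<theta> from \<open>hh\<close>, \<open>s\<close>
  from \<open>1 / Kb\<close> and \<open>1 / 2 - k\<close> from \<open>Nb\<close>. The loss in the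
  estimate of \<open>Kb\<close> is harmless because the total exponent is still negative.\<close>

lemma hh_PP_at_top:
  assumes lam: "lam > 1"
  shows "filterlim (\<lambda>e. hh lam e * PP lam e) at_top (at_left (1 / \<bar>lam\<bar>))"
proof -
  obtain c where c: "c > 0" "\<And>e. 0 \<le> e \<Longrightarrow> e \<in> Dom lam \<Longrightarrow> hh lam e \<ge> c * (1 - lam * e) powr (2 / (lam + 1))"
    using hh_ge[OF lam] by blast
  obtain C where C: "C > 0" "\<And>e. 0 \<le> e \<Longrightarrow> e \<in> Dom lam \<Longrightarrow>
      Kb lam e \<le> C * (1 - lam * e) powr (- (1 / (lam * (lam + 1))))"
    using Kb_le[OF lam] by blast
  define k where "k = 1 / lam + 1"
  define d where "d = 33 powr (- k) / 2"
  define s where "s = 1 / (lam * (lam + 1))"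
  define \<theta> where "\<theta> = 2 / (lam + 1)"
  have neg: "\<theta> + s + (1 / 2 - k) < 0"
  proof -
    have "\<theta> + s + (1 / 2 - k) = 1 / (lam + 1) - 1 / 2"
      using lam by (simp add: \<theta>_def s_def k_def divide_simps) (simp add: algebra_simps)
    moreover have "1 / (lam + 1) < 1 / 2" using lam by (intro divide_strict_left_mono) auto
    ultimately show ?thesis by linarith
  qed
  have pos: "\<theta> \<ge> 0" "s \<ge> 0" "d > 0" "k \<ge> 0" using lam by (auto simp: \<theta>_def s_def d_def k_def)
  have "filterlim (\<lambda>x. c / C * d * x powr (\<theta> + s + (1 / 2 - k))) at_top (at_right 0)"
    by (rule filterlim_tendsto_pos_mult_at_top[OF tendsto_const _ powr_neg_at_top[OF neg]])
      (use c C pos in auto)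
  then have "filterlim (\<lambda>x. - (c / C) + c / C * d * x powr (\<theta> + s + (1 / 2 - k))) at_top (at_right 0)"
    by (rule filterlim_tendsto_add_at_top[OF tendsto_const])
  from filterlim_compose[OF this eps_at_right_0[of lam]] lam
  have "filterlim (\<lambda>e. - (c / C) + c / C * d * (1 - lam * e) powr (\<theta> + s + (1 / 2 - k)))
    at_top (at_left (1 / \<bar>lam\<bar>))" by simp
  moreover have "\<forall>\<^sub>F e in at_left (1 / \<bar>lam\<bar>). - (c / C) + c / C * d * (1 - lam * e) powr (\<theta> + s + (1 / 2 - k))
      \<le> hh lam e * PP lam e"
  proof -
    have "\<forall>\<^sub>F e in at_left (1 / \<bar>lam\<bar>). 1 - \<bar>lam\<bar> * e < 1 / 36"
      using eps_at_right_0[of lam] lam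
      by (intro order_tendstoD(2)[of _ 0]) (auto simp: filterlim_at)
    with eventually_Dom[OF less_imp_neq[OF less_trans[OF zero_less_one lam], THEN not_sym]]
    have "\<forall>\<^sub>F e in at_left (1 / \<bar>lam\<bar>). (0 \<le> e \<and> e \<in> Dom lam) \<and> 1 - lam * e < 1 / 36"
      by eventually_elim (use lam in auto)
    then show ?thesis
    proof eventually_elim
      case (elim e)
      then have e: "0 \<le> e" "e \<in> Dom lam" by auto
      have m: "0 \<le> lam * e" "lam * e < 1" using Dom_pos[OF _ e] lam by auto
      define \<epsilon> where "\<epsilon> = 1 - lam * e"
      have \<epsilon>: "0 < \<epsilon>" "\<epsilon> \<le> 1" using m by (auto simp: \<epsilon>_def)
      \<comment> \<open>The cutoff \<open>1 / 36\<close> is the square of 1/6, the range required by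
        \<open>LC_ge_power\<close>; it also gives \<open>33 * \<epsilon> \<le> 1\<close>, hence
        \<open>Nb \<ge> 0\<close>.\<close>
      have "sqrt (1 - lam * e) \<le> sqrt ((1 / 6)\<^sup>2)" using elim by (intro real_sqrt_le_mono) (simp add: power2_eq_square)
      then have "sqrt (1 - lam * e) \<le> 1 / 6" by simp
      from LC_ge_power[OF m pos(4) this]
      have N: "Nb lam e \<ge> sqrt \<epsilon> * ((33 * \<epsilon>) powr (- k) - 1) / 2"
        using Kb_Nb_pos(2)[OF _ e(2)] lam by (simp add: k_def \<epsilon>_def)
      have "sqrt \<epsilon> * ((33 * \<epsilon>) powr (- k) - 1) / 2 = d * (\<epsilon> powr (1/2) * \<epsilon> powr (- k)) - sqrt \<epsilon> / 2"
        using \<epsilon> by (simp add: d_def powr_mult powr_half_sqrt algebra_simps diff_divide_distrib)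
      also have "\<epsilon> powr (1/2) * \<epsilon> powr (- k) = \<epsilon> powr (1 / 2 - k)" using powr_add[of \<epsilon> "1/2" "- k"] by simp
      finally have N2: "Nb lam e \<ge> d * \<epsilon> powr (1 / 2 - k) - sqrt \<epsilon> / 2" using N by simp
      have "sqrt \<epsilon> \<le> 1" using \<epsilon> by simp
      with N2 have N3: "Nb lam e \<ge> d * \<epsilon> powr (1 / 2 - k) - 1" by linarith
      have N0: "Nb lam e \<ge> 0"
      proof -
        have "33 * \<epsilon> \<le> 1" using elim by (simp add: \<epsilon>_def)
        then have "1 powr (- k) \<le> (33 * \<epsilon>) powr (- k)" using \<epsilon> pos by (intro powr_mono2') auto
        then have "sqrt \<epsilon> * ((33 * \<epsilon>) powr (- k) - 1) / 2 \<ge> 0" using \<epsilon> by simp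
        with N show ?thesis by linarith
      qed
      have h: "hh lam e \<ge> c * \<epsilon> powr \<theta>" using c(2)[OF e] by (simp add: \<theta>_def \<epsilon>_def)
      have K: "Kb lam e \<le> C * \<epsilon> powr (- s)" using C(2)[OF e] by (simp add: s_def \<epsilon>_def)
      have "c / C * \<epsilon> powr (\<theta> + s) * (d * \<epsilon> powr (1 / 2 - k) - 1) \<le> c / C * \<epsilon> powr (\<theta> + s) * Nb lam e"
        using c C N3 by (intro mult_left_mono) auto
      also have "\<dots> = (c * \<epsilon> powr \<theta>) * (Nb lam e / (C * \<epsilon> powr (- s)))"
        by (simp add: powr_add powr_minus field_simps)
      also have "\<dots> \<le> hh lam e * (Nb lam e / Kb lam e)"
        using h K N0 c C \<epsilon> Kb_pos[OF e(2)] hh_pos[OF e(2)]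
        by (intro mult_mono divide_left_mono) auto
      finally have "c / C * \<epsilon> powr (\<theta> + s) * (d * \<epsilon> powr (1 / 2 - k) - 1) \<le> hh lam e * PP lam e"
        by (simp add: PP_def)
      moreover have "c / C * \<epsilon> powr (\<theta> + s) * (d * \<epsilon> powr (1 / 2 - k) - 1)
          = c / C * d * \<epsilon> powr (\<theta> + s + (1 / 2 - k)) - c / C * \<epsilon> powr (\<theta> + s)"
        unfolding powr_add[of \<epsilon> "\<theta> + s"] by (simp add: algebra_simps)
      moreover have "c / C * \<epsilon> powr (\<theta> + s) \<le> c / C * 1"
        using c C \<epsilon> pos by (intro mult_left_mono powr_le1) auto
      ultimately show ?case unfolding \<epsilon>_def by linarith
    qed
  qed
  ultimately show ?thesis by (rule filterlim_at_top_mono)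
qed

text \<open>Away from the maximum \<open>rr\<close> is bounded above and \<open>hh\<close> is
  bounded, so the divergence of \<open>hh * PP\<close> decides.\<close>

lemma vv_at_bot:
  assumes lam: "lam > 1" and a: "cs a \<noteq> 1"
  shows "filterlim (\<lambda>e. vv lam a e) at_bot (at_left (1 / \<bar>lam\<bar>))"
proof -
  have a1: "cs a < 1" using a cs_bound[of a] by (simp add: abs_le_iff)
  define R where "R = (1 / 4) powr (- 2 * lam) * (1 / (1 - cs a))"
  have "filterlim (\<lambda>e. - R + hh lam e * PP lam e) at_top (at_left (1 / \<bar>lam\<bar>))"
    by (rule filterlim_tendsto_add_at_top[OF tendsto_const hh_PP_at_top[OF lam]])
  moreover have "\<forall>\<^sub>F e in at_left (1 / \<bar>lam\<bar>). - R + hh lam e * PP lam e \<le> - vv lam a e"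
    using eventually_Dom[OF less_imp_neq[OF less_trans[OF zero_less_one lam], THEN not_sym]]
  proof eventually_elim
    case (elim e)
    then have e: "0 \<le> e" "e \<in> Dom lam" using lam by auto
    have m: "0 \<le> lam * e" "lam * e < 1" using Dom_pos[OF _ e] lam by auto
    have h: "hh lam e \<le> (1 / 4) powr (- 2 * lam)"
      unfolding hh_def using Kb_ge[OF e] lam by (intro powr_mono2') auto
    have "rr lam e a \<le> 1 / (1 - cs a)"
    proof (cases "cs a \<ge> 0")
      case True
      then have "Jac lam e a \<ge> 1 - cs a" unfolding Jac_def using m mult_right_mono[of "lam * e" 1 "cs a"] by simp
      then show ?thesis unfolding rr_def using a1 True by (intro frac_le) auto
    next
      case False
      then have "rr lam e a \<le> 0" using Jac_pos[OF e(2), of a] by (simp add: rr_def divide_le_0_iff)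
      also have "0 \<le> 1 / (1 - cs a)" using a1 by simp
      finally show ?thesis .
    qed
    then have "hh lam e * rr lam e a \<le> hh lam e * (1 / (1 - cs a))"
      using hh_pos[OF e(2)] by (intro mult_left_mono) auto
    also have "\<dots> \<le> R" unfolding R_def using h a1 by (intro mult_right_mono) auto
    finally show ?case by (simp add: vv_def right_diff_distrib)
  qed
  ultimately have "filterlim (\<lambda>e. - vv lam a e) at_top (at_left (1 / \<bar>lam\<bar>))" by (rule filterlim_at_top_mono)
  then show ?thesis by (simp add: filterlim_uminus_at_bot)
qed

subsection \<open>Blow-up for \<open>\<lambda> < 0\<close>\<close>

text \<open>For negative \<open>lam\<close> the weight is a positive power of \<open>Jac\<close>,
  hence at most \<open>2 powr (- 1 / lam)\<close>. So \<open>hh\<close> lies between positive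
  constants and t is comparable with \<eta>.\<close>

lemma hh_bounds_neg:
  assumes lam: "lam < 0" and e: "0 \<le> e" "e \<in> Dom lam"
  shows "Kb lam e \<le> 2 powr (- 1 / lam)" "hh lam e \<le> 4" "hh lam e \<ge> (1 / 4) powr (- 2 * lam)"
proof -
  have m: "0 \<le> - lam * e" "- lam * e < 1" using lam e by (auto simp: Dom_def abs_mult mult_nonpos_nonneg)
  show K: "Kb lam e \<le> 2 powr (- 1 / lam)"
    using LI_le_neg[OF m, of "1 / lam"] Kb_Nb_neg(1)[OF lam e] lam by simp
  have "hh lam e \<le> (2 powr (- 1 / lam)) powr (- 2 * lam)"
    unfolding hh_def using K Kb_pos[OF e(2)] lam by (intro powr_mono2) auto
  also have "\<dots> = 4" using lam by (simp add: powr_powr)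
  finally show "hh lam e \<le> 4" .
  show "hh lam e \<ge> (1 / 4) powr (- 2 * lam)"
    unfolding hh_def using Kb_ge[OF e] lam by (intro powr_mono2) auto
qed

lemma clock_bounded_neg:
  assumes lam: "lam < 0"
  shows "\<exists>C. \<forall>e. 0 \<le> e \<and> e \<in> Dom lam \<longrightarrow> clock lam e \<le> C"
proof -
  define c where "c = (1 / 4) powr (- 2 * lam)"
  have c: "c > 0" by (simp add: c_def)
  have "clock lam e \<le> 1 / c * (1 / \<bar>lam\<bar>)" if e: "0 \<le> e" "e \<in> Dom lam" for e
  proof -
    have "clock lam 0 - 1 / c * 0 \<ge> clock lam e - 1 / c * e"
    proof (rule DERIV_nonpos_imp_nonincreasing[OF e(1)])
      fix x assume x: "0 \<le> x" "x \<le> e"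
      have xD: "x \<in> Dom lam" by (rule Dom_Icc[OF e(2) x])
      have "((\<lambda>e. clock lam e - 1 / c * e) has_real_derivative 1 / hh lam x - 1 / c) (at x)"
        using clock_deriv[OF xD] Kb_powr_hh[OF xD] c by (auto intro!: derivative_eq_intros)
      moreover have "1 / hh lam x \<le> 1 / c"
        using hh_bounds_neg(3)[OF lam x(1) xD] c by (intro divide_left_mono) (auto simp: c_def hh_pos[OF xD])
      ultimately show "\<exists>y. ((\<lambda>e. clock lam e - 1 / c * e) has_real_derivative y) (at x) \<and> y \<le> 0" by force
    qed
    then have "clock lam e \<le> 1 / c * e" by (simp add: clock_def)
    also have "\<dots> \<le> 1 / c * (1 / \<bar>lam\<bar>)"
      using Dom_iff[of lam e] e lam c by (intro mult_left_mono) auto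
    finally show ?thesis .
  qed
  then show ?thesis by blast
qed

text \<open>Mirror image of \<open>vv_0_ge\<close> at the minimum: \<open>lam - 1 < 0\<close> gives
  the term dropped from the contiguity relation the favourable sign for every negative
  \<open>lam\<close>.\<close>

lemma vv_half_le:
  assumes lam: "lam < 0" and e: "0 \<le> e" "e \<in> Dom lam"
  shows "vv lam (1 / 2) e \<le> - hh lam e / (2 * (1 - \<bar>lam\<bar> * e))"
proof -
  define \<mu> where "\<mu> = - lam * e"
  have m: "0 \<le> \<mu>" "\<mu> < 1" using lam e by (auto simp: \<mu>_def Dom_def abs_mult mult_nonpos_nonneg)
  have p: "1 - \<mu>\<^sup>2 > 0" "1 - \<mu>\<^sup>2 \<le> 2 * (1 - \<mu>)"
    using m by (auto simp: power_less_one_iff) (sos)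
  have "(1 - \<mu>\<^sup>2) * Nb lam e = - \<mu> * Kb lam e - (lam - 1) * integral {0..1} (\<lambda>a. cs a * KK lam e a)"
    using Nb_contiguity[OF _ e(2)] lam by (simp add: \<mu>_def)
  moreover have "(lam - 1) * integral {0..1} (\<lambda>a. cs a * KK lam e a) \<le> 0"
    using cs_KK_integral_nonneg[OF e] lam by (intro mult_nonpos_nonneg) auto
  ultimately have "(1 - \<mu>\<^sup>2) * Nb lam e \<ge> - \<mu> * Kb lam e" by linarith
  then have "(1 - \<mu>\<^sup>2) * PP lam e \<ge> - \<mu>"
    using Kb_pos[OF e(2)] by (simp add: PP_def field_simps)
  then have "PP lam e \<ge> - \<mu> / (1 - \<mu>\<^sup>2)" using p by (simp add: field_simps)
  moreover have "rr lam e (1 / 2) = - (1 / (1 - \<mu>))" by (simp add: rr_def Jac_def cs_def \<mu>_def)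
  moreover have "1 / (1 - \<mu>) - \<mu> / (1 - \<mu>\<^sup>2) = 1 / (1 - \<mu>\<^sup>2)"
  proof -
    have "1 / (1 - \<mu>) = (1 + \<mu>) / (1 - \<mu>\<^sup>2)" using m p by (simp add: divide_simps power2_eq_square) (simp add: algebra_simps)
    then show ?thesis by (simp add: add_divide_distrib)
  qed
  moreover have "1 / (2 * (1 - \<mu>)) \<le> 1 / (1 - \<mu>\<^sup>2)" using p by (intro divide_left_mono) auto
  ultimately have "rr lam e (1 / 2) - PP lam e \<le> - (1 / (2 * (1 - \<mu>)))" by simp
  then have "vv lam (1 / 2) e \<le> hh lam e * - (1 / (2 * (1 - \<mu>)))"
    unfolding vv_def using hh_pos[OF e(2)] by (intro mult_left_mono) auto
  then show ?thesis using lam by (simp add: \<mu>_def)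
qed

lemma vv_half_at_bot:
  assumes lam: "lam < 0"
  shows "filterlim (\<lambda>e. vv lam (1 / 2) e) at_bot (at_left (1 / \<bar>lam\<bar>))"
proof -
  define c where "c = (1 / 4) powr (- 2 * lam)"
  have c: "c > 0" by (simp add: c_def)
  have "filterlim (\<lambda>x. c / 2 * x powr (- 1)) at_top (at_right 0)"
    by (rule filterlim_tendsto_pos_mult_at_top[OF tendsto_const _ powr_neg_at_top]) (use c in auto)
  from filterlim_compose[OF this eps_at_right_0[of lam]] lam
  have "filterlim (\<lambda>e. c / 2 * (1 - \<bar>lam\<bar> * e) powr (- 1)) at_top (at_left (1 / \<bar>lam\<bar>))" by simp
  moreover have "\<forall>\<^sub>F e in at_left (1 / \<bar>lam\<bar>). c / 2 * (1 - \<bar>lam\<bar> * e) powr (- 1) \<le> - vv lam (1 / 2) e"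
    using eventually_Dom[OF less_imp_neq[OF lam]]
  proof eventually_elim
    case (elim e)
    then have e: "0 \<le> e" "e \<in> Dom lam" by auto
    have m: "1 - \<bar>lam\<bar> * e > 0" using e by (simp add: Dom_def abs_mult)
    have "c / 2 * (1 - \<bar>lam\<bar> * e) powr (- 1) = c / (2 * (1 - \<bar>lam\<bar> * e))"
      using m by (simp add: powr_minus field_simps)
    also have "\<dots> \<le> hh lam e / (2 * (1 - \<bar>lam\<bar> * e))"
      using hh_bounds_neg(3)[OF lam e] m by (intro divide_right_mono) (auto simp: c_def)
    finally show ?case using vv_half_le[OF lam e] by simp
  qed
  ultimately have "filterlim (\<lambda>e. - vv lam (1 / 2) e) at_top (at_left (1 / \<bar>lam\<bar>))"
    by (rule filterlim_at_top_mono)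
  then show ?thesis by (simp add: filterlim_uminus_at_bot)
qed

lemma abs_rr_le_neg:
  assumes lam: "lam < 0" and e: "0 \<le> e" "e \<in> Dom lam" and a: "cs a > -1"
  shows "\<bar>rr lam e a\<bar> \<le> 1 / (1 + cs a) + 1"
proof -
  have m: "0 \<le> - lam * e" "- lam * e < 1" using lam e by (auto simp: Dom_def abs_mult mult_nonpos_nonneg)
  have c1: "1 / (1 + cs a) > 0" using a by simp
  show ?thesis
  proof (cases "cs a \<ge> 0")
    case True
    then have "Jac lam e a \<ge> 1" using m mult_nonneg_nonneg[OF m(1) True] by (simp add: Jac_def)
    then have "\<bar>rr lam e a\<bar> \<le> 1 / 1" unfolding rr_def abs_divide using cs_bound[of a] by (intro frac_le) auto
    then show ?thesis using c1 by linarith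
  next
    case False
    then have "Jac lam e a \<ge> 1 + cs a" unfolding Jac_def using m mult_right_mono_neg[of "- lam * e" 1 "cs a"] by simp
    then have "\<bar>rr lam e a\<bar> \<le> 1 / (1 + cs a)"
      unfolding rr_def abs_divide using cs_bound[of a] a by (intro frac_le) auto
    then show ?thesis by simp
  qed
qed

text \<open>\<open>lam \<le> -2\<close> means \<open>1 / lam + 1 \<ge> 1 / 2\<close>, so
  \<open>- Nb\<close> diverges at least logarithmically, while \<open>Kb\<close> and, away from the
  minimum, \<open>rr\<close> stay bounded.\<close>

lemma vv_at_top_neg:
  assumes lam: "lam \<le> -2" and a: "cs a > -1"
  shows "filterlim (\<lambda>e. vv lam a e) at_top (at_left (1 / \<bar>lam\<bar>))"
proof -
  define c where "c = (1 / 4) powr (- 2 * lam)"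
  have c: "c > 0" by (simp add: c_def)
  define R where "R = 1 / (1 + cs a) + 1"
  define K where "K = 2 powr (- 1 / lam)"
  have K: "K > 0" by (simp add: K_def)
  have "filterlim (\<lambda>x. - ln (sqrt x)) at_top (at_right (0::real))"
  proof -
    have "filterlim (\<lambda>x. 1 / 2 * - ln x) at_top (at_right (0::real))"
      by (rule filterlim_tendsto_pos_mult_at_top[OF tendsto_const])
        (use ln_at_0 in \<open>auto simp: filterlim_uminus_at_top\<close>)
    moreover have "\<forall>\<^sub>F x in at_right (0::real). 1 / 2 * - ln x \<le> - ln (sqrt x)"
      unfolding eventually_at_filter by (rule always_eventually) (simp add: ln_sqrt)
    ultimately show ?thesis by (rule filterlim_at_top_mono)
  qed
  from filterlim_compose[OF this eps_at_right_0[of lam]] lam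
  have "filterlim (\<lambda>e. - ln (sqrt (1 - \<bar>lam\<bar> * e))) at_top (at_left (1 / \<bar>lam\<bar>))" by simp
  from filterlim_tendsto_add_at_top[OF tendsto_const this, of "-1"]
  have 1: "filterlim (\<lambda>e. - 1 + - ln (sqrt (1 - \<bar>lam\<bar> * e))) at_top (at_left (1 / \<bar>lam\<bar>))" .
  have "filterlim (\<lambda>e. 1 / (12 * K) * (- 1 + - ln (sqrt (1 - \<bar>lam\<bar> * e)))) at_top (at_left (1 / \<bar>lam\<bar>))"
    by (rule filterlim_tendsto_pos_mult_at_top[OF tendsto_const _ 1]) (use K in auto)
  then have P: "filterlim (\<lambda>e. - R + 1 / (12 * K) * (- 1 + - ln (sqrt (1 - \<bar>lam\<bar> * e)))) at_top (at_left (1 / \<bar>lam\<bar>))"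
    by (rule filterlim_tendsto_add_at_top[OF tendsto_const])
  then have "filterlim (\<lambda>e. c * (- R + 1 / (12 * K) * (- 1 + - ln (sqrt (1 - \<bar>lam\<bar> * e))))) at_top (at_left (1 / \<bar>lam\<bar>))"
    by (rule filterlim_tendsto_pos_mult_at_top[OF tendsto_const c])
  moreover have "\<forall>\<^sub>F e in at_left (1 / \<bar>lam\<bar>).
      c * (- R + 1 / (12 * K) * (- 1 + - ln (sqrt (1 - \<bar>lam\<bar> * e)))) \<le> vv lam a e"
  proof -
    have "\<forall>\<^sub>F e in at_left (1 / \<bar>lam\<bar>). - R + 1 / (12 * K) * (- 1 + - ln (sqrt (1 - \<bar>lam\<bar> * e))) \<ge> 0"
      using P unfolding filterlim_at_top by blast
    moreover have "\<forall>\<^sub>F e in at_left (1 / \<bar>lam\<bar>). - 1 + - ln (sqrt (1 - \<bar>lam\<bar> * e)) \<ge> 0"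
      using 1 unfolding filterlim_at_top by blast
    moreover have "\<forall>\<^sub>F e in at_left (1 / \<bar>lam\<bar>). 0 \<le> e \<and> e \<in> Dom lam"
      using lam by (intro eventually_Dom) auto
    ultimately show ?thesis
    proof eventually_elim
      case (elim e)
      have lam0: "lam < 0" using lam by simp
      from elim have e: "0 \<le> e" "e \<in> Dom lam" by auto
      have m: "0 \<le> - lam * e" "- lam * e < 1" using lam0 e by (auto simp: Dom_def abs_mult mult_nonpos_nonneg)
      define l where "l = - 1 + - ln (sqrt (1 - \<bar>lam\<bar> * e))"
      have k: "1 / lam + 1 \<ge> 1 / 2" using lam by (simp add: field_simps)
      have "Nb lam e \<le> - (l / 12)"
        using LC_ge_log[OF m k] Kb_Nb_neg(2)[OF lam0 e] lam0 by (simp add: l_def)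
      then have "- Nb lam e \<ge> l / 12" by simp
      then have "- Nb lam e / Kb lam e \<ge> l / 12 / Kb lam e"
        using Kb_pos[OF e(2)] by (intro divide_right_mono) auto
      moreover have "l / 12 / K \<le> l / 12 / Kb lam e"
        using elim hh_bounds_neg(1)[OF lam0 e] Kb_pos[OF e(2)] K
        by (intro divide_left_mono) (auto simp: K_def l_def)
      ultimately have "- PP lam e \<ge> 1 / (12 * K) * l" by (simp add: PP_def)
      moreover have "rr lam e a \<ge> - R" using abs_rr_le_neg[OF lam0 e a] by (simp add: R_def)
      ultimately have "- R + 1 / (12 * K) * l \<le> rr lam e a - PP lam e" by linarith
      then have "c * (- R + 1 / (12 * K) * l) \<le> hh lam e * (rr lam e a - PP lam e)"
        using elim hh_bounds_neg(3)[OF lam0 e] hh_pos[OF e(2)] c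
        by (intro mult_mono) (auto simp: c_def l_def)
      then show ?case by (simp add: vv_def l_def)
    qed
  qed
  ultimately show ?thesis by (rule filterlim_at_top_mono)
qed

text \<open>\<open>lam > -2\<close> means \<open>k < 1 / 2\<close>, the range in which
  \<open>LI k\<close> is bounded uniformly in \<open>m\<close>; this bounds \<open>Nb\<close> and
  therefore \<open>PP\<close>.\<close>

lemma vv_bounded_neg:
  assumes lam: "-2 < lam" "lam < 0" and a: "cs a > -1"
  shows "\<exists>C. \<forall>e. 0 \<le> e \<and> e \<in> Dom lam \<longrightarrow> \<bar>vv lam a e\<bar> \<le> C"
proof -
  define k where "k = 1 / lam + 1"
  have k: "k < 1 / 2" using lam by (simp add: k_def field_simps)
  obtain C where C: "\<And>m. 0 \<le> m \<Longrightarrow> m < 1 \<Longrightarrow> LI k m \<le> C"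
  proof (cases "k \<le> 0")
    case True
    then show ?thesis using LI_le_neg[OF _ _ True] that by blast
  next
    case False
    \<comment> \<open>Taking \<open>b = 2 * k < 1\<close> leaves no power of \<open>1 - m\<close> in
      the estimate.\<close>
    then show ?thesis using LI_le[of _ "2 * k" k] k that[of "4 powr k * (4 / (1 - 2 * k))"] by simp
  qed
  define R where "R = 1 / (1 + cs a) + 1"
  have "\<bar>vv lam a e\<bar> \<le> 4 * (R + 4 * C)" if e: "0 \<le> e" "e \<in> Dom lam" for e
  proof -
    have m: "0 \<le> - lam * e" "- lam * e < 1" using lam e by (auto simp: Dom_def abs_mult mult_nonpos_nonneg)
    have "norm (LC k (- lam * e)) \<le> LI k (- lam * e)"
      unfolding LC_def LI_def
    proof (rule integral_norm_bound_integral)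
      show "norm (cs x * J1 (- lam * e) x powr (- k)) \<le> J1 (- lam * e) x powr (- k)" for x
        using mult_right_mono[OF cs_bound[of x], of "J1 (- lam * e) x powr (- k)"] by (simp add: abs_mult)
    qed (use J1_powr_integrable[OF m] in auto)
    then have N: "\<bar>Nb lam e\<bar> \<le> C"
      using C[OF m] Kb_Nb_neg(2)[OF lam(2) e] by (simp add: k_def)
    have "\<bar>PP lam e\<bar> \<le> C / (1 / 4)"
      unfolding PP_def abs_divide using N Kb_ge[OF e] by (intro frac_le) auto
    then have "\<bar>rr lam e a - PP lam e\<bar> \<le> R + 4 * C"
      using abs_rr_le_neg[OF lam(2) e a] by (simp add: R_def)
    then show ?thesis
      unfolding vv_def abs_mult using hh_bounds_neg(2)[OF lam(2) e] hh_pos[OF e(2)]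
      by (intro mult_mono) auto
  qed
  then show ?thesis by blast
qed

subsection \<open>Solutions with sine initial data\<close>

lemma solution_on:
  assumes J: "J \<subseteq> clock lam ` Dom lam" "convex J" "0 \<in> J"
  obtains u \<eta> where "is_solution lam sine_data J u" "\<exists>\<gamma>. is_flow u J \<gamma>"
    "\<And>\<gamma> a t. is_flow u J \<gamma> \<Longrightarrow> a \<in> {0..1} \<Longrightarrow> t \<in> J \<Longrightarrow> ux u (\<gamma> a t) t = vv lam a (\<eta> t)"
    "\<And>t. t \<in> J \<Longrightarrow> \<eta> t \<in> Dom lam \<and> clock lam (\<eta> t) = t"
proof -
  obtain \<eta> where L: "lagrangian_solution lam sine_data (clock lam ` Dom lam)
       (\<lambda>a t. KK lam (\<eta> t) a / Kb lam (\<eta> t)) (\<lambda>a t. vv lam a (\<eta> t)) (\<lambda>a t. hh lam (\<eta> t) * rra lam (\<eta> t) a)"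
    and \<eta>: "\<And>t. t \<in> clock lam ` Dom lam \<Longrightarrow> \<eta> t \<in> Dom lam \<and> clock lam (\<eta> t) = t"
    by (rule lagrangian_solution_sine[of lam]) (rule that)
  interpret L: lagrangian_solution lam sine_data "clock lam ` Dom lam"
    "\<lambda>a t. KK lam (\<eta> t) a / Kb lam (\<eta> t)" "\<lambda>a t. vv lam a (\<eta> t)" "\<lambda>a t. hh lam (\<eta> t) * rra lam (\<eta> t) a"
    by (rule L)
  show thesis
  proof (rule that[of L.sol \<eta>])
    show "is_solution lam sine_data J L.sol" by (rule L.sol_is_solution[OF J(1)])
    show "\<exists>\<gamma>. is_flow L.sol J \<gamma>" using L.Gam_is_flow[OF J(1)] by blast
    show "ux L.sol (\<gamma> a t) t = vv lam a (\<eta> t)" if "is_flow L.sol J \<gamma>" "a \<in> {0..1}" "t \<in> J" for \<gamma> a t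
      by (rule L.ux_along_flow[OF J that])
    show "\<eta> t \<in> Dom lam \<and> clock lam (\<eta> t) = t" if "t \<in> J" for t
      using \<eta> that J(1) by blast
  qed
qed

lemma clock_0 [simp]: "clock lam 0 = 0"
  by (simp add: clock_def)

lemma clock_strict_mono: "e \<in> Dom lam \<Longrightarrow> e' \<in> Dom lam \<Longrightarrow> e < e' \<Longrightarrow> clock lam e < clock lam e'"
  by (rule lagrangian_solution_sine[of lam])

lemma clock_surj:
  assumes "0 \<le> t" "t \<le> clock lam e" "0 \<le> e" "e \<in> Dom lam"
  shows "t \<in> clock lam ` Dom lam"
proof -
  have "continuous_on {0..e} (clock lam)"
    by (rule continuous_at_imp_continuous_on)
      (use Dom_Icc[OF assms(4)] in \<open>auto intro!: DERIV_isCont[OF clock_deriv]\<close>)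
  then have "\<exists>x\<ge>0. x \<le> e \<and> clock lam x = t" using assms by (intro IVT') auto
  then show ?thesis using Dom_Icc[OF assms(4)] by blast
qed

lemma clock_inverse_nonneg:
  assumes "\<eta> \<in> Dom lam" "clock lam \<eta> \<ge> 0"
  shows "\<eta> \<ge> 0"
  using clock_strict_mono[OF assms(1) zero_Dom] assms(2) by force

text \<open>The filter \<open>F\<close> is kept general: it is \<open>at_top\<close> for global
  solutions and \<open>at_left T\<close> for blow-up. In both cases t eventually passes every clock
  value, which pushes \<open>\<eta>\<close> to the end of \<open>Dom\<close>.\<close>

lemma clock_inverse_at_left:
  assumes lam: "lam \<noteq> 0"
    and \<eta>: "\<forall>\<^sub>F t in F. 0 \<le> t \<and> \<eta> t \<in> Dom lam \<and> clock lam (\<eta> t) = t"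
    and F: "\<And>e. 0 \<le> e \<Longrightarrow> e \<in> Dom lam \<Longrightarrow> \<forall>\<^sub>F t in F. clock lam e < t"
  shows "filterlim \<eta> (at_left (1 / \<bar>lam\<bar>)) F"
  unfolding filterlim_at
proof
  have up: "\<forall>\<^sub>F t in F. 0 \<le> \<eta> t \<and> \<eta> t < 1 / \<bar>lam\<bar>"
    using \<eta>
  proof eventually_elim
    case (elim t)
    then have "0 \<le> \<eta> t" using clock_inverse_nonneg[of "\<eta> t" lam] by simp
    then show ?case using elim Dom_iff[OF lam, of "\<eta> t"] by simp
  qed
  then show "\<forall>\<^sub>F t in F. \<eta> t \<in> {..<1 / \<bar>lam\<bar>} \<and> \<eta> t \<noteq> 1 / \<bar>lam\<bar>"
    by eventually_elim auto
  show "(\<eta> \<longlongrightarrow> 1 / \<bar>lam\<bar>) F"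
  proof (rule order_tendstoI)
    fix l assume l: "l < 1 / \<bar>lam\<bar>"
    define e where "e = max l 0"
    have e: "0 \<le> e" "e \<in> Dom lam" using l lam Dom_iff[of lam e] by (auto simp: e_def)
    from F[OF e] \<eta> show "\<forall>\<^sub>F t in F. l < \<eta> t"
    proof eventually_elim
      case (elim t)
      have "\<not> \<eta> t \<le> e"
      proof
        assume "\<eta> t \<le> e"
        then have "clock lam (\<eta> t) \<le> clock lam e"
          using clock_strict_mono[of "\<eta> t" lam e] elim e by (cases "\<eta> t = e") auto
        then show False using elim by simp
      qed
      then show ?case by (simp add: e_def)
    qed
  next
    fix r assume "1 / \<bar>lam\<bar> < r"
    with up show "\<forall>\<^sub>F t in F. \<eta> t < r" by (auto elim!: eventually_mono)
  qed
qed

lemma global_solution: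
  assumes unb: "\<And>C. \<exists>e. 0 \<le> e \<and> e \<in> Dom lam \<and> clock lam e \<ge> C"
  obtains u \<eta> where "is_solution lam sine_data {0..} u" "\<exists>\<gamma>. is_flow u {0..} \<gamma>"
    "\<And>\<gamma> a t. is_flow u {0..} \<gamma> \<Longrightarrow> a \<in> {0..1} \<Longrightarrow> t \<ge> 0 \<Longrightarrow> ux u (\<gamma> a t) t = vv lam a (\<eta> t)"
    "lam \<noteq> 0 \<Longrightarrow> filterlim \<eta> (at_left (1 / \<bar>lam\<bar>)) at_top"
proof -
  have sub: "{0..} \<subseteq> clock lam ` Dom lam"
    proof
    fix t :: real assume "t \<in> {0..}"
    moreover obtain e where "0 \<le> e" "e \<in> Dom lam" "t \<le> clock lam e" using unb by blast
    ultimately show "t \<in> clock lam ` Dom lam" by (intro clock_surj[of t lam e]) auto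
  qed
  obtain u \<eta> where u: "is_solution lam sine_data {0..} u" "\<exists>\<gamma>. is_flow u {0..} \<gamma>"
    "\<And>\<gamma> a t. is_flow u {0..} \<gamma> \<Longrightarrow> a \<in> {0..1} \<Longrightarrow> t \<in> {0..} \<Longrightarrow> ux u (\<gamma> a t) t = vv lam a (\<eta> t)"
    "\<And>t. t \<in> {0..} \<Longrightarrow> \<eta> t \<in> Dom lam \<and> clock lam (\<eta> t) = t"
    using solution_on[OF sub] by auto
  show thesis
  proof (rule that[of u \<eta>])
    show "filterlim \<eta> (at_left (1 / \<bar>lam\<bar>)) at_top" if "lam \<noteq> 0"
    proof (rule clock_inverse_at_left[OF that])
      show "\<forall>\<^sub>F t in at_top. 0 \<le> t \<and> \<eta> t \<in> Dom lam \<and> clock lam (\<eta> t) = t"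
        using eventually_ge_at_top[of 0] by eventually_elim (use u(4) in auto)
    qed (rule eventually_gt_at_top)
  qed (use u in auto)
qed

text \<open>\<open>T\<close> is the supremum of the clock over nonnegative \<eta>. It is not
  attained, since \<open>Dom\<close> has no greatest element and the clock is strictly increasing;
  so times in \<open>[0, T)\<close> correspond to all \<eta> from 0 to the endpoint.\<close>

lemma finite_time_solution:
  assumes lam: "lam \<noteq> 0" and bd: "\<exists>C. \<forall>e. 0 \<le> e \<and> e \<in> Dom lam \<longrightarrow> clock lam e \<le> C"
  obtains T u \<eta> where "T > 0" "is_solution lam sine_data {0..<T} u" "\<exists>\<gamma>. is_flow u {0..<T} \<gamma>"
    "\<And>\<gamma> a t. is_flow u {0..<T} \<gamma> \<Longrightarrow> a \<in> {0..1} \<Longrightarrow> t \<in> {0..<T} \<Longrightarrow> ux u (\<gamma> a t) t = vv lam a (\<eta> t)"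
    "filterlim \<eta> (at_left (1 / \<bar>lam\<bar>)) (at_left T)"
    "\<And>t. t \<in> {0..<T} \<Longrightarrow> 0 \<le> \<eta> t \<and> \<eta> t \<in> Dom lam"
proof -
  define A where "A = clock lam ` {e. 0 \<le> e \<and> e \<in> Dom lam}"
  define T where "T = Sup A"
  have A: "A \<noteq> {}" "bdd_above A"
    using bd zero_Dom by (auto simp: A_def bdd_above_def)
  have lt: "clock lam e < T" if e: "0 \<le> e" "e \<in> Dom lam" for e
  proof -
    obtain e' where e': "e < e'" "e' < 1 / \<bar>lam\<bar>"
      using Dom_iff[OF lam e(1)] e(2) dense by blast
    then have e'D: "0 \<le> e'" "e' \<in> Dom lam" using Dom_iff[OF lam, of e'] e by auto
    have "clock lam e < clock lam e'" by (rule clock_strict_mono[OF e(2) e'D(2) e'(1)])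
    also have "\<dots> \<le> T" unfolding T_def using e'D by (intro cSup_upper A) (auto simp: A_def)
    finally show ?thesis .
  qed
  have T: "T > 0" using lt[OF _ zero_Dom] by simp
  have sub: "{0..<T} \<subseteq> clock lam ` Dom lam"
  proof
    fix t assume t: "t \<in> {0..<T}"
    then obtain y where "y \<in> A" "t < y" using less_cSup_iff[OF A] unfolding T_def by auto
    then obtain e where "0 \<le> e" "e \<in> Dom lam" "t < clock lam e" by (auto simp: A_def)
    then show "t \<in> clock lam ` Dom lam" using t by (intro clock_surj[of t lam e]) auto
  qed
  obtain u \<eta> where u: "is_solution lam sine_data {0..<T} u" "\<exists>\<gamma>. is_flow u {0..<T} \<gamma>"
    "\<And>\<gamma> a t. is_flow u {0..<T} \<gamma> \<Longrightarrow> a \<in> {0..1} \<Longrightarrow> t \<in> {0..<T} \<Longrightarrow> ux u (\<gamma> a t) t = vv lam a (\<eta> t)"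
    "\<And>t. t \<in> {0..<T} \<Longrightarrow> \<eta> t \<in> Dom lam \<and> clock lam (\<eta> t) = t"
    using solution_on[OF sub] T by auto
  show thesis
  proof (rule that[of T u \<eta>])
    have ev: "\<forall>\<^sub>F t in at_left T. l < t \<and> t < T" if "l < T" for l
      using eventually_at_left_real[OF that] by eventually_elim auto
    show "filterlim \<eta> (at_left (1 / \<bar>lam\<bar>)) (at_left T)"
    proof (rule clock_inverse_at_left[OF lam])
      show "\<forall>\<^sub>F t in at_left T. 0 \<le> t \<and> \<eta> t \<in> Dom lam \<and> clock lam (\<eta> t) = t"
        using ev[OF T] by eventually_elim (use u(4) in auto)
      show "\<forall>\<^sub>F t in at_left T. clock lam e < t" if "0 \<le> e" "e \<in> Dom lam" for e
        using ev[OF lt[OF that]] by eventually_elim auto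
    qed
    show "0 \<le> \<eta> t \<and> \<eta> t \<in> Dom lam" if "t \<in> {0..<T}" for t
      using u(4)[OF that] that clock_inverse_nonneg[of "\<eta> t" lam] by auto
  qed (use u T in auto)
qed

text \<open>Real \<open>SUP\<close> and \<open>INF\<close> are informative only for bounded
  families; at fixed \<open>e\<close> the bound on \<open>rr\<close> supplies this.\<close>

lemma Mfun_mfun_bounds:
  assumes "\<And>a. a \<in> {0..1} \<Longrightarrow> ux u (\<gamma> a t) t = vv lam a e" "e \<in> Dom lam" "b \<in> {0..1}"
  shows "vv lam b e \<le> Mfun u \<gamma> t" "mfun u \<gamma> t \<le> vv lam b e"
proof -
  define R where "R = hh lam e * (1 / (1 - \<bar>lam * e\<bar>) + \<bar>PP lam e\<bar>)"
  have "\<bar>vv lam a e\<bar> \<le> R" for a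
  proof -
    have "\<bar>rr lam e a - PP lam e\<bar> \<le> 1 / (1 - \<bar>lam * e\<bar>) + \<bar>PP lam e\<bar>"
      using abs_rr_le[OF assms(2), of a] by linarith
    then show ?thesis
      unfolding vv_def abs_mult R_def using hh_pos[OF assms(2)] by (simp add: mult_left_mono)
  qed
  then have R: "vv lam a e \<le> R" "- R \<le> vv lam a e" for a by (simp_all add: abs_le_iff minus_le_iff)
  have eq: "(\<lambda>a. ux u (\<gamma> a t) t) ` {0..1} = (\<lambda>a. vv lam a e) ` {0..1}"
    using assms(1) by (intro image_cong) auto
  show "vv lam b e \<le> Mfun u \<gamma> t"
    unfolding Mfun_def eq using R(1) assms(3) by (intro cSUP_upper bdd_aboveI2)
  show "mfun u \<gamma> t \<le> vv lam b e"
    unfolding mfun_def eq using R(2) assms(3) by (intro cINF_lower bdd_belowI2)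
qed

section \<open>The sine datum: smoothness and extremal points\<close>

lemma deriv_sine_data: "deriv sine_data = cs"
  by (rule ext) (rule DERIV_imp_deriv[OF sine_data_deriv])

lemma smooth_periodic_sine_data: "smooth_periodic sine_data"
proof -
  \<comment> \<open>The span of sine and cosine is closed under differentiation, so induction over
    this form reaches all derivatives.\<close>
  have *: "\<exists>A B. (deriv ^^ n) sine_data = (\<lambda>x. A * sin (2 * pi * x) + B * cos (2 * pi * x))" for n
  proof (induction n)
    case 0
    have "(deriv ^^ 0) sine_data = (\<lambda>x. 1 / (2 * pi) * sin (2 * pi * x) + 0 * cos (2 * pi * x))"
      by (auto simp: sine_data_def)
    then show ?case by blast
  next
    case (Suc n)
    then obtain A B where AB: "(deriv ^^ n) sine_data = (\<lambda>x. A * sin (2 * pi * x) + B * cos (2 * pi * x))"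
      by blast
    have "deriv (\<lambda>x. A * sin (2 * pi * x) + B * cos (2 * pi * x)) x
        = (- 2 * pi * B) * sin (2 * pi * x) + (2 * pi * A) * cos (2 * pi * x)" for x
      by (rule DERIV_imp_deriv) (auto intro!: derivative_eq_intros)
    then have "(deriv ^^ Suc n) sine_data
        = (\<lambda>x. (- 2 * pi * B) * sin (2 * pi * x) + (2 * pi * A) * cos (2 * pi * x))"
      by (simp add: AB ext)
    then show ?case by blast
  qed
  have "((deriv ^^ n) sine_data) differentiable (at x)" for n x
  proof -
    obtain A B where "(deriv ^^ n) sine_data = (\<lambda>x. A * sin (2 * pi * x) + B * cos (2 * pi * x))"
      using * by blast
    moreover have "((\<lambda>x. A * sin (2 * pi * x) + B * cos (2 * pi * x)) has_real_derivative
        A * (cos (2 * pi * x) * (2 * pi)) + B * (- sin (2 * pi * x) * (2 * pi))) (at x)"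
      by (auto intro!: derivative_eq_intros)
    ultimately show ?thesis unfolding real_differentiable_def by auto
  qed
  then show ?thesis by (simp add: smooth_periodic_def sine_data_def distrib_left)
qed

lemma M0_sine_data: "M0 sine_data = 1"
  unfolding M0_def deriv_sine_data
proof (rule cSup_eq_maximum)
  show "1 \<in> cs ` {0..1}" by (rule image_eqI[of _ _ 0]) (auto simp: cs_def)
  show "y \<le> 1" if "y \<in> cs ` {0..1}" for y
    using that cs_bound by (auto simp: abs_le_iff)
qed

lemma m0_sine_data: "m0 sine_data = -1"
  unfolding m0_def deriv_sine_data
proof (rule cInf_eq_minimum)
  show "-1 \<in> cs ` {0..1}" by (rule image_eqI[of _ _ "1 / 2"]) (auto simp: cs_def)
  fix y assume "y \<in> cs ` {0..1}"
  then obtain a where "y = cs a" by blast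
  then show "-1 \<le> y" using cs_bound[of a] by linarith
qed

lemma max_pts_sine_data: "max_pts sine_data = {a \<in> {0..1}. cs a = 1}"
  by (simp add: max_pts_def M0_sine_data deriv_sine_data)

lemma min_pts_sine_data: "min_pts sine_data = {a \<in> {0..1}. cs a = -1}"
  by (simp add: min_pts_def m0_sine_data deriv_sine_data)

lemma finite_max_pts: "finite (max_pts sine_data)"
proof (rule finite_subset)
  show "max_pts sine_data \<subseteq> {0, 1}"
  proof
    fix a assume "a \<in> max_pts sine_data"
    then have a: "0 \<le> a" "a \<le> 1" "cs a = 1" by (auto simp: max_pts_sine_data)
    then obtain n :: int where "2 * pi * a = n * 2 * pi" using cos_one_2pi_int by (auto simp: cs_def)
    then have "a = n" by simp
    then show "a \<in> {0, 1}" using a by auto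
  qed
qed simp

lemma finite_min_pts: "finite (min_pts sine_data)"
proof (rule finite_subset)
  show "min_pts sine_data \<subseteq> {1 / 2}"
  proof
    fix a assume "a \<in> min_pts sine_data"
    then have a: "0 \<le> a" "a \<le> 1" "cs a = -1" by (auto simp: min_pts_sine_data)
    then obtain n :: int where "2 * pi * a = (2 * n + 1) * pi" using cos_eq_minus1 by (auto simp: cs_def)
    then have "2 * a = 2 * n + 1" by simp
    moreover from this have "n < 1" "-1 < n" using a by linarith+
    then have "n = 0" by simp
    ultimately show "a \<in> {1 / 2}" by simp
  qed
qed simp

lemma sine_data_global:
  assumes lam: "0 \<le> lam" "lam \<le> 1"
  shows "\<exists>u. is_solution lam sine_data {0..} u \<and> (\<exists>\<gamma>. is_flow u {0..} \<gamma>) \<and>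
    (\<forall>\<gamma>. is_flow u {0..} \<gamma> \<longrightarrow>
      (0 < lam \<and> lam < 1 \<longrightarrow> (\<forall>a\<in>{0..1}. ((\<lambda>t. ux u (\<gamma> a t) t) \<longlongrightarrow> 0) at_top)) \<and>
      (lam = 1 \<longrightarrow> (\<exists>L. (\<forall>a\<in>{0..1}. ((\<lambda>t. ux u (\<gamma> a t) t) \<longlongrightarrow> L a) at_top) \<and> (\<exists>a\<in>{0..1}. L a \<noteq> 0))))"
proof -
  have unb: "\<exists>e. 0 \<le> e \<and> e \<in> Dom lam \<and> clock lam e \<ge> C" for C
  proof (cases "lam = 0")
    case True
    have D: "Dom 0 = UNIV" by (simp add: Dom_def)
    \<comment> \<open>At \<open>lam = 0\<close> the clock speed is \<open>Kb powr 0 = 1\<close>, so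
      \<eta> is time itself and its range is unbounded.\<close>
    have "clock 0 e = e" for e
    proof -
      have "(\<lambda>e. Kb 0 e powr (2 * 0)) = (\<lambda>e. 1)"
        using Kb_pos[of _ 0] by (auto simp: D less_imp_neq[THEN not_sym])
      then show ?thesis by (simp add: clock_def prim_def)
    qed
    then show ?thesis using True D by (auto intro!: exI[of _ "max C 0"])
  next
    case False
    then show ?thesis using clock_unbounded[of lam C] lam by simp
  qed
  obtain u \<eta> where u: "is_solution lam sine_data {0..} u" "\<exists>\<gamma>. is_flow u {0..} \<gamma>"
    "\<And>\<gamma> a t. is_flow u {0..} \<gamma> \<Longrightarrow> a \<in> {0..1} \<Longrightarrow> t \<ge> 0 \<Longrightarrow> ux u (\<gamma> a t) t = vv lam a (\<eta> t)"
    "lam \<noteq> 0 \<Longrightarrow> filterlim \<eta> (at_left (1 / \<bar>lam\<bar>)) at_top"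
    using global_solution[OF unb] by blast
  have lim: "((\<lambda>t. ux u (\<gamma> a t) t) \<longlongrightarrow> l) at_top"
    if "is_flow u {0..} \<gamma>" "a \<in> {0..1}" "lam \<noteq> 0" "((\<lambda>e. vv lam a e) \<longlongrightarrow> l) (at_left (1 / \<bar>lam\<bar>))" for \<gamma> a l
  proof (rule Lim_transform_eventually)
    show "((\<lambda>t. vv lam a (\<eta> t)) \<longlongrightarrow> l) at_top"
      by (rule filterlim_compose[OF that(4) u(4)[OF that(3)]])
    show "\<forall>\<^sub>F t in at_top. vv lam a (\<eta> t) = ux u (\<gamma> a t) t"
      using eventually_ge_at_top[of 0] by eventually_elim (use u(3) that in auto)
  qed
  have "(0 < lam \<and> lam < 1 \<longrightarrow> (\<forall>a\<in>{0..1}. ((\<lambda>t. ux u (\<gamma> a t) t) \<longlongrightarrow> 0) at_top))"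
    "(lam = 1 \<longrightarrow> (\<exists>L. (\<forall>a\<in>{0..1}. ((\<lambda>t. ux u (\<gamma> a t) t) \<longlongrightarrow> L a) at_top) \<and> (\<exists>a\<in>{0..1}. L a \<noteq> 0)))"
    if fl: "is_flow u {0..} \<gamma>" for \<gamma>
  proof -
    show "(0 < lam \<and> lam < 1 \<longrightarrow> (\<forall>a\<in>{0..1}. ((\<lambda>t. ux u (\<gamma> a t) t) \<longlongrightarrow> 0) at_top))"
      using lim[OF fl] vv_tendsto_0 by auto
    have "\<forall>a\<in>{0..1}. ((\<lambda>t. ux u (\<gamma> a t) t) \<longlongrightarrow> (if cs a = 1 then 1 else -1)) at_top" if "lam = 1"
      using lim[OF fl] vv_1_tendsto that by auto
    then show "(lam = 1 \<longrightarrow> (\<exists>L. (\<forall>a\<in>{0..1}. ((\<lambda>t. ux u (\<gamma> a t) t) \<longlongrightarrow> L a) at_top) \<and> (\<exists>a\<in>{0..1}. L a \<noteq> 0)))"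
      by (auto intro!: exI[of _ "\<lambda>a. if cs a = 1 then 1 else -1"] bexI[of _ 0] split: if_splits)
  qed
  then show ?thesis using u(1,2) by blast
qed

text \<open>Carries divergence in \<eta> over to time by composing with \<open>\<eta>\<close>; a
  single diverging label in [0,1] suffices for the supremum or the infimum.\<close>

lemma blow_up_along_flow:
  assumes T: "T > (0::real)"
    and eq: "\<And>a t. a \<in> {0..1} \<Longrightarrow> t \<in> {0..<T} \<Longrightarrow> ux u (\<gamma> a t) t = vv lam a (\<eta> t)"
    and \<eta>: "filterlim \<eta> F (at_left T)" "\<And>t. t \<in> {0..<T} \<Longrightarrow> \<eta> t \<in> Dom lam"
    and a: "a \<in> {0..1}"
  shows "filterlim (\<lambda>e. vv lam a e) at_top F \<Longrightarrow> filterlim (Mfun u \<gamma>) at_top (at_left T)"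
    and "filterlim (\<lambda>e. vv lam a e) at_bot F \<Longrightarrow> filterlim (mfun u \<gamma>) at_bot (at_left T)"
    and "filterlim (\<lambda>e. vv lam a e) at_top F \<or> filterlim (\<lambda>e. vv lam a e) at_bot F \<Longrightarrow>
      filterlim (\<lambda>t. \<bar>ux u (\<gamma> a t) t\<bar>) at_top (at_left T)"
proof -
  have ev: "\<forall>\<^sub>F t in at_left T. t \<in> {0..<T}"
    using eventually_at_left_real[OF T] by eventually_elim auto
  show "filterlim (Mfun u \<gamma>) at_top (at_left T)" if "filterlim (\<lambda>e. vv lam a e) at_top F"
  proof (rule filterlim_at_top_mono[OF filterlim_compose[OF that \<eta>(1)]])
    show "\<forall>\<^sub>F t in at_left T. vv lam a (\<eta> t) \<le> Mfun u \<gamma> t"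
      using ev by eventually_elim (use Mfun_mfun_bounds(1) eq \<eta>(2) a in blast)
  qed
  show "filterlim (mfun u \<gamma>) at_bot (at_left T)" if "filterlim (\<lambda>e. vv lam a e) at_bot F"
  proof (rule filterlim_at_bot_mono[OF filterlim_compose[OF that \<eta>(1)]])
    show "\<forall>\<^sub>F t in at_left T. mfun u \<gamma> t \<le> vv lam a (\<eta> t)"
      using ev by eventually_elim (use Mfun_mfun_bounds(2) eq \<eta>(2) a in blast)
  qed
  assume "filterlim (\<lambda>e. vv lam a e) at_top F \<or> filterlim (\<lambda>e. vv lam a e) at_bot F"
  then have "filterlim (\<lambda>e. \<bar>vv lam a e\<bar>) at_top F"
    by (auto simp: filterlim_uminus_at_bot intro: always_eventually elim!: filterlim_at_top_mono)
  from filterlim_compose[OF this \<eta>(1)]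
  show "filterlim (\<lambda>t. \<bar>ux u (\<gamma> a t) t\<bar>) at_top (at_left T)"
    by (rule filterlim_at_top_mono) (use ev in eventually_elim, use eq a in auto)
qed

lemma sine_data_two_sided:
  assumes lam: "lam \<le> -2 \<or> 1 < lam"
  shows "\<exists>ts>0. \<exists>u. is_solution lam sine_data {0..<ts} u \<and> (\<exists>\<gamma>. is_flow u {0..<ts} \<gamma>) \<and>
    (\<forall>\<gamma>. is_flow u {0..<ts} \<gamma> \<longrightarrow>
       filterlim (Mfun u \<gamma>) at_top (at_left ts) \<and> filterlim (mfun u \<gamma>) at_bot (at_left ts) \<and>
       (\<forall>a\<in>{0..1} - (max_pts sine_data \<union> min_pts sine_data).
          filterlim (\<lambda>t. \<bar>ux u (\<gamma> a t) t\<bar>) at_top (at_left ts)))"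
proof -
  let ?F = "at_left (1 / \<bar>lam\<bar>)"
  have bd: "\<exists>C. \<forall>e. 0 \<le> e \<and> e \<in> Dom lam \<longrightarrow> clock lam e \<le> C"
    using lam clock_bounded_gt_1[of lam] clock_bounded_neg[of lam] by (cases "lam < 0") auto
  \<comment> \<open>Labels 0 and 1/2 are a maximum and a minimum of \<open>cs\<close>. For
    \<open>lam > 1\<close> all labels but the maxima go to minus infinity, for
    \<open>lam \<le> -2\<close> all but the minima go to plus infinity; the remaining extremum has
    its own lemma.\<close>
  have top: "filterlim (\<lambda>e. vv lam 0 e) at_top ?F"
    using lam vv_0_at_top[of lam] vv_at_top_neg[of lam 0] by (auto simp: cs_def)
  have bot: "filterlim (\<lambda>e. vv lam (1 / 2) e) at_bot ?F"
    using lam vv_half_at_bot[of lam] vv_at_bot[of lam "1 / 2"] by (auto simp: cs_def)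
  have gen: "filterlim (\<lambda>e. vv lam a e) at_top ?F \<or> filterlim (\<lambda>e. vv lam a e) at_bot ?F"
    if "cs a \<noteq> 1" "cs a \<noteq> -1" for a
  proof -
    have "cs a > -1" using that cs_bound[of a] by (simp add: abs_le_iff)
    then show ?thesis using lam vv_at_bot[of lam a] vv_at_top_neg[of lam a] that by auto
  qed
  have "lam \<noteq> 0" using lam by auto
  from finite_time_solution[OF this bd]
  obtain T u \<eta> where T: "T > 0" and u: "is_solution lam sine_data {0..<T} u" "\<exists>\<gamma>. is_flow u {0..<T} \<gamma>"
    "\<And>\<gamma> a t. is_flow u {0..<T} \<gamma> \<Longrightarrow> a \<in> {0..1} \<Longrightarrow> t \<in> {0..<T} \<Longrightarrow> ux u (\<gamma> a t) t = vv lam a (\<eta> t)"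
    "filterlim \<eta> ?F (at_left T)" "\<And>t. t \<in> {0..<T} \<Longrightarrow> 0 \<le> \<eta> t \<and> \<eta> t \<in> Dom lam"
    by blast
  have "filterlim (Mfun u \<gamma>) at_top (at_left T) \<and> filterlim (mfun u \<gamma>) at_bot (at_left T) \<and>
       (\<forall>a\<in>{0..1} - (max_pts sine_data \<union> min_pts sine_data).
          filterlim (\<lambda>t. \<bar>ux u (\<gamma> a t) t\<bar>) at_top (at_left T))" if fl: "is_flow u {0..<T} \<gamma>" for \<gamma>
  proof (intro conjI ballI)
    note * = blow_up_along_flow[OF T u(3)[OF fl] u(4) conjunct2[OF u(5)]]
    show "filterlim (Mfun u \<gamma>) at_top (at_left T)" by (rule *(1)[of 0]) (use top in auto)
    show "filterlim (mfun u \<gamma>) at_bot (at_left T)" by (rule *(2)[of "1 / 2"]) (use bot in auto)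
    show "filterlim (\<lambda>t. \<bar>ux u (\<gamma> a t) t\<bar>) at_top (at_left T)"
      if "a \<in> {0..1} - (max_pts sine_data \<union> min_pts sine_data)" for a
      by (rule *(3)) (use that gen[of a] in \<open>auto simp: max_pts_sine_data min_pts_sine_data\<close>)
  qed
  then show ?thesis using T u(1,2) by blast
qed

lemma sine_data_one_sided:
  assumes lam: "-2 < lam" "lam < 0"
  shows "\<exists>ts>0. \<exists>u. is_solution lam sine_data {0..<ts} u \<and> (\<exists>\<gamma>. is_flow u {0..<ts} \<gamma>) \<and>
    (\<forall>\<gamma>. is_flow u {0..<ts} \<gamma> \<longrightarrow>
       filterlim (mfun u \<gamma>) at_bot (at_left ts) \<and>
       (\<forall>a\<in>{0..1} - min_pts sine_data. bounded ((\<lambda>t. ux u (\<gamma> a t) t) ` {0..<ts})))"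
proof -
  let ?F = "at_left (1 / \<bar>lam\<bar>)"
  have bot: "filterlim (\<lambda>e. vv lam (1 / 2) e) at_bot ?F"
    by (rule vv_half_at_bot[OF lam(2)])
  from finite_time_solution[OF less_imp_neq[OF lam(2)] clock_bounded_neg[OF lam(2)]]
  obtain T u \<eta> where T: "T > 0" and u: "is_solution lam sine_data {0..<T} u" "\<exists>\<gamma>. is_flow u {0..<T} \<gamma>"
    "\<And>\<gamma> a t. is_flow u {0..<T} \<gamma> \<Longrightarrow> a \<in> {0..1} \<Longrightarrow> t \<in> {0..<T} \<Longrightarrow> ux u (\<gamma> a t) t = vv lam a (\<eta> t)"
    "filterlim \<eta> ?F (at_left T)" "\<And>t. t \<in> {0..<T} \<Longrightarrow> 0 \<le> \<eta> t \<and> \<eta> t \<in> Dom lam"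
    by blast
  have "filterlim (mfun u \<gamma>) at_bot (at_left T) \<and>
       (\<forall>a\<in>{0..1} - min_pts sine_data. bounded ((\<lambda>t. ux u (\<gamma> a t) t) ` {0..<T}))"
    if fl: "is_flow u {0..<T} \<gamma>" for \<gamma>
  proof (intro conjI ballI)
    note * = blow_up_along_flow[OF T u(3)[OF fl] u(4) conjunct2[OF u(5)]]
    show "filterlim (mfun u \<gamma>) at_bot (at_left T)" by (rule *(2)[of "1 / 2"]) (use bot in auto)
    fix a assume a: "a \<in> {0..1} - min_pts sine_data"
    then have "cs a > -1" using cs_bound[of a] by (auto simp: abs_le_iff min_pts_sine_data)
    then obtain C where "\<And>e. 0 \<le> e \<Longrightarrow> e \<in> Dom lam \<Longrightarrow> \<bar>vv lam a e\<bar> \<le> C"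
      using vv_bounded_neg[OF lam] by blast
    then show "bounded ((\<lambda>t. ux u (\<gamma> a t) t) ` {0..<T})"
      using u(3)[OF fl] u(5) a by (auto simp: bounded_iff intro!: exI[of _ C])
  qed
  then show ?thesis using T u(1,2) by blast
qed

theorem mainTheorem1:
  shows "\<exists>u0. smooth_periodic u0 \<and> M0 u0 > 0 \<and> m0 u0 < 0 \<and>
      finite (max_pts u0) \<and> finite (min_pts u0) \<and>
    \<comment> \<open>(1) global existence for lam in [0,1]\<close>
    (\<forall>lam::real. 0 \<le> lam \<and> lam \<le> 1 \<longrightarrow>
       (\<exists>u. is_solution lam u0 {0..} u \<and> (\<exists>\<gamma>. is_flow u {0..} \<gamma>) \<and>
          (\<forall>\<gamma>. is_flow u {0..} \<gamma> \<longrightarrow>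
             (0 < lam \<and> lam < 1 \<longrightarrow>
                (\<forall>\<alpha>\<in>{0..1}. ((\<lambda>t. ux u (\<gamma> \<alpha> t) t) \<longlongrightarrow> 0) at_top)) \<and>
             (lam = 1 \<longrightarrow>
                (\<exists>L. (\<forall>\<alpha>\<in>{0..1}. ((\<lambda>t. ux u (\<gamma> \<alpha> t) t) \<longlongrightarrow> L \<alpha>) at_top) \<and>
                     (\<exists>\<alpha>\<in>{0..1}. L \<alpha> \<noteq> 0)))))) \<and>
    \<comment> \<open>(2) two-sided everywhere blow-up\<close>
    (\<forall>lam::real. lam \<le> -2 \<or> 1 < lam \<longrightarrow>
       (\<exists>ts>0. \<exists>u. is_solution lam u0 {0..<ts} u \<and> (\<exists>\<gamma>. is_flow u {0..<ts} \<gamma>) \<and>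
          (\<forall>\<gamma>. is_flow u {0..<ts} \<gamma> \<longrightarrow>
             filterlim (Mfun u \<gamma>) at_top (at_left ts) \<and>
             filterlim (mfun u \<gamma>) at_bot (at_left ts) \<and>
             (\<forall>\<alpha>\<in>{0..1} - (max_pts u0 \<union> min_pts u0).
                filterlim (\<lambda>t. \<bar>ux u (\<gamma> \<alpha> t) t\<bar>) at_top (at_left ts))))) \<and>
    \<comment> \<open>(3) one-sided discrete blow-up\<close>
    (\<forall>lam::real. -2 < lam \<and> lam < 0 \<longrightarrow>
       (\<exists>ts>0. \<exists>u. is_solution lam u0 {0..<ts} u \<and> (\<exists>\<gamma>. is_flow u {0..<ts} \<gamma>) \<and>
          (\<forall>\<gamma>. is_flow u {0..<ts} \<gamma> \<longrightarrow>
             filterlim (mfun u \<gamma>) at_bot (at_left ts) \<and>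
             (\<forall>\<alpha>\<in>{0..1} - min_pts u0.
                bounded ((\<lambda>t. ux u (\<gamma> \<alpha> t) t) ` {0..<ts})))))"
proof (rule exI[of _ sine_data], intro conjI)
  show "smooth_periodic sine_data" by (rule smooth_periodic_sine_data)
  show "M0 sine_data > 0" "m0 sine_data < 0" by (simp_all add: M0_sine_data m0_sine_data)
  show "finite (max_pts sine_data)" by (rule finite_max_pts)
  show "finite (min_pts sine_data)" by (rule finite_min_pts)
qed (intro allI impI, (elim conjE)?,
    rule sine_data_global sine_data_two_sided sine_data_one_sided, assumption+)+

end
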